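(* Let $\Omega\subset\mathbb{R}^d$ be any open set, $p\in(1,\infty)$ and $\{s_n\}\subset(0,1)$ a non-decreasing sequence with $s_n\nearrow\sigma\in(0,1]$. Let $\{\psi_n\}$ be a sequence of functions with $\psi_n\in\Lambda^{s_n,p}_0(\Omega)$ for all $n\in\mathbb{N}$, such that $\Pi_{s_n}(\psi_n)\rightharpoonup\Pi_\sigma(\psi)$ weakly in $\mathbb{L}^p(\Omega)$ for some $\psi\in\Lambda^{\sigma,p}_0(\Omega)$, and $\psi_n\leq\psi$ for all $n$. Then $K^{s_n}_{\geq\psi_n}$ converges in the generalized sense of Mosco to $K^\sigma_{\geq\psi}$, where $K^s_{\geq\psi}=\{v\in\Lambda^{s,p}_0(\Omega):v\geq\psi\}$.
   Context: Fractional gradient. For $r\in(0,1)$ and $\varphi\in C_c^\infty(\mathbb{R}^d)$ let $I_r\varphi(x)=\frac{\mu_{d,1-r}}{d-r}\int_{\mathbb{R}^d}\frac{\varphi(y)}{|x-y|^{d-r}}\,dy$ be the Riesz potential, where $\mu_{d,s}=\frac{2^s\Gamma((d+s+1)/2)}{\pi^{d/2}\Gamma((1-s)/2)}$. For $s\in(0,1)$, $D^s\varphi=D(I_{1-s}\varphi)$, where $D$ is the classical gradient; $D^1=D$. For $\Phi\in C^\infty_c(\mathbb{R}^d;\mathbb{R}^d)$, $D^s\cdot\Phi=\sum_{j=1}^d (D^s\Phi_j)_j$. For $0<s<1$ and $u\in L^p(\mathbb{R}^d)$, the weak $s$-fractional gradient $D^su$ is the function $\Gamma\in L^1_{\mathrm{loc}}(\mathbb{R}^d;\mathbb{R}^d)$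 (if it exists) such that $\int u\,D^s\cdot\Phi\,dx=-\int\Gamma\cdot\Phi\,dx$ for all $\Phi\in C_c^\infty(\mathbb{R}^d;\mathbb{R}^d)$. Spaces. $\Lambda^{s,p}(\mathbb{R}^d)=\{u\in L^p(\mathbb{R}^d): D^su\in L^p(\mathbb{R}^d;\mathbb{R}^d)\}$ with norm $(\|u\|^p_{L^p(\mathbb{R}^d)}+\|D^su\|^p_{L^p(\mathbb{R}^d;\mathbb{R}^d)})^{1/p}$; $\Lambda^{1,p}(\mathbb{R}^d)=W^{1,p}(\mathbb{R}^d)$. For $\Omega$ open, $\Lambda^{s,p}_0(\Omega)$ is the closure of $C^\infty_c(\Omega)$ in $\Lambda^{s,p}(\mathbb{R}^d)$, with the same norm; its elements vanish a.e. outside $\Omega$. $L^p_0(\Omega)=\{u\in L^p(\mathbb{R}^d):u=0\text{ a.e. in }\mathbb{R}^d\setminus\Omega\}$. Generalized Mosco convergence. Let $\mathbb{L}^p(\Omega)=L^p_0(\Omega)\times L^p(\mathbb{R}^d;\mathbb{R}^d)$ and $\Pi_s:\Lambda^{s,p}_0(\Omega)\to\mathbb{L}^p(\Omega)$, $\Pi_s(u)=(u,D^su)$. For $s_n\to\sigma$ and convex sets $K_n\subset\Lambda^{s_n,p}_0(\Omega)$, $K\subset\Lambda^{\sigma,p}_0(\Omega)$, $K_n$ converges in the generalized sense of Mosco to $K$ if: (M1) for every $u\in K$ there is a sequence $\{u_n\}$ with $u_n\in K_n$ such that $\Pi_{s_n}(u_n)\to\Pi_\sigma(u)$ in $\mathbb{L}^p(\Omega)$;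 (M2) if there exist a sequence $\{u_n\}$ with $u_n\in K_n$ and a function $u\in\Lambda^{\sigma,p}_0(\Omega)$ such that $\Pi_{s_n}(u_n)\rightharpoonup\Pi_\sigma(u)$ weakly in $\mathbb{L}^p(\Omega)$, then $u\in K$. *)

theory Defs
  imports "HOL-Analysis.Analysis"
begin

text \<open>
  \<open>\<real>\<^sup>d\<close> is an arbitrary type \<open>'a::euclidean_space\<close> with \<open>d = DIM('a)\<close>; the components of a vector
  \<open>v\<close> are \<open>v \<bullet> b\<close> for \<open>b \<in> Basis\<close>. Elements of Lebesgue and Sobolev-type spaces are represented by
  functions, so equalities and inequalities between them are understood almost everywhere.
\<close>

fun Ck :: "nat \<Rightarrow> ('a::euclidean_space \<Rightarrow> 'b::euclidean_space) \<Rightarrow> bool" where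
  "Ck 0 f \<longleftrightarrow> continuous_on UNIV f"
| "Ck (Suc k) f \<longleftrightarrow> (\<forall>x. f differentiable (at x)) \<and>
     (\<forall>v. Ck k (\<lambda>x. frechet_derivative f (at x) v))"

definition Cc_infty :: "'a::euclidean_space set \<Rightarrow> ('a \<Rightarrow> 'b::euclidean_space) set" where
  "Cc_infty \<Omega> = {f. (\<forall>k. Ck k f) \<and> compact (closure {x. f x \<noteq> 0}) \<and> closure {x. f x \<noteq> 0} \<subseteq> \<Omega>}"

definition Lp :: "real \<Rightarrow> ('a::euclidean_space \<Rightarrow> 'b::euclidean_space) set" where
  "Lp p = {f. f \<in> borel_measurable lebesgue \<and> integrable lebesgue (\<lambda>x. norm (f x) powr p)}"

definition Lp_norm :: "real \<Rightarrow> ('a::euclidean_space \<Rightarrow> 'b::euclidean_space) \<Rightarrow> real" where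
  "Lp_norm p f = (LINT x|lebesgue. norm (f x) powr p) powr (1 / p)"

definition L1_loc :: "('a::euclidean_space \<Rightarrow> 'b::euclidean_space) set" where
  "L1_loc = {f. f \<in> borel_measurable lebesgue \<and>
                (\<forall>C. compact C \<longrightarrow> set_integrable lebesgue C f)}"

definition Lp0 :: "real \<Rightarrow> 'a::euclidean_space set \<Rightarrow> ('a \<Rightarrow> real) set" where
  "Lp0 p \<Omega> = {u \<in> Lp p. AE x in lebesgue. x \<notin> \<Omega> \<longrightarrow> u x = 0}"

subsection \<open>The fractional gradient\<close>

definition frac_const :: "nat \<Rightarrow> real \<Rightarrow> real" where
  "frac_const d s =
     2 powr s * Gamma ((real d + s + 1) / 2) / (pi powr (real d / 2) * Gamma ((1 - s) / 2))"

definition riesz :: "real \<Rightarrow> ('a::euclidean_space \<Rightarrow> real) \<Rightarrow> 'a \<Rightarrow> real" where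
  "riesz r \<phi> x = frac_const DIM('a) (1 - r) / (real DIM('a) - r) *
     (LINT y|lebesgue. \<phi> y / norm (x - y) powr (real DIM('a) - r))"

definition grad :: "('a::euclidean_space \<Rightarrow> real) \<Rightarrow> 'a \<Rightarrow> 'a" where
  "grad f x = (THE D. GDERIV f x :> D)"

definition fgrad :: "real \<Rightarrow> ('a::euclidean_space \<Rightarrow> real) \<Rightarrow> 'a \<Rightarrow> 'a" where
  "fgrad s \<phi> = (if s = 1 then grad \<phi> else grad (riesz (1 - s) \<phi>))"

definition fdiv :: "real \<Rightarrow> ('a::euclidean_space \<Rightarrow> 'a) \<Rightarrow> 'a \<Rightarrow> real" where
  "fdiv s \<Phi> x = (\<Sum>b\<in>Basis. fgrad s (\<lambda>y. \<Phi> y \<bullet> b) x \<bullet> b)"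

text \<open>
  For \<open>s = 1\<close> the next definition is that of the usual weak gradient. It is only used for
  \<open>u\<close> in some \<open>L\<^sup>p\<close>, where the left-hand integrals exist.
\<close>

definition is_weak_fgrad :: "real \<Rightarrow> ('a::euclidean_space \<Rightarrow> real) \<Rightarrow> ('a \<Rightarrow> 'a) \<Rightarrow> bool" where
  "is_weak_fgrad s u \<Gamma> \<longleftrightarrow> \<Gamma> \<in> L1_loc \<and>
     (\<forall>\<Phi> \<in> Cc_infty UNIV.
        (LINT x|lebesgue. u x * fdiv s \<Phi> x) = - (LINT x|lebesgue. \<Gamma> x \<bullet> \<Phi> x))"

text \<open>The weak gradient is unique only up to null sets; \<open>wgrad\<close> selects a representative.\<close>

definition wgrad :: "real \<Rightarrow> ('a::euclidean_space \<Rightarrow> real) \<Rightarrow> 'a \<Rightarrow> 'a" where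
  "wgrad s u = (SOME \<Gamma>. is_weak_fgrad s u \<Gamma>)"

text \<open>\<open>Lam 1 p\<close> is the Sobolev space \<open>W\<^sup>1\<^sup>,\<^sup>p\<close>.\<close>

definition Lam :: "real \<Rightarrow> real \<Rightarrow> ('a::euclidean_space \<Rightarrow> real) set" where
  "Lam s p = {u \<in> Lp p. \<exists>\<Gamma> \<in> Lp p. is_weak_fgrad s u \<Gamma>}"

definition Lam_norm :: "real \<Rightarrow> real \<Rightarrow> ('a::euclidean_space \<Rightarrow> real) \<Rightarrow> real" where
  "Lam_norm s p u = (Lp_norm p u powr p + Lp_norm p (wgrad s u) powr p) powr (1 / p)"

definition Lam0 :: "real \<Rightarrow> real \<Rightarrow> 'a::euclidean_space set \<Rightarrow> ('a \<Rightarrow> real) set" where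
  "Lam0 s p \<Omega> =
     {u \<in> Lam s p. \<forall>\<epsilon>>0. \<exists>\<phi> \<in> Cc_infty \<Omega>. Lam_norm s p (\<lambda>x. u x - \<phi> x) < \<epsilon>}"

subsection \<open>The product space and its weak and strong convergence\<close>

type_synonym 'a LL_elem = "('a \<Rightarrow> real) \<times> ('a \<Rightarrow> 'a)"

definition LL :: "real \<Rightarrow> 'a::euclidean_space set \<Rightarrow> 'a LL_elem set" where
  "LL p \<Omega> = Lp0 p \<Omega> \<times> Lp p"

definition LL_norm :: "real \<Rightarrow> 'a::euclidean_space LL_elem \<Rightarrow> real" where
  "LL_norm p X = (Lp_norm p (fst X) powr p + Lp_norm p (snd X) powr p) powr (1 / p)"

text \<open>The linear combination \<open>a X + b Y\<close>; function types carry no real vector space structure.\<close>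

definition LL_lin ::
    "real \<Rightarrow> 'a::euclidean_space LL_elem \<Rightarrow> real \<Rightarrow> 'a LL_elem \<Rightarrow> 'a LL_elem" where
  "LL_lin a X b Y =
     (\<lambda>x. a * fst X x + b * fst Y x, \<lambda>x. a *\<^sub>R snd X x + b *\<^sub>R snd Y x)"

text \<open>
  The continuous dual. The bound also makes a functional invariant under changes of its argument
  on null sets.
\<close>

definition LL_dual :: "real \<Rightarrow> 'a::euclidean_space set \<Rightarrow> ('a LL_elem \<Rightarrow> real) set" where
  "LL_dual p \<Omega> = {F.
     (\<forall>X \<in> LL p \<Omega>. \<forall>Y \<in> LL p \<Omega>. \<forall>a b. F (LL_lin a X b Y) = a * F X + b * F Y) \<and>
     (\<exists>C. \<forall>X \<in> LL p \<Omega>. \<bar>F X\<bar> \<le> C * LL_norm p X)}"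

definition LL_strong ::
    "real \<Rightarrow> (nat \<Rightarrow> 'a::euclidean_space LL_elem) \<Rightarrow> 'a LL_elem \<Rightarrow> bool" where
  "LL_strong p X L \<longleftrightarrow> (\<lambda>n. LL_norm p (LL_lin 1 (X n) (-1) L)) \<longlonglongrightarrow> 0"

definition LL_weak ::
    "real \<Rightarrow> 'a::euclidean_space set \<Rightarrow> (nat \<Rightarrow> 'a LL_elem) \<Rightarrow> 'a LL_elem \<Rightarrow> bool" where
  "LL_weak p \<Omega> X L \<longleftrightarrow> (\<forall>F \<in> LL_dual p \<Omega>. (\<lambda>n. F (X n)) \<longlonglongrightarrow> F L)"

definition Pi_s :: "real \<Rightarrow> ('a::euclidean_space \<Rightarrow> real) \<Rightarrow> 'a LL_elem" where
  "Pi_s s u = (u, wgrad s u)"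

subsection \<open>Generalized Mosco convergence\<close>

definition convex_fun_set :: "('a \<Rightarrow> real) set \<Rightarrow> bool" where
  "convex_fun_set K \<longleftrightarrow>
     (\<forall>u \<in> K. \<forall>v \<in> K. \<forall>t. 0 \<le> t \<and> t \<le> 1 \<longrightarrow> (\<lambda>x. (1 - t) * u x + t * v x) \<in> K)"

text \<open>
  The notion is defined for orders \<open>s\<^sub>n \<rightarrow> \<sigma>\<close> and convex subsets of the spaces \<open>Lam0\<close>; these side
  conditions are made part of the definition.
\<close>

definition mosco_conv ::
    "real \<Rightarrow> 'a::euclidean_space set \<Rightarrow> (nat \<Rightarrow> real) \<Rightarrow> real \<Rightarrow>
     (nat \<Rightarrow> ('a \<Rightarrow> real) set) \<Rightarrow> ('a \<Rightarrow> real) set \<Rightarrow> bool" where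
  "mosco_conv p \<Omega> s \<sigma> Kn K \<longleftrightarrow>
     s \<longlonglongrightarrow> \<sigma> \<and>
     (\<forall>n. Kn n \<subseteq> Lam0 (s n) p \<Omega> \<and> convex_fun_set (Kn n)) \<and>
     K \<subseteq> Lam0 \<sigma> p \<Omega> \<and> convex_fun_set K \<and>
     (\<forall>u \<in> K. \<exists>un. (\<forall>n. un n \<in> Kn n) \<and>
        LL_strong p (\<lambda>n. Pi_s (s n) (un n)) (Pi_s \<sigma> u)) \<and>
     (\<forall>un. \<forall>u \<in> Lam0 \<sigma> p \<Omega>. (\<forall>n. un n \<in> Kn n) \<and>
        LL_weak p \<Omega> (\<lambda>n. Pi_s (s n) (un n)) (Pi_s \<sigma> u) \<longrightarrow> u \<in> K)"

definition obstacle_set ::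
    "real \<Rightarrow> real \<Rightarrow> 'a::euclidean_space set \<Rightarrow> ('a \<Rightarrow> real) \<Rightarrow> ('a \<Rightarrow> real) set" where
  "obstacle_set s p \<Omega> \<psi> = {v \<in> Lam0 s p \<Omega>. AE x in lebesgue. v x \<ge> \<psi> x}"

end

theory Submission
  imports Defs "HOL-Probability.Probability"
begin

text \<open>
  An element \<open>u\<close> of the limit set lies above \<open>\<psi>\<close>, hence above every \<open>\<psi>n n\<close>. So the constant sequence \<open>u\<close> is a
  recovery sequence as soon as \<open>u\<close> belongs to the spaces of lower order \<open>s n\<close> and its gradients of order
  \<open>s n\<close> converge in \<open>L\<^sup>p\<close> to the one of order \<open>\<sigma>\<close> (\<open>Lam0_lower_order\<close>, \<open>wgrad_tendsto_from_below\<close>). The second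
  condition of Mosco is the stability of inequalities under weak limits (\<open>LL_weak_le\<close>).

  It remains to compare gradients of different orders. Formally the gradient of order \<open>s\<close> is the Riesz
  potential of order \<open>\<sigma> - s\<close> of the gradient of order \<open>\<sigma>\<close>, but Riesz potentials are not bounded on \<open>L\<^sup>p\<close>; the
  low frequencies have to be estimated by \<open>u\<close> itself. The heat flow separates the two regimes. The Riesz
  kernel is a mixture of heat kernels over the times \<open>nu ((1 - s) / 2)\<close>, where \<open>nu a\<close> has the density
  \<open>t powr (a - 1) / Gamma a\<close> (\<open>fgrad_eq_flow_grad\<close>), and the measures \<open>nu a\<close> form a convolution semigroup. With
  \<open>a = (\<sigma> - s) / 2\<close> and \<open>b = (1 - \<sigma>) / 2\<close> each time is a sum \<open>t + \<tau>\<close>, with \<open>t\<close> from \<open>nu a\<close> and \<open>\<tau>\<close> from \<open>nu b\<close>. For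
  \<open>t \<le> 1\<close> the time \<open>\<tau>\<close> rebuilds the gradient of order \<open>\<sigma>\<close>, which is then averaged by a kernel of mass
  \<open>1 / Gamma (a + 1)\<close>. For \<open>t > 1\<close> the derivative is moved to the heat kernel, whose gradient has an integral
  of order \<open>(t + \<tau>) powr (-1/2)\<close>; this converges because \<open>s > 0\<close> (\<open>flow_grad_decomposition\<close>). By Minkowski's
  integral inequality both parts are bounded on \<open>L\<^sup>p\<close>, without any singular integrals, and so the formula
  extends to the closure of the test functions.

  As \<open>s\<close> increases to \<open>\<sigma>\<close>, the first part is an approximate identity and the second carries the factor
  \<open>1 / Gamma a\<close>, which tends to 0. The case \<open>\<sigma> = 1\<close> needs no separate argument, since \<open>nu 0\<close> is the Dirac measure at
  time 0. The weak gradients that occur in the definition of the spaces are identified by their uniqueness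
  (\<open>is_weak_fgrad_unique\<close>) and their closedness (\<open>is_weak_fgrad_closed\<close>).
\<close>

section \<open>Calculus of test functions\<close>

lemma frechet_derivative_eqI: "(f has_derivative f') (at x) \<Longrightarrow> frechet_derivative f (at x) = f'"
  using frechet_derivative_at by metis

lemma Ck_has_derivative:
  "Ck (Suc k) f \<Longrightarrow> (f has_derivative frechet_derivative f (at x)) (at x)"
  by (simp add: frechet_derivative_works[symmetric])

lemma Ck_SucI:
  assumes "\<And>x. (f has_derivative f' x) (at x)" "\<And>v. Ck k (\<lambda>x. f' x v)"
  shows "Ck (Suc k) f"
  using assms frechet_derivative_eqI[OF assms(1)] by (auto simp: differentiable_def)

lemma Ck_SucD: "Ck (Suc k) f \<Longrightarrow> Ck k f"
proof (induction k arbitrary: f)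
  case 0
  then show ?case
    by (auto simp: continuous_on_eq_continuous_at differentiable_imp_continuous_within)
qed auto

lemma Ck_const: "Ck k (\<lambda>x. c)"
  by (induction k arbitrary: c) (auto simp: frechet_derivative_const)

lemma Ck_add: "Ck k f \<Longrightarrow> Ck k g \<Longrightarrow> Ck k (\<lambda>x. f x + g x)"
proof (induction k arbitrary: f g)
  case 0
  then show ?case by (auto intro: continuous_intros)
next
  case (Suc k)
  show ?case
    by (rule Ck_SucI[OF has_derivative_add[OF Ck_has_derivative[OF Suc.prems(1)]
          Ck_has_derivative[OF Suc.prems(2)]]]) (use Suc in auto)
qed

lemma Ck_bounded_linear: "bounded_linear T \<Longrightarrow> Ck k f \<Longrightarrow> Ck k (\<lambda>x. T (f x))"
proof (induction k arbitrary: f)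
  case 0
  then show ?case
    by (auto intro: continuous_intros linear_continuous_on_compose simp: linear_conv_bounded_linear)
next
  case (Suc k)
  show ?case
    by (rule Ck_SucI[OF bounded_linear.has_derivative[OF Suc.prems(1)
          Ck_has_derivative[OF Suc.prems(2)]]]) (use Suc in auto)
qed

lemma Ck_mult:
  fixes f g :: "'a::euclidean_space \<Rightarrow> real"
  shows "Ck k f \<Longrightarrow> Ck k g \<Longrightarrow> Ck k (\<lambda>x. f x * g x)"
proof (induction k arbitrary: f g)
  case 0
  then show ?case by (auto intro: continuous_intros)
next
  case (Suc k)
  show ?case
  proof (rule Ck_SucI[OF has_derivative_mult[OF Ck_has_derivative[OF Suc.prems(1)]
          Ck_has_derivative[OF Suc.prems(2)]]])
    fix v
    show "Ck k (\<lambda>x. f x * frechet_derivative g (at x) v + frechet_derivative f (at x) v * g x)"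
      by (intro Ck_add Suc.IH) (use Suc.prems Ck_SucD in auto)
  qed
qed

lemma Ck_prod:
  fixes f :: "'i \<Rightarrow> 'a::euclidean_space \<Rightarrow> real"
  assumes "\<And>i. i \<in> I \<Longrightarrow> Ck k (f i)"
  shows "Ck k (\<lambda>x. \<Prod>i\<in>I. f i x)"
  using assms by (induction I rule: infinite_finite_induct) (auto intro: Ck_const Ck_mult)

lemma Ck_translate: "Ck k f \<Longrightarrow> Ck k (\<lambda>x. f (x - c))"
proof (induction k arbitrary: f)
  case 0
  then show ?case
    using continuous_on_compose2[of UNIV f UNIV "\<lambda>x. x - c"] by (simp add: continuous_intros)
next
  case (Suc k)
  have "((\<lambda>x. f (x - c)) has_derivative frechet_derivative f (at (x - c))) (at x)" for x
    by (rule has_derivative_compose[where f="\<lambda>x. x - c" and f'="\<lambda>h. h" and g=f, OF _ Ck_has_derivative[OF Suc.prems]])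
       (auto intro!: derivative_eq_intros)
  then show ?case
    by (rule Ck_SucI) (use Suc in auto)
qed

subsection \<open>Cutoffs\<close>

text \<open>Up to constants, the derivatives of \<open>exp (- 1 / t)\<close>, extended by 0 to the left half-line, are
  combinations of these functions. One induction for all exponents \<open>j\<close> therefore proves smoothness.\<close>

definition flat_exp :: "nat \<Rightarrow> real \<Rightarrow> real" where
  "flat_exp j t = (if t > 0 then exp (- 1 / t) / t ^ j else 0)"

lemma flat_exp_tendsto_0: "(flat_exp j \<longlongrightarrow> 0) (at 0)"
proof -
  have "((\<lambda>t. inverse t ^ j / exp (inverse t)) \<longlongrightarrow> 0) (at_right (0::real))"
    by (rule filterlim_compose[OF tendsto_power_div_exp_0 filterlim_inverse_at_top_right])
  then have r: "(flat_exp j \<longlongrightarrow> 0) (at_right 0)"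
    by (rule Lim_transform_eventually)
       (auto simp: flat_exp_def eventually_at_filter exp_minus field_simps)
  have l: "(flat_exp j \<longlongrightarrow> 0) (at_left 0)"
    by (rule Lim_transform_eventually[OF tendsto_const])
       (auto simp: flat_exp_def eventually_at_filter)
  show ?thesis using r l by (simp add: filterlim_at_split)
qed

lemma flat_exp_deriv:
  "(flat_exp j has_field_derivative (flat_exp (j + 2) t - real j * flat_exp (Suc j) t)) (at t)"
proof (cases t "0::real" rule: linorder_cases)
  case less
  have "((\<lambda>t. 0) has_field_derivative 0) (at t)" by simp
  then have "(flat_exp j has_field_derivative 0) (at t)"
    by (rule has_field_derivative_transform_within_open[where S="{..<0}"])
       (use less in \<open>auto simp: flat_exp_def\<close>)
  then show ?thesis using less by (simp add: flat_exp_def)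
next
  case equal
  have "((\<lambda>h. (flat_exp j (0 + h) - flat_exp j 0) / h) \<longlongrightarrow> 0) (at 0)"
    by (rule Lim_transform_eventually[OF flat_exp_tendsto_0[of "Suc j"]])
       (auto simp: flat_exp_def eventually_at_filter)
  then show ?thesis using equal by (simp add: DERIV_def flat_exp_def)
next
  case greater
  have "((\<lambda>t. exp (- 1 / t) / t ^ j) has_field_derivative
      (exp (- 1 / t) / t ^ (j + 2) - real j * (exp (- 1 / t) / t ^ Suc j))) (at t)"
    using greater
    apply (auto intro!: derivative_eq_intros)
    apply (cases j)
     apply (auto simp: field_simps power2_eq_square)
    done
  then have "(flat_exp j has_field_derivative
      (exp (- 1 / t) / t ^ (j + 2) - real j * (exp (- 1 / t) / t ^ Suc j))) (at t)"
    by (rule has_field_derivative_transform_within_open[where S="{0<..}"])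
       (use greater in \<open>auto simp: flat_exp_def\<close>)
  then show ?thesis using greater by (simp add: flat_exp_def)
qed

lemma Ck_flat_exp: "Ck k (\<lambda>x::'a::euclidean_space. flat_exp j (x \<bullet> b + c))"
proof (induction k arbitrary: j)
  case 0
  have "continuous_on UNIV (flat_exp j)"
    using flat_exp_deriv DERIV_isCont continuous_at_imp_continuous_on by blast
  then show ?case
    using continuous_on_compose2[of UNIV "flat_exp j" UNIV "\<lambda>x. x \<bullet> b + c"]
    by (simp add: continuous_intros)
next
  case (Suc k)
  let ?d = "\<lambda>x v. (flat_exp (j + 2) (x \<bullet> b + c) - real j * flat_exp (Suc j) (x \<bullet> b + c)) * (v \<bullet> b)"
  have d1: "((\<lambda>x. flat_exp j (x \<bullet> b + c)) has_derivative ?d x) (at x)" for x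
  proof -
    have "((\<lambda>x. x \<bullet> b + c) has_derivative (\<lambda>v. v \<bullet> b)) (at x)"
      by (auto intro!: derivative_eq_intros)
    from has_derivative_compose[OF this flat_exp_deriv[of j, unfolded has_field_derivative_def]]
    show ?thesis by simp
  qed
  have d2: "Ck k (\<lambda>x. ?d x v)" for v
    using Ck_mult[OF Ck_add[OF Suc.IH[of "j+2"] Ck_mult[OF Ck_const[of k "- real j"] Suc.IH[of "Suc j"]]]
       Ck_const[of k "v \<bullet> b"]]
    by simp
  show ?case by (rule Ck_SucI[where f'="?d", OF d1 d2])
qed

lemma flat_exp_0_bounds: "0 \<le> flat_exp 0 t" "flat_exp 0 t \<le> 1"
  by (auto simp: flat_exp_def)

text \<open>Dilations of a single smooth function approximate the indicator of a half-line from below by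
  functions with values in the unit interval.\<close>

lemma flat_exp_scaled_tendsto: "(\<lambda>n. flat_exp 0 (real n * t)) \<longlonglongrightarrow> (if t > 0 then 1 else 0)"
proof (cases "t > 0")
  case True
  have "(\<lambda>n. exp (- (inverse t * inverse (real n)))) \<longlonglongrightarrow> exp (- (inverse t * 0))"
    by (intro tendsto_intros lim_inverse_n)
  then have "(\<lambda>n. exp (- (inverse t * inverse (real n)))) \<longlonglongrightarrow> 1" by simp
  then have "(\<lambda>n. flat_exp 0 (real n * t)) \<longlonglongrightarrow> 1"
    by (rule Lim_transform_eventually)
       (use True in \<open>auto simp: flat_exp_def field_simps intro!: eventually_sequentiallyI[of 1]\<close>)
  then show ?thesis using True by simp
next
  case False
  then have "flat_exp 0 (real n * t) = 0" for n
    by (auto simp: flat_exp_def zero_less_mult_iff)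
  then show ?thesis using False by simp
qed

subsection \<open>Closure properties of test functions\<close>

lemma Cc_inftyI:
  assumes "\<And>k. Ck k f" "compact K" "K \<subseteq> \<Omega>" "\<And>x. x \<notin> K \<Longrightarrow> f x = 0"
  shows "f \<in> Cc_infty \<Omega>"
proof -
  have "closure {x. f x \<noteq> 0} \<subseteq> K"
    by (rule closure_minimal) (use assms compact_imp_closed in auto)
  moreover have "compact (closure {x. f x \<noteq> 0})"
    using \<open>closure _ \<subseteq> K\<close> assms(2)
    by (metis bounded_subset closed_closure compact_eq_bounded_closed)
  ultimately show ?thesis
    using assms unfolding Cc_infty_def by auto
qed

lemma Cc_inftyE:
  assumes "f \<in> Cc_infty \<Omega>"
  obtains K where "\<And>k. Ck k f" "compact K" "K \<subseteq> \<Omega>" "\<And>x. x \<notin> K \<Longrightarrow> f x = 0"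
proof (rule that)
  show "Ck k f" for k using assms by (simp add: Cc_infty_def)
  show "f x = 0" if "x \<notin> closure {x. f x \<noteq> 0}" for x
    using that closure_subset[of "{x. f x \<noteq> 0}"] by blast
qed (use assms in \<open>simp_all add: Cc_infty_def\<close>)

lemma Cc_infty_mono: "f \<in> Cc_infty A \<Longrightarrow> A \<subseteq> B \<Longrightarrow> f \<in> Cc_infty B"
  by (auto simp: Cc_infty_def)

lemma Cc_infty_add:
  assumes f: "f \<in> Cc_infty \<Omega>" and g: "g \<in> Cc_infty \<Omega>"
  shows "(\<lambda>x. f x + g x) \<in> Cc_infty \<Omega>"
proof (rule Cc_inftyE[OF f], rule Cc_inftyE[OF g])
  fix K L
  assume K: "\<And>k. Ck k f" "compact K" "K \<subseteq> \<Omega>" "\<And>x. x \<notin> K \<Longrightarrow> f x = 0"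
    and L: "\<And>k. Ck k g" "compact L" "L \<subseteq> \<Omega>" "\<And>x. x \<notin> L \<Longrightarrow> g x = 0"
  show ?thesis
    by (rule Cc_inftyI[OF Ck_add[OF K(1) L(1)] compact_Un[OF K(2) L(2)]]) (use K L in auto)
qed

lemma Cc_infty_linear:
  assumes T: "bounded_linear T" and f: "f \<in> Cc_infty \<Omega>"
  shows "(\<lambda>x. T (f x)) \<in> Cc_infty \<Omega>"
proof (rule Cc_inftyE[OF f])
  fix K
  assume K: "\<And>k. Ck k f" "compact K" "K \<subseteq> \<Omega>" "\<And>x. x \<notin> K \<Longrightarrow> f x = 0"
  show ?thesis
    by (rule Cc_inftyI[OF Ck_bounded_linear[OF T K(1)] K(2,3)])
       (use K(4) T in \<open>simp add: linear_simps\<close>)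
qed

lemma Cc_infty_deriv:
  assumes "f \<in> Cc_infty \<Omega>" shows "(\<lambda>x. frechet_derivative f (at x) v) \<in> Cc_infty \<Omega>"
proof -
  obtain K where K: "\<And>k. Ck k f" "compact K" "K \<subseteq> \<Omega>" "\<And>x. x \<notin> K \<Longrightarrow> f x = 0"
    by (rule Cc_inftyE[OF assms]) blast
  show ?thesis
  proof (rule Cc_inftyI[OF _ K(2,3)])
    show "Ck k (\<lambda>x. frechet_derivative f (at x) v)" for k using K(1)[of "Suc k"] by simp
    fix x assume x: "x \<notin> K"
    have "((\<lambda>x. 0) has_derivative (\<lambda>v. 0)) (at x)" by simp
    then have "(f has_derivative (\<lambda>v. 0)) (at x)"
      by (rule has_derivative_transform_within_open[where s="- K"])
         (use x K compact_imp_closed[OF K(2)] in \<open>auto simp: open_Compl\<close>)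
    then show "frechet_derivative f (at x) v = 0"
      by (simp add: frechet_derivative_eqI)
  qed
qed

lemma Cc_infty_translate:
  assumes "f \<in> Cc_infty UNIV" shows "(\<lambda>x. f (x - c)) \<in> Cc_infty UNIV"
proof -
  obtain K where K: "\<And>k. Ck k f" "compact K" "\<And>x. x \<notin> K \<Longrightarrow> f x = 0"
    by (rule Cc_inftyE[OF assms]) blast
  show ?thesis
    by (rule Cc_inftyI[OF Ck_translate[OF K(1)] compact_translation[OF K(2), of c]])
       (use K(3) in \<open>force simp: image_iff\<close>)+
qed

lemma Cc_infty_cont: "f \<in> Cc_infty \<Omega> \<Longrightarrow> continuous_on UNIV f"
  using Ck.simps(1)[of f] by (auto simp: Cc_infty_def)

lemma Cc_infty_deriv_works:
  "f \<in> Cc_infty \<Omega> \<Longrightarrow> (f has_derivative frechet_derivative f (at x)) (at x)"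
  by (rule Ck_has_derivative[of 0]) (auto simp: Cc_infty_def)

lemma Cc_infty_borel [measurable_dest]: "f \<in> Cc_infty \<Omega> \<Longrightarrow> f \<in> borel_measurable borel"
  by (simp add: Cc_infty_cont borel_measurable_continuous_onI)

lemma Cc_infty_bounded:
  assumes "f \<in> Cc_infty \<Omega>"
  obtains B R where "0 < B" "0 < R" "\<And>x. norm (f x) \<le> B" "\<And>x. norm x > R \<Longrightarrow> f x = 0"
proof -
  obtain K where K: "\<And>k. Ck k f" "compact K" "\<And>x. x \<notin> K \<Longrightarrow> f x = 0"
    by (rule Cc_inftyE[OF assms]) blast
  have "compact (f ` K)"
    by (rule compact_continuous_image[OF continuous_on_subset[OF Cc_infty_cont[OF assms]] K(2)]) auto
  then obtain B where B: "0 < B" "\<And>x. x \<in> K \<Longrightarrow> norm (f x) \<le> B"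
    using compact_imp_bounded[of "f ` K"] unfolding bounded_pos by auto
  obtain R where R: "0 < R" "\<And>x. x \<in> K \<Longrightarrow> norm x \<le> R"
    using compact_imp_bounded[OF K(2)] unfolding bounded_pos by auto
  show ?thesis
  proof
    show "norm (f x) \<le> B" for x using B K(3)[of x] by (cases "x \<in> K") auto
    show "f x = 0" if "norm x > R" for x using R(2)[of x] K(3)[of x] that by force
  qed (use B R in auto)
qed

subsection \<open>Gradients of test functions\<close>

lemma GDERIV_unique: "GDERIV f x :> D \<Longrightarrow> GDERIV f x :> E \<Longrightarrow> D = E"
  unfolding gderiv_def
  by (drule (1) has_derivative_unique) (metis inner_commute vector_eq_rdot)

lemma grad_eqI: "GDERIV f x :> D \<Longrightarrow> grad f x = D"
  unfolding grad_def using GDERIV_unique by blast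

lemma Cc_infty_GDERIV:
  assumes "f \<in> Cc_infty \<Omega>" shows "GDERIV f x :> grad f x"
proof -
  let ?f' = "frechet_derivative f (at x)"
  define D where "D = (\<Sum>b\<in>Basis. ?f' b *\<^sub>R b)"
  have d: "(f has_derivative ?f') (at x)" by (rule Cc_infty_deriv_works[OF assms])
  have "?f' h = h \<bullet> D" for h
  proof -
    have "?f' h = ?f' (\<Sum>b\<in>Basis. (h \<bullet> b) *\<^sub>R b)" by (simp add: euclidean_representation)
    also have "\<dots> = (\<Sum>b\<in>Basis. (h \<bullet> b) *\<^sub>R ?f' b)"
      using d by (simp add: has_derivative_linear linear_sum linear_scale)
    finally show ?thesis by (simp add: D_def inner_sum_right mult.commute)
  qed
  then have "GDERIV f x :> D" using d unfolding gderiv_def by (metis ext)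
  then show ?thesis by (simp add: grad_eqI)
qed

lemma Cc_infty_grad_inner:
  assumes "f \<in> Cc_infty \<Omega>" shows "frechet_derivative f (at x) v = v \<bullet> grad f x"
  using Cc_infty_GDERIV[OF assms, of x] by (simp add: gderiv_def frechet_derivative_eqI)

lemma Cc_infty_grad_comp:
  assumes "f \<in> Cc_infty \<Omega>" shows "(\<lambda>x. grad f x \<bullet> v) \<in> Cc_infty \<Omega>"
  using Cc_infty_deriv[OF assms, of v] by (simp add: Cc_infty_grad_inner[OF assms] inner_commute)

lemma Cc_infty_0: "(\<lambda>x. 0) \<in> Cc_infty \<Omega>"
  by (rule Cc_inftyI[OF Ck_const, of "{}"]) auto

lemma Cc_infty_sum:
  "(\<And>i. i \<in> I \<Longrightarrow> f i \<in> Cc_infty \<Omega>) \<Longrightarrow> (\<lambda>x. \<Sum>i\<in>I. f i x) \<in> Cc_infty \<Omega>"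
  by (induction I rule: infinite_finite_induct) (auto simp: Cc_infty_0 Cc_infty_add)

lemma Cc_infty_grad:
  assumes "f \<in> Cc_infty \<Omega>" shows "grad f \<in> Cc_infty \<Omega>"
proof -
  have "(\<lambda>x. \<Sum>b\<in>Basis. (grad f x \<bullet> b) *\<^sub>R b) \<in> Cc_infty \<Omega>"
    by (intro Cc_infty_sum Cc_infty_linear[OF bounded_linear_scaleR_left] Cc_infty_grad_comp assms)
  then show ?thesis by (simp add: euclidean_representation)
qed

lemma Cc_infty_inner: "f \<in> Cc_infty \<Omega> \<Longrightarrow> (\<lambda>x. f x \<bullet> b) \<in> Cc_infty \<Omega>"
  by (rule Cc_infty_linear[OF bounded_linear_inner_left])

lemma Cc_infty_lincomb:
  fixes f g :: "'a::euclidean_space \<Rightarrow> real"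
  assumes "f \<in> Cc_infty \<Omega>" "g \<in> Cc_infty \<Omega>"
  shows "(\<lambda>x. a * f x + b * g x) \<in> Cc_infty \<Omega>"
  by (intro Cc_infty_add Cc_infty_linear[OF bounded_linear_mult_right] assms)

lemma grad_lincomb:
  assumes "f \<in> Cc_infty \<Omega>" "g \<in> Cc_infty \<Omega>"
  shows "grad (\<lambda>x. a * f x + b * g x) x = a *\<^sub>R grad f x + b *\<^sub>R grad g x"
  using assms[THEN Cc_infty_GDERIV, of x]
  by (intro grad_eqI) (auto simp: gderiv_def inner_right_distrib intro!: derivative_eq_intros)

lemma grad_translate:
  assumes "f \<in> Cc_infty UNIV"
  shows "grad (\<lambda>x. f (x - c)) x = grad f (x - c)"
proof (rule grad_eqI)
  have 1: "((\<lambda>x. x - c) has_derivative (\<lambda>h. h)) (at x)" by (auto intro!: derivative_eq_intros)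
  show "GDERIV (\<lambda>x. f (x - c)) x :> grad f (x - c)"
    using has_derivative_compose[OF 1 Cc_infty_GDERIV[OF assms, of "x - c", unfolded gderiv_def]]
    by (simp add: gderiv_def)
qed

lemma Cc_infty_real_Lipschitz:
  fixes f :: "'a::euclidean_space \<Rightarrow> real"
  assumes "f \<in> Cc_infty \<Omega>"
  obtains L where "0 < L" "\<And>x y. \<bar>f x - f y\<bar> \<le> L * norm (x - y)"
proof -
  obtain B R where B: "0 < B" "\<And>x. norm (grad f x) \<le> B"
    using Cc_infty_bounded[OF Cc_infty_grad[OF assms]] by metis
  have "norm (f x - f y) \<le> B * norm (x - y)" for x y
  proof (rule differentiable_bound[of UNIV f "\<lambda>x h. h \<bullet> grad f x"])
    show "(f has_derivative (\<lambda>h. h \<bullet> grad f x)) (at x within UNIV)" for x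
      using Cc_infty_GDERIV[OF assms, of x] by (simp add: gderiv_def)
    show "onorm (\<lambda>h. h \<bullet> grad f x) \<le> B" for x
    proof (rule onorm_le)
      fix h
      have "norm (h \<bullet> grad f x) \<le> norm h * norm (grad f x)"
        by (simp add: Cauchy_Schwarz_ineq2)
      also have "\<dots> \<le> norm h * B" using B by (intro mult_left_mono) auto
      finally show "norm (h \<bullet> grad f x) \<le> B * norm h" by (simp add: mult.commute)
    qed
  qed auto
  then show ?thesis using B that by auto
qed

lemma Cc_infty_Lipschitz:
  assumes "f \<in> Cc_infty \<Omega>"
  obtains L where "0 < L" "\<And>x y. norm (f x - f y) \<le> L * norm (x - y)"
proof -
  have "\<exists>L. 0 < L \<and> (\<forall>x y. \<bar>f x \<bullet> b - f y \<bullet> b\<bar> \<le> L * norm (x - y))" for b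
    using Cc_infty_real_Lipschitz[OF Cc_infty_inner[OF assms, of b]] by metis
  then obtain L where L: "\<And>b. 0 < L b" "\<And>b x y. \<bar>f x \<bullet> b - f y \<bullet> b\<bar> \<le> L b * norm (x - y)"
    by metis
  have "norm (f x - f y) \<le> (\<Sum>b\<in>Basis. L b) * norm (x - y)" for x y
  proof -
    have "norm (f x - f y) \<le> (\<Sum>b\<in>Basis. \<bar>(f x - f y) \<bullet> b\<bar>)" by (rule norm_le_l1)
    also have "\<dots> \<le> (\<Sum>b\<in>Basis. L b * norm (x - y))"
      by (intro sum_mono) (use L in \<open>simp add: inner_diff_left\<close>)
    finally show ?thesis by (simp add: sum_distrib_right)
  qed
  moreover have "0 < (\<Sum>b\<in>Basis. L b)" using L by (intro sum_pos) auto
  ultimately show ?thesis using that by blast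
qed

subsection \<open>Integrals of test functions\<close>

lemma integrable_bounded_support:
  fixes f :: "'a::euclidean_space \<Rightarrow> 'b::{banach,second_countable_topology}"
  assumes "f \<in> borel_measurable borel" "\<And>x. norm (f x) \<le> B" "\<And>x. norm x > R \<Longrightarrow> f x = 0"
  shows "integrable lborel f"
proof (rule integrableI_bounded_set[where A="cball 0 R" and B=B])
  show "emeasure lborel (cball (0::'a) R) < \<infinity>"
    using emeasure_lborel_cball_finite by simp
qed (use assms in \<open>auto simp: dist_norm intro!: AE_I2\<close>)

lemma Cc_infty_integrable: 
  assumes "f \<in> Cc_infty \<Omega>" shows "integrable lborel f"
  by (rule Cc_infty_bounded[OF assms], rule integrable_bounded_support[OF Cc_infty_borel[OF assms]]) auto

lemma lborel_distr_reflect: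
  "distr lborel borel (\<lambda>z. x - z) = (lborel :: 'a::euclidean_space measure)"
  using lborel_affine[of "-1" x] by (simp add: density_1 power_minus1_even)

lemma nn_integral_reflect:
  fixes f :: "'a::euclidean_space \<Rightarrow> ennreal"
  assumes [measurable]: "f \<in> borel_measurable borel"
  shows "(\<integral>\<^sup>+z. f (x - z) \<partial>lborel) = (\<integral>\<^sup>+z. f z \<partial>lborel)"
  by (subst (2) lborel_distr_reflect[of x, symmetric]) (simp add: nn_integral_distr)

lemma nn_integral_translate:
  fixes f :: "'a::euclidean_space \<Rightarrow> ennreal"
  assumes [measurable]: "f \<in> borel_measurable borel"
  shows "(\<integral>\<^sup>+z. f (z - x) \<partial>lborel) = (\<integral>\<^sup>+z. f z \<partial>lborel)"
  by (subst (2) lborel_distr_plus[of "-x", symmetric]) (simp add: nn_integral_distr)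

lemma integral_reflect:
  fixes f :: "'a::euclidean_space \<Rightarrow> 'b::{banach,second_countable_topology}"
  assumes [measurable]: "f \<in> borel_measurable borel"
  shows "(LINT z|lborel. f (x - z)) = (LINT z|lborel. f z)"
  by (subst (2) lborel_distr_reflect[of x, symmetric]) (simp add: integral_distr)

lemma integral_translate:
  fixes f :: "'a::euclidean_space \<Rightarrow> 'b::{banach,second_countable_topology}"
  assumes [measurable]: "f \<in> borel_measurable borel"
  shows "(LINT z|lborel. f (z - x)) = (LINT z|lborel. f z)"
  by (subst (2) lborel_distr_plus[of "-x", symmetric]) (simp add: integral_distr)

lemma integrable_translate:
  fixes f :: "'a::euclidean_space \<Rightarrow> 'b::{banach,second_countable_topology}"
  assumes "integrable lborel f"
  shows "integrable lborel (\<lambda>z. f (z - x))"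
proof -
  have [measurable]: "f \<in> borel_measurable borel" using assms by auto
  have "integrable (distr lborel borel ((+) (-x))) f"
    by (subst lborel_distr_plus) (rule assms)
  then show ?thesis by (subst (asm) integrable_distr_eq) auto
qed

text \<open>The integral of a translate does not depend on the translation, so the integrals of the
  difference quotients vanish; the derivative is their bounded limit.\<close>

lemma integral_derivative_eq_0:
  fixes f :: "'a::euclidean_space \<Rightarrow> real"
  assumes d: "\<And>x. (f has_derivative f' x) (at x)" and B: "\<And>x. \<bar>f' x v\<bar> \<le> B"
    and R: "\<And>x. norm x > R \<Longrightarrow> f x = 0"
  shows "(LINT x|lborel. f' x v) = 0"
proof -
  have cont: "continuous_on UNIV f"
    using d has_derivative_continuous continuous_at_imp_continuous_on by blast
  then have [measurable]: "f \<in> borel_measurable borel" by (rule borel_measurable_continuous_onI)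
  have "compact (f ` cball 0 R)"
    by (rule compact_continuous_image[OF continuous_on_subset[OF cont]]) auto
  then obtain C where C: "0 < C" "\<And>x. x \<in> cball 0 R \<Longrightarrow> norm (f x) \<le> C"
    using compact_imp_bounded[of "f ` cball 0 R"] unfolding bounded_pos by auto
  have "norm (f x) \<le> C" for x using C(1) C(2)[of x] R[of x] by (cases "norm x \<le> R") auto
  then have int: "integrable lborel f" by (intro integrable_bounded_support[of f C R] R) auto
  \<comment> \<open>The difference quotients, written with a subtraction to match the translation rule.\<close>
  define D where "D n x = real (Suc n) * (f (x - (- (1 / real (Suc n))) *\<^sub>R v) - f x)" for n x
  have D0: "(LINT x|lborel. D n x) = 0" for n
  proof -
    have "(LINT x|lborel. D n x) = real (Suc n) *
        ((LINT x|lborel. f (x - (- (1 / real (Suc n))) *\<^sub>R v)) - (LINT x|lborel. f x))"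
      unfolding D_def
      by (subst integral_mult_right_zero, subst Bochner_Integration.integral_diff)
         (use int integrable_translate[OF int, of "- (1 / real (Suc n)) *\<^sub>R v"] in auto)
    then show ?thesis by (subst (asm) integral_translate) auto
  qed
  have DB: "\<bar>D n x\<bar> \<le> B" for n x
  proof -
    let ?g = "\<lambda>t. f (x + t *\<^sub>R v)"
    have g: "(?g has_field_derivative f' (x + t *\<^sub>R v) v) (at t)" for t
    proof -
      have 1: "((\<lambda>t. x + t *\<^sub>R v) has_derivative (\<lambda>h. h *\<^sub>R v)) (at t)"
        by (auto intro!: derivative_eq_intros)
      have "f' (x + t *\<^sub>R v) (h *\<^sub>R v) = f' (x + t *\<^sub>R v) v * h" for h
        using linear_scale[OF has_derivative_linear[OF d[of "x + t *\<^sub>R v"]], of h v] by simp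
      then show ?thesis using has_derivative_compose[OF 1 d]
        by (simp add: has_field_derivative_def)
    qed
    have "norm (?g (1 / real (Suc n)) - ?g 0) \<le> B * norm (1 / real (Suc n) - 0)"
      by (rule field_differentiable_bound[of UNIV ?g "\<lambda>t. f' (x + t *\<^sub>R v) v"])
         (use g B in auto)
    then have "\<bar>f (x - (- (1 / real (Suc n))) *\<^sub>R v) - f x\<bar> \<le> B / real (Suc n)"
      by simp
    then show ?thesis
      unfolding D_def abs_mult by (simp add: pos_le_divide_eq mult.commute del: of_nat_Suc)
  qed
  have Dlim: "(\<lambda>n. D n x) \<longlonglongrightarrow> f' x v" for x
  proof -
    have 1: "((\<lambda>t. x + t *\<^sub>R v) has_derivative (\<lambda>h. h *\<^sub>R v)) (at 0)"
      by (auto intro!: derivative_eq_intros)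
    have "f' x (h *\<^sub>R v) = f' x v * h" for h
      using linear_scale[OF has_derivative_linear[OF d[of x]], of h v] by simp
    then have "((\<lambda>t. f (x + t *\<^sub>R v)) has_field_derivative f' x v) (at 0)"
      using has_derivative_compose[OF 1, of f "f' x"] d[of x] by (simp add: has_field_derivative_def)
    then have l: "((\<lambda>h. (f (x + h *\<^sub>R v) - f x) / h) \<longlongrightarrow> f' x v) (at 0)"
      by (simp add: DERIV_def)
    have "filterlim (\<lambda>n. 1 / real (Suc n)) (at 0) sequentially"
      unfolding filterlim_at by (intro conjI LIMSEQ_Suc[OF lim_1_over_n]) (auto simp: LIMSEQ_Suc[OF lim_1_over_n])
    from filterlim_compose[OF l this] show ?thesis
      by (simp add: D_def field_simps)
  qed
  have Dsupp: "D n x = 0" if "norm x > R + norm v" for n x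
  proof -
    have "norm ((1 / real (Suc n)) *\<^sub>R v) \<le> 1 * norm v"
      unfolding norm_scaleR by (intro mult_right_mono) auto
    then have "norm (x + (1 / real (Suc n)) *\<^sub>R v) > R"
      using that norm_diff_ineq[of x "(1 / real (Suc n)) *\<^sub>R v"] by linarith
    moreover have "norm x > R" using that norm_ge_zero[of v] by linarith
    ultimately show ?thesis by (simp add: D_def R)
  qed
  have [measurable]: "D n \<in> borel_measurable borel" for n unfolding D_def by measurable
  have "(\<lambda>n. LINT x|lborel. D n x) \<longlonglongrightarrow> (LINT x|lborel. f' x v)"
  proof (rule integral_dominated_convergence[where w="\<lambda>x. B * indicator (cball 0 (R + norm v)) x"])
    show "integrable lborel (\<lambda>x::'a. B * indicator (cball 0 (R + norm v)) x)"
      using emeasure_lborel_cball_finite[of "0::'a" "R + norm v"] by (intro integrable_mult_right) auto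
    show "AE x in lborel. norm (D n x) \<le> B * indicator (cball 0 (R + norm v)) x" for n
      using DB Dsupp by (auto simp: indicator_def intro!: AE_I2)
    show "(\<lambda>x. f' x v) \<in> borel_measurable lborel"
      by (rule borel_measurable_LIMSEQ_real[OF Dlim]) simp
  qed (use Dlim in auto)
  then show ?thesis using D0 by (simp add: LIMSEQ_const_iff)
qed

text \<open>Only \<open>g\<close> has compact support, so \<open>f\<close> may be a translated heat kernel.\<close>

lemma integral_by_parts:
  fixes f g :: "'a::euclidean_space \<Rightarrow> real"
  assumes f: "\<And>x. (f has_derivative f' x) (at x)" and g: "g \<in> Cc_infty UNIV"
    and Bf: "\<And>x. \<bar>f x\<bar> \<le> B" and Bf': "\<And>x. \<bar>f' x v\<bar> \<le> B'"
    and [measurable]: "(\<lambda>x. f' x v) \<in> borel_measurable borel"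
  shows "(LINT x|lborel. f x * (v \<bullet> grad g x)) = - (LINT x|lborel. f' x v * g x)"
proof -
  obtain C R where C: "0 < C" "\<And>x. norm (g x) \<le> C" "\<And>x. norm x > R \<Longrightarrow> g x = 0"
    using Cc_infty_bounded[OF g] by metis
  obtain C' R' where C': "0 < C'" "\<And>x. norm (grad g x \<bullet> v) \<le> C'" "\<And>x. norm x > R' \<Longrightarrow> grad g x \<bullet> v = 0"
    using Cc_infty_bounded[OF Cc_infty_grad_comp[OF g, of v]] by metis
  have [measurable]: "f \<in> borel_measurable borel"
    using f has_derivative_continuous continuous_at_imp_continuous_on
    by (intro borel_measurable_continuous_onI) blast
  have [measurable]: "g \<in> borel_measurable borel" "grad g \<in> borel_measurable borel"
    using Cc_infty_borel[OF g] Cc_infty_borel[OF Cc_infty_grad[OF g]] by auto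
  have B0: "0 \<le> B" "0 \<le> B'" using Bf[of 0] Bf'[of 0] by linarith+
  have b1: "\<bar>f x * (v \<bullet> grad g x)\<bar> \<le> B * C'" for x
    unfolding abs_mult using Bf C'(2) B0 by (intro mult_mono) (auto simp: inner_commute)
  have b2: "\<bar>f' x v * g x\<bar> \<le> B' * C" for x
    unfolding abs_mult using Bf' C(2) B0 by (intro mult_mono) auto
  have i1: "integrable lborel (\<lambda>x. f x * (v \<bullet> grad g x))"
    by (rule integrable_bounded_support[of _ "B * C'" R']) (use b1 C'(3) in \<open>auto simp: inner_commute\<close>)
  have i2: "integrable lborel (\<lambda>x. f' x v * g x)"
    by (rule integrable_bounded_support[of _ "B' * C" R]) (use b2 C(3) in auto)
  have "(LINT x|lborel. f x * (v \<bullet> grad g x) + f' x v * g x) = 0"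
  proof (rule integral_derivative_eq_0[where f="\<lambda>x. f x * g x" and f'="\<lambda>x h. f x * (h \<bullet> grad g x) + f' x h * g x" and v=v])
    show "((\<lambda>x. f x * g x) has_derivative (\<lambda>h. f x * (h \<bullet> grad g x) + f' x h * g x)) (at x)" for x
      by (rule has_derivative_mult[OF f Cc_infty_GDERIV[OF g, unfolded gderiv_def]])
    show "\<bar>f x * (v \<bullet> grad g x) + f' x v * g x\<bar> \<le> B * C' + B' * C" for x
      using b1[of x] b2[of x] by linarith
    show "f x * g x = 0" if "norm x > R" for x using C(3)[OF that] by simp
  qed
  then show ?thesis using Bochner_Integration.integral_add[OF i1 i2] by linarith
qed

lemma Cc_infty_by_parts:
  assumes f: "f \<in> Cc_infty UNIV" and g: "g \<in> Cc_infty UNIV"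
  shows "(LINT x|lborel. f x * (v \<bullet> grad g x)) = - (LINT x|lborel. (v \<bullet> grad f x) * g x)"
proof -
  obtain B R where "\<And>x. norm (f x) \<le> B" using Cc_infty_bounded[OF f] by metis
  moreover obtain B' R where "\<And>x. norm (grad f x \<bullet> v) \<le> B'"
    using Cc_infty_bounded[OF Cc_infty_grad_comp[OF f, of v]] by metis
  moreover have "(\<lambda>x. v \<bullet> grad f x) \<in> borel_measurable borel"
    using Cc_infty_borel[OF Cc_infty_grad_comp[OF f, of v]] by (simp add: inner_commute)
  ultimately show ?thesis
    by (intro integral_by_parts[where f'="\<lambda>x h. h \<bullet> grad f x" and B=B and B'=B', OF _ g])
       (use Cc_infty_GDERIV[OF f] in \<open>auto simp: gderiv_def inner_commute\<close>)
qed

subsection \<open>The fundamental lemma of the calculus of variations\<close>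

text \<open>The arguments are written as an inner product plus a constant, the form in which smoothness of
  \<open>flat_exp\<close> along a direction is available.\<close>

definition box_cutoff :: "nat \<Rightarrow> 'a::euclidean_space \<Rightarrow> 'a \<Rightarrow> 'a \<Rightarrow> real" where
  "box_cutoff n l u x =
     (\<Prod>b\<in>Basis. flat_exp 0 (x \<bullet> (real n *\<^sub>R b) + (- real n * (l \<bullet> b))) *
                flat_exp 0 (x \<bullet> (- real n *\<^sub>R b) + real n * (u \<bullet> b)))"

lemma box_cutoff_0:
  assumes "x \<notin> box l u" shows "box_cutoff n l u x = 0"
proof -
  from assms obtain b where b: "b \<in> Basis" "x \<bullet> b \<le> l \<bullet> b \<or> u \<bullet> b \<le> x \<bullet> b"
    by (auto simp: mem_box not_less)
  then have "flat_exp 0 (x \<bullet> (real n *\<^sub>R b) + (- real n * (l \<bullet> b))) = 0 \<or>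
      flat_exp 0 (x \<bullet> (- real n *\<^sub>R b) + real n * (u \<bullet> b)) = 0"
    using mult_left_mono[of "x \<bullet> b" "l \<bullet> b" "real n"] mult_left_mono[of "u \<bullet> b" "x \<bullet> b" "real n"]
    by (auto simp: flat_exp_def)
  then show ?thesis unfolding box_cutoff_def using b(1) by (intro prod_zero) auto
qed

lemma box_cutoff_Cc_infty: "box_cutoff n l u \<in> Cc_infty UNIV"
proof (rule Cc_inftyI[of _ "cbox l u"])
  show "Ck k (box_cutoff n l u)" for k
    unfolding box_cutoff_def by (intro Ck_prod Ck_mult Ck_flat_exp)
  show "box_cutoff n l u x = 0" if "x \<notin> cbox l u" for x
    using that box_subset_cbox by (intro box_cutoff_0) auto
qed auto

lemma box_cutoff_bounds: "\<bar>box_cutoff n l u x\<bar> \<le> indicator (cbox l u) x"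
proof (cases "x \<in> box l u")
  case True
  have "0 \<le> box_cutoff n l u x" "box_cutoff n l u x \<le> 1"
    unfolding box_cutoff_def
    by (auto intro!: prod_nonneg prod_le_1 mult_nonneg_nonneg mult_le_one flat_exp_0_bounds)
  then show ?thesis using True box_subset_cbox by (auto simp: indicator_def)
next
  case False then show ?thesis by (simp add: box_cutoff_0)
qed

lemma box_cutoff_tendsto: "(\<lambda>n. box_cutoff n l u x) \<longlonglongrightarrow> indicator (box l u) x"
proof -
  have "(\<lambda>n. box_cutoff n l u x) \<longlonglongrightarrow> (\<Prod>b\<in>Basis. (if x \<bullet> b - l \<bullet> b > 0 then 1 else 0) *
      (if u \<bullet> b - x \<bullet> b > 0 then 1 else 0))"
    unfolding box_cutoff_def
    using flat_exp_scaled_tendsto[of "x \<bullet> b - l \<bullet> b" for b] flat_exp_scaled_tendsto[of "u \<bullet> b - x \<bullet> b" for b]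
    by (intro tendsto_prod tendsto_mult) (simp_all add: algebra_simps)
  also have "(\<Prod>b\<in>Basis. (if x \<bullet> b - l \<bullet> b > 0 then 1 else 0) *
      (if u \<bullet> b - x \<bullet> b > 0 then 1 else (0::real))) = indicator (box l u) x"
  proof (cases "x \<in> box l u")
    case True then show ?thesis by (auto simp: mem_box intro!: prod.neutral)
  next
    case False
    then obtain b where "b \<in> Basis" "\<not> (l \<bullet> b < x \<bullet> b \<and> x \<bullet> b < u \<bullet> b)" by (auto simp: mem_box)
    then show ?thesis using False by (auto intro!: prod_zero bexI[of _ b])
  qed
  finally show ?thesis .
qed

text \<open>Boxes are closed under intersection and generate the Borel sets, so the integral of \<open>f\<close> vanishes
  over every Borel set.\<close>

lemma AE_zero_of_box_integrals:
  fixes f :: "'a::euclidean_space \<Rightarrow> real"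
  assumes f: "integrable lborel f" and box: "\<And>l u. (LINT x|lborel. indicator (box l u) x * f x) = 0"
  shows "AE x in lborel. f x = 0"
proof (rule sigma_finite_measure.density_zero[OF _ f])
  show "sigma_finite_measure lborel" by (rule lborel.sigma_finite_measure_axioms)
  fix A :: "'a set" assume "A \<in> sets lborel"
  then have A: "A \<in> sigma_sets UNIV (range (\<lambda>(a, b). box a b))" by (simp add: borel_eq_box)
  have ist: "Int_stable (range (\<lambda>(a::'a, b). box a b))"
    by (auto simp: Int_stable_def box_Int_box)
  have box0: "set_lebesgue_integral lborel (box a b) f = 0" for a b
    using box[of a b] by (simp add: set_lebesgue_integral_def)
  have sub: "range (\<lambda>(a::'a, b). box a b) \<subseteq> Pow UNIV" by simp
  have I: "set_integrable lborel B f" if "B \<in> sets borel" for B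
    using integrable_mult_indicator[OF _ f, of B] that by (simp add: set_integrable_def)
  from ist sub A show "set_lebesgue_integral lborel A f = 0"
  proof (induction rule: sigma_sets_induct_disjoint)
    case (basic A) then show ?case using box0 by auto
  next
    case empty then show ?case by (simp add: set_lebesgue_integral_def)
  next
    have "(\<lambda>n. LINT x|lborel. indicator (box (- (real n *\<^sub>R One)) (real n *\<^sub>R One)) x * f x) \<longlonglongrightarrow> (LINT x|lborel. f x)"
    proof (rule integral_dominated_convergence[where w="\<lambda>x. norm (f x)"])
      have [measurable]: "f \<in> borel_measurable borel" using f by auto
      show "(\<lambda>x. indicator (box (- (real n *\<^sub>R One)) (real n *\<^sub>R One)) x * f x) \<in> borel_measurable lborel" for n
        by measurable
      show "AE x in lborel. (\<lambda>n. indicator (box (- (real n *\<^sub>R One)) (real n *\<^sub>R One)) x * f x) \<longlonglongrightarrow> f x"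
      proof (rule AE_I2)
        fix x :: 'a
        obtain N where N: "norm x < real N" using reals_Archimedean2 by blast
        have "x \<in> box (- (real n *\<^sub>R One)) (real n *\<^sub>R One)" if "n \<ge> N" for n
        proof -
          have "\<bar>x \<bullet> b\<bar> < real n" if "b \<in> Basis" for b
            using N \<open>n \<ge> N\<close> Basis_le_norm[OF that, of x] by linarith
          then show ?thesis by (auto simp: mem_box abs_less_iff) (metis minus_less_iff)
        qed
        then show "(\<lambda>n. indicator (box (- (real n *\<^sub>R One)) (real n *\<^sub>R One)) x * f x) \<longlonglongrightarrow> f x"
          by (intro tendsto_eventually eventually_sequentiallyI[of N]) simp
      qed
    qed (use f in \<open>auto simp: indicator_def intro!: AE_I2\<close>)
    then have tot: "(LINT x|lborel. f x) = 0" using box by (simp add: LIMSEQ_const_iff)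
    case (compl A)
    then have "A \<in> sets lborel" by (simp add: borel_eq_box)
    then have "(LINT x:A|lborel. f x) + (LINT x:UNIV - A|lborel. f x) = (LINT x:A \<union> (UNIV - A)|lborel. f x)"
      by (intro set_integral_Un[symmetric] I) auto
    then show ?case using compl tot by (simp add: set_lebesgue_integral_def)
  next
    case (union A)
    then have [measurable]: "A i \<in> sets borel" for i by (auto simp: borel_eq_box subset_eq)
    have "(LINT x:(\<Union>i. A i)|lborel. f x) = (\<Sum>i. LINT x:A i|lborel. f x)"
      using union by (intro lebesgue_integral_countable_add I) (auto simp: disjoint_family_on_def)
    then show ?case using union by simp
  qed
qed

text \<open>The cutoffs converge boundedly to the indicators of boxes. As \<open>f\<close> is only locally integrable, the
  previous criterion is applied on an exhausting sequence of boxes.\<close>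

lemma AE_zero_of_test_functions_real:
  fixes f :: "'a::euclidean_space \<Rightarrow> real"
  assumes f: "f \<in> borel_measurable borel"
    and loc: "\<And>R. integrable lborel (\<lambda>x. indicator (cball 0 R) x * f x)"
    and test: "\<And>\<phi>. \<phi> \<in> Cc_infty UNIV \<Longrightarrow> (LINT x|lborel. f x * \<phi> x) = 0"
  shows "AE x in lborel. f x = 0"
proof -
  note [measurable] = f
  have intbox: "integrable lborel (\<lambda>x. indicator (cbox l u) x * f x)" for l u :: 'a
  proof -
    obtain R where R: "cbox l u \<subseteq> cball 0 R"
      using bounded_subset_ballD[OF bounded_cbox[of l u], of 0] ball_subset_cball by fast
    show ?thesis
      by (rule Bochner_Integration.integrable_bound[OF loc[of R]])
         (use R in \<open>auto simp: indicator_def intro!: AE_I2\<close>)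
  qed
  have box0: "(LINT x|lborel. indicator (box l u) x * f x) = 0" for l u :: 'a
  proof -
    have "(\<lambda>n. LINT x|lborel. f x * box_cutoff n l u x) \<longlonglongrightarrow> (LINT x|lborel. f x * indicator (box l u) x)"
    proof (rule integral_dominated_convergence[where w="\<lambda>x. norm (indicator (cbox l u) x * f x)"])
      show "(\<lambda>x. f x * box_cutoff n l u x) \<in> borel_measurable lborel" for n
        using Cc_infty_borel[OF box_cutoff_Cc_infty[of n l u]] by measurable
      show "AE x in lborel. norm (f x * box_cutoff n l u x) \<le> norm (indicator (cbox l u) x * f x)" for n
      proof (rule AE_I2)
        fix x
        have "\<bar>f x\<bar> * \<bar>box_cutoff n l u x\<bar> \<le> \<bar>f x\<bar> * indicator (cbox l u) x"
          by (intro mult_left_mono box_cutoff_bounds) auto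
        then show "norm (f x * box_cutoff n l u x) \<le> norm (indicator (cbox l u) x * f x)"
          by (simp add: abs_mult mult.commute)
      qed
    qed (use intbox in \<open>auto intro!: AE_I2 tendsto_mult box_cutoff_tendsto integrable_abs\<close>)
    then show ?thesis using test[OF box_cutoff_Cc_infty] by (simp add: LIMSEQ_const_iff mult.commute)
  qed
  have "AE x in lborel. \<forall>n::nat. indicator (box (- (real n *\<^sub>R One)) (real n *\<^sub>R One)) x * f x = 0"
    unfolding AE_all_countable
  proof
    fix n :: nat
    let ?B = "box (- (real n *\<^sub>R One)) (real n *\<^sub>R One) :: 'a set"
    show "AE x in lborel. indicator ?B x * f x = 0"
    proof (rule AE_zero_of_box_integrals)
      show "integrable lborel (\<lambda>x. indicator ?B x * f x)"
        by (rule Bochner_Integration.integrable_bound[OF intbox[of "- (real n *\<^sub>R One)" "real n *\<^sub>R One"]])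
           (use box_subset_cbox[of "- (real n *\<^sub>R One)" "real n *\<^sub>R One::'a"] in \<open>auto simp: indicator_def intro!: AE_I2\<close>)
      fix l u :: 'a
      obtain l' u' where "box l u \<inter> ?B = box l' u'" by (simp add: box_Int_box)
      then have "indicator (box l u) x * (indicator ?B x * f x) = indicator (box l' u') x * f x" for x
        by (metis indicator_inter_arith mult.assoc)
      then show "(LINT x|lborel. indicator (box l u) x * (indicator ?B x * f x)) = 0"
        using box0 by (simp only:)
    qed
  qed
  then show ?thesis
  proof (rule AE_mp, intro AE_I2 impI)
    fix x :: 'a assume *: "\<forall>n::nat. indicator (box (- (real n *\<^sub>R One)) (real n *\<^sub>R One)) x * f x = 0"
    obtain n where n: "norm x < real n" using reals_Archimedean2 by blast
    have "\<bar>x \<bullet> b\<bar> < real n" if "b \<in> Basis" for b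
      using n Basis_le_norm[OF that, of x] by linarith
    then have "x \<in> box (- (real n *\<^sub>R One)) (real n *\<^sub>R One)"
      by (auto simp: mem_box abs_less_iff) (metis minus_less_iff)
    then show "f x = 0" using *[rule_format, of n] by simp
  qed
qed

section \<open>The heat kernel\<close>

text \<open>The Gauss--Weierstrass kernel; for positive \<open>t\<close> it is a probability density.\<close>

definition heat :: "real \<Rightarrow> 'a::euclidean_space \<Rightarrow> real" where
  "heat t z = (4 * pi * t) powr (- (real DIM('a) / 2)) * exp (- (norm z)\<^sup>2 / (4 * t))"

lemma heat_nonneg [simp]: "0 \<le> heat t z"
  by (simp add: heat_def)

lemma measurable_heat [measurable (raw)]:
  assumes [measurable]: "f \<in> borel_measurable M" "g \<in> borel_measurable M"
  shows "(\<lambda>x. heat (f x) (g x :: 'a::euclidean_space)) \<in> borel_measurable M"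
  unfolding heat_def by measurable

lemma heat_minus [simp]: "heat t (- z) = heat t z"
  by (simp add: heat_def)

lemma heat_le: "0 < t \<Longrightarrow> heat t (z::'a::euclidean_space) \<le> (4 * pi * t) powr (- (real DIM('a) / 2))"
  unfolding heat_def by (rule mult_left_le) auto

lemma heat_eq_prod:
  fixes z :: "'a::euclidean_space"
  assumes t: "0 < t"
  shows "heat t z = (\<Prod>b\<in>Basis. normal_density 0 (sqrt (2 * t)) (z \<bullet> b))"
proof -
  have "(\<Prod>b\<in>Basis. normal_density 0 (sqrt (2 * t)) (z \<bullet> b)) =
      (\<Prod>b\<in>(Basis::'a set). (4 * pi * t) powr (- 1 / 2) * exp (- (z \<bullet> b)\<^sup>2 / (4 * t)))"
    using t by (intro prod.cong) (auto simp: normal_density_def powr_minus powr_half_sqrt field_simps)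
  also have "\<dots> = ((4 * pi * t) powr (- 1 / 2)) ^ DIM('a) * exp (\<Sum>b\<in>Basis. - (z \<bullet> b)\<^sup>2 / (4 * t))"
    by (simp add: prod.distrib exp_sum)
  also have "((4 * pi * t) powr (- 1 / 2)) ^ DIM('a) = (4 * pi * t) powr (- (real DIM('a) / 2))"
    using t by (simp add: powr_realpow[symmetric] powr_powr)
  also have "(\<Sum>b\<in>Basis. - (z \<bullet> b)\<^sup>2 / (4 * t)) = - (norm z)\<^sup>2 / (4 * t)"
    unfolding power2_norm_eq_inner by (subst euclidean_inner[of z z])
      (simp add: sum_divide_distrib sum_negf power2_eq_square)
  finally show ?thesis by (simp add: heat_def)
qed

lemma nn_integral_heat:
  assumes "0 < t" shows "(\<integral>\<^sup>+z. ennreal (heat t (z::'a::euclidean_space)) \<partial>lborel) = 1"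
proof -
  have "(\<integral>\<^sup>+x. ennreal (normal_density 0 (sqrt (2 * t)) x) \<partial>lborel) = 1"
    using assms by (subst nn_integral_eq_integral) auto
  then show ?thesis
    using assms nn_integral_lborel_prod[of "\<lambda>b::'a. \<lambda>x. ennreal (normal_density 0 (sqrt (2 * t)) x)"]
    by (simp add: heat_eq_prod prod_ennreal)
qed

lemma integrable_heat: "0 < t \<Longrightarrow> integrable lborel (heat t :: 'a::euclidean_space \<Rightarrow> real)"
  by (rule integrableI_nonneg) (auto simp: nn_integral_heat)

lemma integral_heat: "0 < t \<Longrightarrow> (LINT z|lborel. heat t (z::'a::euclidean_space)) = 1"
  by (subst integral_eq_nn_integral) (auto simp: nn_integral_heat)

text \<open>Completing the square in \<open>z\<close>; this is the semigroup law of the heat flow before integration.\<close>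

lemma heat_mult_heat:
  fixes z w :: "'a::euclidean_space"
  assumes t: "0 < t" "0 < \<tau>"
  shows "heat t z * heat \<tau> (w - z) = heat (t + \<tau>) w * heat (t * \<tau> / (t + \<tau>)) (z - (t / (t + \<tau>)) *\<^sub>R w)"
proof -
  have e: "(norm z)\<^sup>2 / (4 * t) + (norm (w - z))\<^sup>2 / (4 * \<tau>) =
      (norm w)\<^sup>2 / (4 * (t + \<tau>)) + (norm (z - (t / (t + \<tau>)) *\<^sub>R w))\<^sup>2 / (4 * (t * \<tau> / (t + \<tau>)))"
  proof -
    define a b c where abc: "a = z \<bullet> z" "b = z \<bullet> w" "c = w \<bullet> w"
    have s: "t + \<tau> > 0" using t by simp
    have 1: "(norm (w - z))\<^sup>2 = c - 2 * b + a"
      unfolding power2_norm_eq_inner by (simp add: abc algebra_simps inner_commute)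
    have 2: "(norm (z - k *\<^sub>R w))\<^sup>2 = a - 2 * k * b + k\<^sup>2 * c" for k
      unfolding power2_norm_eq_inner by (simp add: abc algebra_simps inner_commute power2_eq_square)
    have 3: "(norm z)\<^sup>2 = a" "(norm w)\<^sup>2 = c" by (simp_all add: abc power2_norm_eq_inner)
    define r where "r = t / (t + \<tau>)"
    have r: "t = r * (t + \<tau>)" "\<tau> = (1 - r) * (t + \<tau>)" using s by (auto simp: r_def field_simps)
    define q where "q = t + \<tau>"
    have q: "q > 0" "t = r * q" "\<tau> = (1 - r) * q" "0 < r" "r < 1"
      using s r t by (auto simp: q_def r_def)
    have m: "t * \<tau> / q = r * (1 - r) * q" using q by simp
    show ?thesis unfolding 1 2 3 r_def[symmetric] q_def[symmetric] m
      unfolding q(2) q(3) using q by (simp add: divide_simps) (simp add: algebra_simps power2_eq_square)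
  qed
  have p: "(4 * pi * t) * (4 * pi * \<tau>) = (4 * pi * (t + \<tau>)) * (4 * pi * (t * \<tau> / (t + \<tau>)))"
    using t by (simp add: field_simps)
  let ?d = "- (real DIM('a) / 2)"
  have hh: "heat u x * heat v y = ((4 * pi * u) * (4 * pi * v)) powr ?d *
      exp (- ((norm x)\<^sup>2 / (4 * u) + (norm y)\<^sup>2 / (4 * v)))" if "0 < u" "0 < v" for u v and x y :: 'a
  proof -
    have "((4 * pi * u) * (4 * pi * v)) powr ?d = (4 * pi * u) powr ?d * (4 * pi * v) powr ?d"
      using that by (intro powr_mult)
    moreover have "exp (- ((norm x)\<^sup>2 / (4 * u) + (norm y)\<^sup>2 / (4 * v))) =
        exp (- (norm x)\<^sup>2 / (4 * u)) * exp (- (norm y)\<^sup>2 / (4 * v))"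
      by (simp flip: exp_add)
    ultimately show ?thesis by (simp only: heat_def mult_ac)
  qed
  have u: "0 < t + \<tau>" "0 < t * \<tau> / (t + \<tau>)" using t by simp_all
  show ?thesis by (simp only: hh[OF t] hh[OF u] e p)
qed

lemma nn_integral_heat_conv:
  fixes w :: "'a::euclidean_space"
  assumes t: "0 < t" "0 < \<tau>"
  shows "(\<integral>\<^sup>+z. ennreal (heat t z * heat \<tau> (w - z)) \<partial>lborel) = ennreal (heat (t + \<tau>) w)"
proof -
  let ?u = "t * \<tau> / (t + \<tau>)"
  have u: "0 < ?u" using t by simp
  have "(\<integral>\<^sup>+z. ennreal (heat t z * heat \<tau> (w - z)) \<partial>lborel) =
      ennreal (heat (t + \<tau>) w) * (\<integral>\<^sup>+z. ennreal (heat ?u (z - (t / (t + \<tau>)) *\<^sub>R w)) \<partial>lborel)"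
    unfolding heat_mult_heat[OF t] by (subst nn_integral_cmult[symmetric]) (auto simp: ennreal_mult)
  also have "(\<integral>\<^sup>+z. ennreal (heat ?u (z - (t / (t + \<tau>)) *\<^sub>R w)) \<partial>lborel) = 1"
    by (subst nn_integral_translate[of "\<lambda>z. ennreal (heat ?u z)"], measurable, rule nn_integral_heat[OF u])
  finally show ?thesis by simp
qed

text \<open>The ratio of the normalizing constants of the heat kernels at the times \<open>t\<close> and \<open>2 * t\<close>.\<close>

definition heat_mom :: "'a::euclidean_space itself \<Rightarrow> real" where
  "heat_mom _ = 2 powr (real DIM('a) / 2)"

lemma heat_mom_pos: "0 < heat_mom TYPE('a::euclidean_space)"
  by (simp add: heat_mom_def)

text \<open>Half of the exponent absorbs the factor \<open>norm z\<close>, because \<open>y exp (- y\<^sup>2 / 8) \<le> 2\<close>.\<close>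

lemma norm_mult_heat_le:
  fixes z :: "'a::euclidean_space"
  assumes t: "0 < t"
  shows "norm z * heat t z \<le> 2 * heat_mom TYPE('a) * sqrt t * heat (2 * t) z"
proof -
  define y where "y = norm z / sqrt t"
  have y: "norm z = y * sqrt t" "(norm z)\<^sup>2 = y\<^sup>2 * t" "y \<ge> 0" using t by (auto simp: y_def power_divide)
  have "y \<le> 2 * (1 + y\<^sup>2 / 8)" using zero_le_power2[of "y - 2"] by (simp add: power2_diff)
  also have "\<dots> \<le> 2 * exp (y\<^sup>2 / 8)" by (intro mult_left_mono exp_ge_add_one_self) auto
  finally have "y * exp (- (y\<^sup>2 / 8)) \<le> 2" by (simp add: exp_minus field_simps)
  then have "y * exp (- (y\<^sup>2 / 8)) * exp (- (y\<^sup>2 / 8)) \<le> 2 * exp (- (y\<^sup>2 / 8))"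
    by (rule mult_right_mono) auto
  moreover have "exp (- (y\<^sup>2 / 8)) * exp (- (y\<^sup>2 / 8)) = exp (- (y\<^sup>2 / 4))"
    by (simp flip: exp_add)
  ultimately have ex: "y * exp (- (y\<^sup>2 / 4)) \<le> 2 * exp (- (y\<^sup>2 / 8))" by (simp add: mult.assoc)
  let ?d = "- (real DIM('a) / 2)"
  have "norm z * heat t z = (4 * pi * t) powr ?d * sqrt t * (y * exp (- (y\<^sup>2 / 4)))"
    unfolding heat_def y(2) using t by (simp add: y(1))
  also have "\<dots> \<le> (4 * pi * t) powr ?d * sqrt t * (2 * exp (- (y\<^sup>2 / 8)))"
    using t by (intro mult_left_mono ex) auto
  also have "(4 * pi * t) powr ?d = heat_mom TYPE('a) * (4 * pi * (2 * t)) powr ?d"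
  proof -
    have "4 * pi * (2 * t) = 2 * (4 * pi * t)" by simp
    then show ?thesis
      using t by (simp only: powr_mult heat_mom_def) (simp add: powr_minus)
  qed
  finally show ?thesis unfolding heat_def y(2) using t by (simp add: mult_ac)
qed

text \<open>The gradient of the heat kernel.\<close>

definition dheat :: "real \<Rightarrow> 'a::euclidean_space \<Rightarrow> 'a" where
  "dheat t z = (- (heat t z / (2 * t))) *\<^sub>R z"

lemma measurable_dheat [measurable (raw)]:
  assumes [measurable]: "f \<in> borel_measurable M" "g \<in> borel_measurable M"
  shows "(\<lambda>x. dheat (f x) (g x :: 'a::euclidean_space)) \<in> borel_measurable M"
  unfolding dheat_def by measurable

lemma heat_has_derivative:
  fixes z :: "'a::euclidean_space"
  assumes t: "0 < t"
  shows "(heat t has_derivative (\<lambda>h. h \<bullet> dheat t z)) (at z)"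
  unfolding heat_def dheat_def power2_norm_eq_inner using t
  by (auto intro!: derivative_eq_intros simp: inner_commute field_simps)

text \<open>After integration in \<open>z\<close>, the gradient of the heat kernel decays like \<open>r powr - (1 / 2)\<close>. This decay is
  the only source of convergence for long times.\<close>

lemma norm_dheat_le:
  fixes z :: "'a::euclidean_space"
  assumes r: "0 < r"
  shows "norm (dheat r z) \<le> heat_mom TYPE('a) * r powr - (1 / 2) * heat (2 * r) z"
proof -
  have "norm (dheat r z) = (norm z * heat r z) / (2 * r)" using r by (simp add: dheat_def)
  also have "\<dots> \<le> (2 * heat_mom TYPE('a) * sqrt r * heat (2 * r) z) / (2 * r)"
    using r by (intro divide_right_mono norm_mult_heat_le) auto
  also have "\<dots> = heat_mom TYPE('a) * (sqrt r / r) * heat (2 * r) z" by simp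
  also have "sqrt r / r = r powr - (1 / 2)"
    using r by (simp add: powr_minus powr_half_sqrt real_div_sqrt field_simps)
  finally show ?thesis .
qed

section \<open>The Gamma semigroup of measures on the time axis\<close>

text \<open>The measures of fractional integration of order \<open>a\<close>. They form a convolution semigroup, whose neutral
  element is the Dirac measure at 0; with it the classical gradient is the case \<open>a = 0\<close> of the theory.\<close>

definition nu :: "real \<Rightarrow> real measure" where
  "nu a = (if a = 0 then return borel 0
     else density lborel (\<lambda>t. ennreal (indicator {0<..} t * t powr (a - 1) / Gamma a)))"

lemma sets_nu [measurable_cong, simp]: "sets (nu a) = sets borel"
  by (simp add: nu_def)

lemma space_nu [simp]: "space (nu a) = UNIV"
  by (simp add: nu_def)

lemma nn_integral_nu:
  assumes "0 < a" and [measurable]: "f \<in> borel_measurable borel"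
  shows "(\<integral>\<^sup>+t. f t \<partial>nu a) =
    (\<integral>\<^sup>+t. ennreal (indicator {0<..} t * t powr (a - 1) / Gamma a) * f t \<partial>lborel)"
  using assms by (simp add: nu_def nn_integral_density)

lemma nn_integral_nu_0: "f \<in> borel_measurable borel \<Longrightarrow> (\<integral>\<^sup>+t. f t \<partial>nu 0) = f 0"
  by (simp add: nu_def nn_integral_return)

lemma sigma_finite_nu: "sigma_finite_measure (nu a)"
proof (cases "a = 0")
  case True
  interpret prob_space "return borel (0::real)" by (rule prob_space_return) simp
  show ?thesis using True by (simp add: nu_def sigma_finite_measure_axioms)
next
  case False
  then show ?thesis unfolding nu_def
    by (simp add: sigma_finite_measure.sigma_finite_iff_density_finite[OF lborel.sigma_finite_measure_axioms])
qed

interpretation nu: sigma_finite_measure "nu a" for a by (rule sigma_finite_nu)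

lemma AE_nu_pos: assumes "0 < a" shows "AE t in nu a. 0 < t"
  using assms unfolding nu_def
  by (simp, subst AE_density) (auto intro!: AE_I2 simp: indicator_def split: if_splits)

lemma AE_nu_nonneg: assumes "0 \<le> a" shows "AE t in nu a. 0 \<le> t"
proof (cases "a = 0")
  case True
  have "AE t in return borel (0::real). 0 \<le> t" by (subst AE_return) auto
  moreover have "nu a = return borel 0" using True by (simp add: nu_def)
  ultimately show ?thesis by (simp only:)
next
  case False
  with assms have "0 < a" by simp
  from AE_nu_pos[OF this] show ?thesis by (rule AE_mp) (auto intro!: AE_I2)
qed

text \<open>The substitution \<open>t = r x\<close> turns the convolution of two densities into a Beta integral.\<close>

lemma nn_integral_beta_kernel:
  assumes a: "0 < a" and b: "0 < b" and r: "0 < r"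
  shows "(\<integral>\<^sup>+t. ennreal (indicator {0<..} t * t powr (a - 1) / Gamma a *
      (indicator {0<..} (r - t) * (r - t) powr (b - 1) / Gamma b)) \<partial>lborel) =
    ennreal (r powr (a + b - 1) / Gamma (a + b))"
proof -
  let ?f = "\<lambda>t. indicator {0<..} t * t powr (a - 1) / Gamma a *
      (indicator {0<..} (r - t) * (r - t) powr (b - 1) / Gamma b)"
  have G: "0 < Gamma a" "0 < Gamma b" "0 < Gamma (a + b)" using a b by auto
  have "(\<integral>\<^sup>+t. ennreal (?f t) \<partial>lborel) = \<bar>r\<bar> * (\<integral>\<^sup>+x. ennreal (?f (0 + r * x)) \<partial>lborel)"
    using r by (intro nn_integral_real_affine) auto
  also have "(\<integral>\<^sup>+x. ennreal (?f (0 + r * x)) \<partial>lborel) =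
      (\<integral>\<^sup>+x. ennreal (r powr (a + b - 2) / (Gamma a * Gamma b)) *
         ennreal (indicator {0..1} x * (x powr (a - 1) * (1 - x) powr (b - 1))) \<partial>lborel)"
  proof (intro nn_integral_cong_AE)
    show "AE x in lborel. ennreal (?f (0 + r * x)) =
      ennreal (r powr (a + b - 2) / (Gamma a * Gamma b)) *
         ennreal (indicator {0..1} x * (x powr (a - 1) * (1 - x) powr (b - 1)))"
      using AE_lborel_singleton[of 0] AE_lborel_singleton[of 1]
    proof eventually_elim
      case (elim x)
      have "r - r * x = r * (1 - x)" by (simp add: algebra_simps)
      moreover have "r powr (a + b - 2) = r powr (a - 1) * r powr (b - 1)"
        using r by (simp flip: powr_add)
      ultimately have "?f (0 + r * x) = r powr (a + b - 2) / (Gamma a * Gamma b) *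
         (indicator {0..1} x * (x powr (a - 1) * (1 - x) powr (b - 1)))"
        using r elim by (auto simp: indicator_def powr_mult zero_less_mult_iff)
      then show ?case using G by (simp only:) (subst ennreal_mult, auto)
    qed
  qed
  also have "\<dots> = ennreal (r powr (a + b - 2) / (Gamma a * Gamma b)) *
      (\<integral>\<^sup>+x. ennreal (indicator {0..1} x * (x powr (a - 1) * (1 - x) powr (b - 1))) \<partial>lborel)"
    by (rule nn_integral_cmult) auto
  also have "(\<integral>\<^sup>+x. ennreal (indicator {0..1} x * (x powr (a - 1) * (1 - x) powr (b - 1))) \<partial>lborel) = ennreal (Beta a b)"
    by (rule nn_integral_has_integral_lebesgue[OF _ has_integral_Beta_real[OF a b]]) auto
  also have "\<bar>r\<bar> * (ennreal (r powr (a + b - 2) / (Gamma a * Gamma b)) * ennreal (Beta a b)) =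
      ennreal (r * (r powr (a + b - 2) / (Gamma a * Gamma b)) * Beta a b)"
    using r G by (simp add: Beta_def ennreal_mult[symmetric])
  also have "r * (r powr (a + b - 2) / (Gamma a * Gamma b)) * Beta a b = r powr (a + b - 1) / Gamma (a + b)"
    using r G powr_mult_base[of r "a + b - 2"] by (simp add: Beta_def field_simps)
  finally show ?thesis .
qed

lemma nn_integral_nu_add:
  assumes a: "0 < a" and b: "0 \<le> b" and [measurable]: "f \<in> borel_measurable borel"
  shows "(\<integral>\<^sup>+t. \<integral>\<^sup>+\<tau>. f (t + \<tau>) \<partial>nu b \<partial>nu a) = (\<integral>\<^sup>+r. f r \<partial>nu (a + b))"
proof (cases "b = 0")
  case True then show ?thesis by (simp add: nn_integral_nu_0)
next
  case False
  with b have b: "0 < b" by simp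
  have G: "0 < Gamma a" "0 < Gamma b" using a b by auto
  let ?w = "\<lambda>c t. indicator {0<..} t * t powr (c - 1) / Gamma c :: real"
  have "(\<integral>\<^sup>+t. \<integral>\<^sup>+\<tau>. f (t + \<tau>) \<partial>nu b \<partial>nu a) =
      (\<integral>\<^sup>+t. ennreal (?w a t) * (\<integral>\<^sup>+\<tau>. ennreal (?w b \<tau>) * f (t + \<tau>) \<partial>lborel) \<partial>lborel)"
    using a b by (simp add: nn_integral_nu)
  also have "\<dots> = (\<integral>\<^sup>+t. \<integral>\<^sup>+\<tau>. ennreal (?w a t * ?w b \<tau>) * f (t + \<tau>) \<partial>lborel \<partial>lborel)"
  proof (rule nn_integral_cong)
    fix t :: real
    have "0 \<le> ?w a t" using G by simp
    then show "ennreal (?w a t) * (\<integral>\<^sup>+\<tau>. ennreal (?w b \<tau>) * f (t + \<tau>) \<partial>lborel) =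
        (\<integral>\<^sup>+\<tau>. ennreal (?w a t * ?w b \<tau>) * f (t + \<tau>) \<partial>lborel)"
      by (subst nn_integral_cmult[symmetric]) (simp_all only: ennreal_mult' mult.assoc, measurable)
  qed
  also have "\<dots> = (\<integral>\<^sup>+t. \<integral>\<^sup>+r. ennreal (?w a t * ?w b (r - t)) * f r \<partial>lborel \<partial>lborel)"
  proof (rule nn_integral_cong)
    fix t :: real
    show "(\<integral>\<^sup>+\<tau>. ennreal (?w a t * ?w b \<tau>) * f (t + \<tau>) \<partial>lborel) =
        (\<integral>\<^sup>+r. ennreal (?w a t * ?w b (r - t)) * f r \<partial>lborel)"
      using nn_integral_translate[of "\<lambda>\<tau>. ennreal (?w a t * ?w b \<tau>) * f (t + \<tau>)" t] by simp
  qed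
  also have "\<dots> = (\<integral>\<^sup>+r. \<integral>\<^sup>+t. ennreal (?w a t * ?w b (r - t)) * f r \<partial>lborel \<partial>lborel)"
    by (rule lborel_pair.Fubini') simp
  also have "\<dots> = (\<integral>\<^sup>+r. (\<integral>\<^sup>+t. ennreal (?w a t * ?w b (r - t)) \<partial>lborel) * f r \<partial>lborel)"
    by (intro nn_integral_cong nn_integral_multc) simp
  also have "\<dots> = (\<integral>\<^sup>+r. ennreal (?w (a + b) r) * f r \<partial>lborel)"
  proof (intro nn_integral_cong)
    fix r :: real
    show "(\<integral>\<^sup>+t. ennreal (?w a t * ?w b (r - t)) \<partial>lborel) * f r = ennreal (?w (a + b) r) * f r"
    proof (cases "r > 0")
      case True then show ?thesis by (simp only: nn_integral_beta_kernel[OF a b True]) simp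
    next
      case False
      then have z: "?w a t * ?w b (r - t) = 0" for t by (auto simp: indicator_def)
      then show ?thesis using False by (simp only: z) simp
    qed
  qed
  also have "\<dots> = (\<integral>\<^sup>+r. f r \<partial>nu (a + b))" using a b by (simp add: nn_integral_nu)
  finally show ?thesis .
qed

lemma nn_integral_nu_low:
  assumes a: "0 < a" and e: "0 < a + e"
  shows "(\<integral>\<^sup>+t. ennreal (indicator {..1} t * t powr e) \<partial>nu a) = ennreal (1 / (Gamma a * (a + e)))"
proof -
  have G: "0 < Gamma a" using a by auto
  have "(\<integral>\<^sup>+t. ennreal (indicator {..1} t * t powr e) \<partial>nu a) =
      (\<integral>\<^sup>+t. ennreal (1 / Gamma a) * ennreal (indicator {0..1} t * t powr (a + e - 1)) \<partial>lborel)"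
    using G AE_lborel_singleton[of 0]
    by (subst nn_integral_nu[OF a]; (intro nn_integral_cong_AE)?)
       (auto elim!: eventually_mono simp: ennreal_mult[symmetric] indicator_def powr_add[symmetric] algebra_simps)
  also have "\<dots> = ennreal (1 / Gamma a) * (\<integral>\<^sup>+t. ennreal (indicator {0..1} t * t powr (a + e - 1)) \<partial>lborel)"
    by (rule nn_integral_cmult) auto
  also have "(\<integral>\<^sup>+t. ennreal (indicator {0..1} t * t powr (a + e - 1)) \<partial>lborel) = ennreal (1 / (a + e))"
    using nn_integral_has_integral_lebesgue[OF _ has_integral_powr_from_0[of "a + e - 1" 1]] e by simp
  finally show ?thesis using G e by (simp add: ennreal_mult[symmetric])
qed

lemma nn_integral_nu_high:
  assumes a: "0 < a" and e: "a < e"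
  shows "(\<integral>\<^sup>+t. ennreal (indicator {1<..} t * t powr - e) \<partial>nu a) = ennreal (1 / (Gamma a * (e - a)))"
proof -
  have G: "0 < Gamma a" using a by auto
  have "(\<integral>\<^sup>+t. ennreal (indicator {1<..} t * t powr - e) \<partial>nu a) =
      (\<integral>\<^sup>+t. ennreal (1 / Gamma a) * ennreal (indicator {1..} t * t powr (a - e - 1)) \<partial>lborel)"
    using G AE_lborel_singleton[of 1]
    by (subst nn_integral_nu[OF a]; (intro nn_integral_cong_AE)?)
       (auto elim!: eventually_mono simp: ennreal_mult[symmetric] indicator_def powr_add[symmetric] algebra_simps)
  also have "\<dots> = ennreal (1 / Gamma a) * (\<integral>\<^sup>+t. ennreal (indicator {1..} t * t powr (a - e - 1)) \<partial>lborel)"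
    by (rule nn_integral_cmult) auto
  also have "(\<integral>\<^sup>+t. ennreal (indicator {1..} t * t powr (a - e - 1)) \<partial>lborel) = ennreal (1 / (e - a))"
    using nn_integral_has_integral_lebesgue[OF _ has_integral_powr_to_inf[of "a - e - 1" 1]] e
    by (simp add: minus_divide_right)
  finally show ?thesis using G e by (simp add: ennreal_mult[symmetric])
qed

text \<open>A power of the distance is a mixture of heat kernels: the substitution \<open>r = (norm z)\<^sup>2 / (4 w)\<close> produces a
  Gamma integral.\<close>

lemma nn_integral_heat_nu:
  fixes z :: "'a::euclidean_space"
  assumes a: "0 < a" "a < real DIM('a) / 2" and z: "z \<noteq> 0"
  shows "(\<integral>\<^sup>+r. ennreal (heat r z) \<partial>nu a) = ennreal (Gamma (real DIM('a) / 2 - a) /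
     (Gamma a * pi powr (real DIM('a) / 2) * 4 powr a) * norm z powr (2 * a - real DIM('a)))"
proof -
  define c where "c = real DIM('a) / 2 - a"
  define A where "A = (norm z)\<^sup>2 / 4"
  have A: "0 < A" using z by (simp add: A_def)
  have c: "0 < c" using a by (simp add: c_def)
  have G: "0 < Gamma a" using a by auto
  define f where "f r = r powr (- c - 1) * exp (- A / r)" for r :: real
  define g where "g w = A / w" for w :: real
  have img: "g ` {0<..} = {0<..}"
  proof safe
    fix r :: real assume "0 < r" then show "r \<in> g ` {0<..}" using A
      by (intro image_eqI[of _ _ "A / r"]) (auto simp: g_def)
  qed (use A in \<open>auto simp: g_def\<close>)
  have Gam: "((\<lambda>w. w powr (c - 1) / exp w) has_integral Gamma c) {0<..}"
    using Gamma_integral_real[OF c]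
    by (rule has_integral_spike_set_eq[THEN iffD1, rotated 2]) (auto intro: negligible_subset[of "{0}"])
  have eq: "\<bar>- A / w\<^sup>2\<bar> * f (g w) = A powr (- c) * (w powr (c - 1) / exp w)" if "0 < w" for w
  proof -
    have "(A / w) powr (- c - 1) = A powr (- c - 1) * w powr (c + 1)"
      using A that by (simp add: powr_divide powr_minus field_simps flip: powr_add)
    moreover have "w powr (c + 1) = w powr (c - 1) * w\<^sup>2"
      using that powr_add[of w "c - 1" 2] by (simp add: powr_numeral add.commute)
    moreover have "A * A powr (- c - 1) = A powr (- c)" using A by (simp add: powr_mult_base)
    ultimately show ?thesis using A that
      by (simp add: f_def g_def exp_minus field_simps)
  qed
  have "(\<lambda>w. \<bar>- A / w\<^sup>2\<bar> * f (g w)) absolutely_integrable_on {0<..} \<and>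
      integral {0<..} (\<lambda>w. \<bar>- A / w\<^sup>2\<bar> * f (g w)) = A powr (- c) * Gamma c"
  proof -
    have "((\<lambda>w. A powr (- c) * (w powr (c - 1) / exp w)) has_integral A powr (- c) * Gamma c) {0<..}"
      by (rule has_integral_mult_right[OF Gam])
    then have h: "((\<lambda>w. \<bar>- A / w\<^sup>2\<bar> * f (g w)) has_integral A powr (- c) * Gamma c) {0<..}"
      by (rule has_integral_cong[THEN iffD1, rotated]) (use eq in auto)
    moreover have "(\<lambda>w. \<bar>- A / w\<^sup>2\<bar> * f (g w)) absolutely_integrable_on {0<..}"
      using h by (intro nonnegative_absolutely_integrable_1) (auto simp: f_def)
    ultimately show ?thesis by (simp add: integral_unique)
  qed
  moreover have "(g has_field_derivative - A / w\<^sup>2) (at w within {0<..})" if "0 < w" for w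
    unfolding g_def using that by (auto intro!: derivative_eq_intros simp: power2_eq_square)
  ultimately have "f absolutely_integrable_on g ` {0<..} \<and> integral (g ` {0<..}) f = A powr (- c) * Gamma c"
    by (subst (asm) has_absolute_integral_change_of_variables_1'[where f=f and g=g and S="{0<..}"])
       (use A in \<open>auto intro!: inj_onI simp: g_def\<close>)
  then have "(f has_integral A powr (- c) * Gamma c) {0<..}"
    unfolding img using set_lebesgue_integral_eq_integral(1) by (metis has_integral_integrable_integral)
  then have int: "(\<integral>\<^sup>+r. ennreal (indicator {0<..} r * f r) \<partial>lborel) = ennreal (A powr (- c) * Gamma c)"
    by (rule nn_integral_has_integral_lebesgue[rotated]) (simp add: f_def)
  let ?d = "real DIM('a) / 2"
  have "(\<integral>\<^sup>+r. ennreal (heat r z) \<partial>nu a) =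
      (\<integral>\<^sup>+r. ennreal ((4 * pi) powr (- ?d) / Gamma a) * ennreal (indicator {0<..} r * f r) \<partial>lborel)"
  proof (subst nn_integral_nu[OF a(1)], simp, intro nn_integral_cong)
    fix r :: real
    have "indicator {0<..} r * r powr (a - 1) / Gamma a * heat r z =
        (4 * pi) powr (- ?d) / Gamma a * (indicator {0<..} r * f r)"
    proof (cases "0 < r")
      case True
      have "(4 * pi * r) powr (- ?d) = (4 * pi) powr (- ?d) * r powr (- ?d)"
        using True by (simp add: powr_mult)
      moreover have "r powr (- ?d) * r powr (a - 1) = r powr (- c - 1)"
      proof -
        have "- ?d + (a - 1) = - c - 1" by (simp add: c_def)
        then show ?thesis by (simp only: powr_add[symmetric])
      qed
      moreover have "- (norm z)\<^sup>2 / (4 * r) = - A / r" by (simp add: A_def)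
      ultimately show ?thesis using True by (simp add: heat_def f_def mult_ac)
    qed simp
    then show "ennreal (indicator {0<..} r * r powr (a - 1) / Gamma a) * ennreal (heat r z) =
        ennreal ((4 * pi) powr (- ?d) / Gamma a) * ennreal (indicator {0<..} r * f r)"
      using G by (simp add: ennreal_mult[symmetric] f_def del: times_divide_eq_left times_divide_eq_right)
  qed
  also have "\<dots> = ennreal ((4 * pi) powr (- ?d) / Gamma a) * ennreal (A powr (- c) * Gamma c)"
    unfolding int[symmetric] by (rule nn_integral_cmult) (simp add: f_def)
  also have "\<dots> = ennreal ((4 * pi) powr (- ?d) / Gamma a * (A powr (- c) * Gamma c))"
    using G c by (intro ennreal_mult[symmetric]) (auto intro!: mult_nonneg_nonneg less_imp_le[OF Gamma_real_pos])
  also have "A powr (- c) = norm z powr (2 * a - real DIM('a)) * 4 powr c"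
  proof -
    have "A powr (- c) = (norm z powr 2) powr (- c) / 4 powr (- c)"
      using z by (simp add: A_def powr_divide powr_numeral)
    moreover have "2 * (- c) = 2 * a - real DIM('a)" by (simp add: c_def)
    moreover have "inverse (4 powr (- c)) = 4 powr c" by (simp add: powr_minus)
    ultimately show ?thesis by (simp only: powr_powr divide_inverse)
  qed
  also have "(4 * pi) powr (- ?d) / Gamma a * (norm z powr (2 * a - real DIM('a)) * 4 powr c * Gamma c) =
      Gamma c / (Gamma a * pi powr ?d * 4 powr a) * norm z powr (2 * a - real DIM('a))"
  proof -
    have "(2::real) powr (a * 2) = 4 powr a" using powr_powr[of 2 2 a] by (simp add: mult.commute)
    then show ?thesis using G by (simp add: c_def powr_mult powr_minus powr_diff field_simps)
  qed
  finally show ?thesis by (simp add: c_def)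
qed


lemma nu_add_distr:
  assumes a: "0 < a" and b: "0 \<le> b"
  shows "nu (a + b) = distr (nu a \<Otimes>\<^sub>M nu b) borel (\<lambda>x. fst x + snd x)"
proof (rule measure_eqI)
  fix A assume "A \<in> sets (nu (a + b))"
  then have [measurable]: "A \<in> sets borel" by simp
  have "emeasure (distr (nu a \<Otimes>\<^sub>M nu b) borel (\<lambda>x. fst x + snd x)) A =
      (\<integral>\<^sup>+r. indicator A r \<partial>distr (nu a \<Otimes>\<^sub>M nu b) borel (\<lambda>x. fst x + snd x))"
    by simp
  also have "\<dots> = (\<integral>\<^sup>+x. indicator A (fst x + snd x) \<partial>(nu a \<Otimes>\<^sub>M nu b))"
    by (rule nn_integral_distr) measurable
  also have "\<dots> = (\<integral>\<^sup>+t. \<integral>\<^sup>+\<tau>. indicator A (t + \<tau>) \<partial>nu b \<partial>nu a)"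
    by (subst nu.nn_integral_fst[symmetric]) auto
  also have "\<dots> = emeasure (nu (a + b)) A"
    by (subst nn_integral_nu_add[OF a b]) auto
  finally show "emeasure (nu (a + b)) A = emeasure (distr (nu a \<Otimes>\<^sub>M nu b) borel (\<lambda>x. fst x + snd x)) A"
    by simp
qed simp

text \<open>A time distributed like \<open>nu (a + b)\<close> is a sum \<open>t + \<tau>\<close> with \<open>t\<close> from \<open>nu a\<close> and \<open>\<tau>\<close> from \<open>nu b\<close>. It is split
  according to whether \<open>t \<le> 1\<close>. For \<open>t \<le> 1\<close> only the law of \<open>t\<close> is recorded, because \<open>\<tau>\<close> is absorbed into
  the gradient of higher order; for \<open>t > 1\<close> the law of the sum is.\<close>

definition early :: "real \<Rightarrow> real measure" where
  "early a = density (nu a) (indicator {..1})"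

definition late :: "real \<Rightarrow> real \<Rightarrow> real measure" where
  "late a b = distr (density (nu a \<Otimes>\<^sub>M nu b) (\<lambda>x. indicator {1<..} (fst x))) borel (\<lambda>x. fst x + snd x)"

lemma sets_early [measurable_cong, simp]: "sets (early a) = sets borel"
  by (simp add: early_def)

lemma sets_late [measurable_cong, simp]: "sets (late a b) = sets borel"
  by (simp add: late_def)

lemma space_early [simp]: "space (early a) = UNIV" and space_late [simp]: "space (late a b) = UNIV"
  by (simp_all add: early_def late_def)

interpretation nu2: pair_sigma_finite "nu a" "nu b" for a b
  by (rule pair_sigma_finite.intro) (rule sigma_finite_nu)+

lemma nn_integral_early:
  "f \<in> borel_measurable borel \<Longrightarrow> (\<integral>\<^sup>+t. f t \<partial>early a) = (\<integral>\<^sup>+t. indicator {..1} t * f t \<partial>nu a)"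
  unfolding early_def by (subst nn_integral_density) auto

lemma nn_integral_late:
  assumes [measurable]: "f \<in> borel_measurable borel"
  shows "(\<integral>\<^sup>+r. f r \<partial>late a b) = (\<integral>\<^sup>+t. indicator {1<..} t * (\<integral>\<^sup>+\<tau>. f (t + \<tau>) \<partial>nu b) \<partial>nu a)"
proof -
  have "(\<integral>\<^sup>+r. f r \<partial>late a b) = (\<integral>\<^sup>+x. indicator {1<..} (fst x) * f (fst x + snd x) \<partial>(nu a \<Otimes>\<^sub>M nu b))"
    unfolding late_def by (subst nn_integral_distr, measurable) (subst nn_integral_density, auto)
  also have "\<dots> = (\<integral>\<^sup>+t. \<integral>\<^sup>+\<tau>. indicator {1<..} t * f (t + \<tau>) \<partial>nu b \<partial>nu a)"
    by (subst nu.nn_integral_fst[symmetric]) auto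
  also have "\<dots> = (\<integral>\<^sup>+t. indicator {1<..} t * (\<integral>\<^sup>+\<tau>. f (t + \<tau>) \<partial>nu b) \<partial>nu a)"
    by (intro nn_integral_cong nn_integral_cmult) auto
  finally show ?thesis .
qed

lemma integral_nu_split:
  fixes P :: "real \<Rightarrow> 'b::{banach, second_countable_topology}"
  assumes a: "0 < a" and b: "0 \<le> b" and P: "integrable (nu (a + b)) P"
  shows "integrable (late a b) P"
    and "(LINT r|nu (a + b). P r) = (LINT t|early a. LINT \<tau>|nu b. P (t + \<tau>)) + (LINT r|late a b. P r)"
proof -
  let ?Q = "nu a \<Otimes>\<^sub>M nu b"
  have [measurable]: "P \<in> borel_measurable borel" using P by auto
  have PQ: "integrable ?Q (\<lambda>x. P (fst x + snd x))"
    using P unfolding nu_add_distr[OF a b] by (subst (asm) integrable_distr_eq) auto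
  have i1: "integrable ?Q (\<lambda>x. indicator {..1} (fst x) *\<^sub>R P (fst x + snd x))"
    by (rule Bochner_Integration.integrable_bound[OF PQ]) (auto simp: indicator_def)
  have i2: "integrable ?Q (\<lambda>x. indicator {1<..} (fst x) *\<^sub>R P (fst x + snd x))"
    by (rule Bochner_Integration.integrable_bound[OF PQ]) (auto simp: indicator_def)
  have "(\<lambda>x. indicator {1<..} (fst x) :: ennreal) = (\<lambda>x::real\<times>real. ennreal (indicator {1<..} (fst x)))"
    by (auto simp: indicator_def)
  note late = late_def[unfolded this]
  show "integrable (late a b) P"
    unfolding late using i2 by (subst integrable_distr_eq, measurable) (subst integrable_density, auto)
  have h: "(LINT r|late a b. P r) = (LINT x|?Q. indicator {1<..} (fst x) *\<^sub>R P (fst x + snd x))"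
    unfolding late by (subst integral_distr, measurable) (subst integral_density, auto)
  have "(LINT r|nu (a + b). P r) = (LINT x|?Q. P (fst x + snd x))"
    unfolding nu_add_distr[OF a b] by (subst integral_distr) auto
  also have "\<dots> = (LINT x|?Q. indicator {..1} (fst x) *\<^sub>R P (fst x + snd x) +
      indicator {1<..} (fst x) *\<^sub>R P (fst x + snd x))"
    by (intro Bochner_Integration.integral_cong) (auto simp: indicator_def)
  also have "\<dots> = (LINT x|?Q. indicator {..1} (fst x) *\<^sub>R P (fst x + snd x)) + (LINT r|late a b. P r)"
    unfolding h by (rule Bochner_Integration.integral_add[OF i1 i2])
  also have "(LINT x|?Q. indicator {..1} (fst x) *\<^sub>R P (fst x + snd x)) =
      (LINT t|nu a. LINT \<tau>|nu b. indicator {..1} t *\<^sub>R P (t + \<tau>))"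
    using nu2.integral_fst'[OF i1] by simp
  also have "\<dots> = (LINT t|nu a. indicator {..1} t *\<^sub>R (LINT \<tau>|nu b. P (t + \<tau>)))" by simp
  also have "\<dots> = (LINT t|early a. LINT \<tau>|nu b. P (t + \<tau>))"
  proof -
    have "(\<lambda>x. indicator {..1} x :: ennreal) = (\<lambda>x::real. ennreal (indicator {..1} x))"
      by (auto simp: indicator_def)
    note early = early_def[unfolded this]
    have [measurable]: "(\<lambda>t. LINT \<tau>|nu b. P (t + \<tau>)) \<in> borel_measurable (nu a)"
      by (rule nu.borel_measurable_lebesgue_integral) simp
    show ?thesis unfolding early by (subst integral_density) auto
  qed
  finally show "(LINT r|nu (a + b). P r) =
    (LINT t|early a. LINT \<tau>|nu b. P (t + \<tau>)) + (LINT r|late a b. P r)" .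
qed

lemma AE_early: assumes "0 < a" shows "AE t in early a. 0 < t \<and> t \<le> 1"
proof -
  have "AE t in nu a. indicator {..1::real} t > (0::ennreal) \<longrightarrow> 0 < t \<and> t \<le> 1"
    using AE_nu_pos[OF assms] by eventually_elim (auto simp: indicator_def split: if_splits)
  then show ?thesis unfolding early_def by (subst AE_density) auto
qed

lemma AE_late: assumes a: "0 < a" and b: "0 \<le> b" shows "AE r in late a b. 0 < r"
proof -
  have "(\<integral>\<^sup>+r. indicator {..0} r \<partial>late a b) = (\<integral>\<^sup>+t. indicator {1<..} t * (\<integral>\<^sup>+\<tau>. indicator {..0} (t + \<tau>) \<partial>nu b) \<partial>nu a)"
    by (rule nn_integral_late) auto
  also have "\<dots> = (\<integral>\<^sup>+t. 0 \<partial>nu a)"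
  proof (rule nn_integral_cong)
    fix t :: real
    have "(\<integral>\<^sup>+\<tau>. indicator {..0} (t + \<tau>) \<partial>nu b) = (\<integral>\<^sup>+\<tau>. 0 \<partial>nu b)" if "1 < t"
      using AE_nu_nonneg[OF b] that
      by (intro nn_integral_cong_AE) (auto elim!: eventually_mono simp: indicator_def)
    then show "indicator {1<..} t * (\<integral>\<^sup>+\<tau>. indicator {..0} (t + \<tau>) \<partial>nu b) = 0"
      by (auto simp: indicator_def)
  qed
  finally have "emeasure (late a b) {..0} = 0" by simp
  then have "{..0} \<in> null_sets (late a b)" by auto
  from AE_not_in[OF this] show ?thesis by eventually_elim auto
qed

lemma early_mass:
  assumes "0 < a" shows "(\<integral>\<^sup>+t. 1 \<partial>early a) = ennreal (1 / Gamma (a + 1))"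
proof -
  have "(\<integral>\<^sup>+t. 1 \<partial>early a) = (\<integral>\<^sup>+t. ennreal (indicator {..1} t * t powr 0) \<partial>nu a)"
    using AE_nu_pos[OF assms] by (subst nn_integral_early, simp, intro nn_integral_cong_AE)
      (auto elim!: eventually_mono simp: indicator_def)
  moreover have "Gamma (a + 1) = a * Gamma a"
    using assms by (intro Gamma_plus1) (auto elim!: nonpos_Ints_cases)
  ultimately show ?thesis using nn_integral_nu_low[of a 0] assms by (simp add: mult.commute)
qed

lemma early_sqrt:
  assumes "0 < a" shows "(\<integral>\<^sup>+t. ennreal (sqrt t) \<partial>early a) = ennreal (1 / (Gamma a * (a + 1 / 2)))"
proof -
  have "(\<integral>\<^sup>+t. ennreal (sqrt t) \<partial>early a) = (\<integral>\<^sup>+t. ennreal (indicator {..1} t * t powr (1 / 2)) \<partial>nu a)"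
    using AE_nu_pos[OF assms] by (subst nn_integral_early, simp, intro nn_integral_cong_AE)
      (auto elim!: eventually_mono simp: indicator_def powr_half_sqrt)
  then show ?thesis using nn_integral_nu_low[of a "1 / 2"] assms by simp
qed

text \<open>What remains of the weight \<open>(t + \<tau>) powr - (1 / 2)\<close> for \<open>t > 1\<close> when \<open>t powr - e\<close> is split off.\<close>

definition decay_const :: "real \<Rightarrow> real \<Rightarrow> ennreal" where
  "decay_const b e = (\<integral>\<^sup>+\<tau>. ennreal ((1 + \<tau>) powr (e - 1 / 2)) \<partial>nu b)"

lemma decay_const_finite:
  assumes b: "0 \<le> b" and e: "0 < e" "b + e < 1 / 2"
  shows "decay_const b e < \<infinity>"
proof (cases "b = 0")
  case True
  then show ?thesis by (simp add: decay_const_def nn_integral_nu_0)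
next
  case False
  with b have b: "0 < b" by simp
  have "decay_const b e \<le> (\<integral>\<^sup>+\<tau>. ennreal (indicator {..1} \<tau> * \<tau> powr 0) + ennreal (indicator {1<..} \<tau> * \<tau> powr - (1 / 2 - e)) \<partial>nu b)"
    unfolding decay_const_def
  proof (intro nn_integral_mono_AE, use AE_nu_pos[OF b] in eventually_elim)
    case (elim \<tau>)
    show ?case
    proof (cases "\<tau> \<le> 1")
      case True
      have "(1 + \<tau>) powr (e - 1 / 2) \<le> 1 powr (e - 1 / 2)"
        using elim e b by (intro powr_mono2') auto
      then show ?thesis using True elim by (simp add: ennreal_leI)
    next
      case False
      have "(1 + \<tau>) powr (e - 1 / 2) \<le> \<tau> powr (e - 1 / 2)"
        using elim e b by (intro powr_mono2') auto
      then show ?thesis using False elim by (simp add: ennreal_leI)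
    qed
  qed
  also have "\<dots> = ennreal (1 / (Gamma b * (b + 0))) + ennreal (1 / (Gamma b * (1 / 2 - e - b)))"
    using nn_integral_nu_low[of b 0] nn_integral_nu_high[of b "1 / 2 - e"] b e
    by (subst nn_integral_add) auto
  also have "\<dots> < \<infinity>" by simp
  finally show ?thesis .
qed

text \<open>The weight \<open>r powr (-1/2)\<close> is the decay of the gradient of the heat kernel. Part of it pays for
  the integrability in \<open>t\<close>, the rest for the integrability in \<open>\<tau>\<close>.\<close>

lemma late_bound:
  assumes a: "0 < a" "a < e" and b: "0 \<le> b" and e: "e < 1 / 2"
  shows "(\<integral>\<^sup>+r. ennreal (r powr - (1 / 2)) \<partial>late a b) \<le> decay_const b e * ennreal (1 / (Gamma a * (e - a)))"
proof -
  have "(\<integral>\<^sup>+r. ennreal (r powr - (1 / 2)) \<partial>late a b) =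
      (\<integral>\<^sup>+t. indicator {1<..} t * (\<integral>\<^sup>+\<tau>. ennreal ((t + \<tau>) powr - (1 / 2)) \<partial>nu b) \<partial>nu a)"
    by (rule nn_integral_late) simp
  also have "\<dots> \<le> (\<integral>\<^sup>+t. decay_const b e * ennreal (indicator {1<..} t * t powr - e) \<partial>nu a)"
  proof (rule nn_integral_mono)
    fix t :: real
    show "indicator {1<..} t * (\<integral>\<^sup>+\<tau>. ennreal ((t + \<tau>) powr - (1 / 2)) \<partial>nu b) \<le>
        decay_const b e * ennreal (indicator {1<..} t * t powr - e)"
    proof (cases "1 < t")
      case True
      have "(\<integral>\<^sup>+\<tau>. ennreal ((t + \<tau>) powr - (1 / 2)) \<partial>nu b) \<le>
          (\<integral>\<^sup>+\<tau>. ennreal ((1 + \<tau>) powr (e - 1 / 2)) * ennreal (t powr - e) \<partial>nu b)"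
      proof (intro nn_integral_mono_AE, use AE_nu_nonneg[OF b] in eventually_elim)
        case (elim \<tau>)
        have "(t + \<tau>) powr - (1 / 2) = (t + \<tau>) powr (e - 1 / 2) * (t + \<tau>) powr - e"
          by (simp flip: powr_add)
        also have "\<dots> \<le> (1 + \<tau>) powr (e - 1 / 2) * t powr - e"
          using elim True e a by (intro mult_mono powr_mono2') auto
        finally show ?case by (simp add: ennreal_mult[symmetric] ennreal_leI)
      qed
      also have "\<dots> = decay_const b e * ennreal (t powr - e)"
        unfolding decay_const_def by (rule nn_integral_multc) simp
      finally show ?thesis using True by simp
    qed simp
  qed
  also have "\<dots> = decay_const b e * ennreal (1 / (Gamma a * (e - a)))"
    using a by (subst nn_integral_cmult) (auto simp: nn_integral_nu_high)
  finally show ?thesis .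
qed

lemma late_finite:
  assumes a: "0 < a" and b: "0 \<le> b" and ab: "a + b < 1 / 2"
  shows "(\<integral>\<^sup>+r. ennreal (r powr - (1 / 2)) \<partial>late a b) < \<infinity>"
proof -
  \<comment> \<open>The midpoint of the admissible interval from \<open>a\<close> to \<open>1 / 2 - b\<close>.\<close>
  define e where "e = (a + (1 / 2 - b)) / 2"
  have e: "a < e" "b + e < 1 / 2" "e < 1 / 2" using a b ab by (auto simp: e_def field_simps)
  show ?thesis
    using late_bound[OF a e(1) b e(3)] decay_const_finite[OF b _ e(2)] a e
    by (auto simp: ennreal_mult_less_top intro: le_less_trans)
qed

text \<open>Measures on the time axis against which the heat flow is averaged. Nonpositive times are excluded
  because \<open>heat\<close> is a probability density for positive times only.\<close>

locale time_measure = sigma_finite_measure M for M :: "real measure" +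
  assumes sets_M [measurable_cong, simp]: "sets M = sets borel"
    and AE_pos: "AE r in M. 0 < r"

lemma time_measure_nu: "0 < a \<Longrightarrow> time_measure (nu a)"
  by (intro time_measure.intro time_measure_axioms.intro sigma_finite_nu AE_nu_pos) auto

lemma time_measure_early: assumes a: "0 < a" shows "time_measure (early a)"
proof (intro time_measure.intro time_measure_axioms.intro)
  have "emeasure (early a) (space (early a)) < \<infinity>"
    using early_mass[OF a] by simp
  then interpret finite_measure "early a" by (intro finite_measureI) auto
  show "sigma_finite_measure (early a)" by (rule sigma_finite_measure_axioms)
  show "AE r in early a. 0 < r" using AE_early[OF a] by eventually_elim simp
qed simp

lemma time_measure_late:
  assumes a: "0 < a" and b: "0 \<le> b" and ab: "a + b < 1 / 2"
  shows "time_measure (late a b)"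
proof (intro time_measure.intro time_measure_axioms.intro AE_late a b)
  note fin = late_finite[OF a b ab]
  show "sigma_finite_measure (late a b)"
  proof (rule sigma_finite_measure.intro, intro exI conjI ballI)
    show "countable (range (\<lambda>n. {..real n}))" by simp
    show "\<Union> (range (\<lambda>n. {..real n})) = space (late a b)"
      using real_arch_simple by auto
    fix A assume "A \<in> range (\<lambda>n. {..real n})"
    then obtain n where n: "A = {..real n}" by auto
    have "emeasure (late a b) A = (\<integral>\<^sup>+r. indicator A r \<partial>late a b)" using n by simp
    also have "\<dots> \<le> (\<integral>\<^sup>+r. ennreal (sqrt (real n)) * ennreal (r powr - (1 / 2)) \<partial>late a b)"
    proof (intro nn_integral_mono_AE, use AE_late[OF a b] in eventually_elim)
      case (elim r)
      show ?case
      proof (cases "r \<le> real n")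
        case True
        then have "1 \<le> sqrt (real n) * r powr - (1 / 2)"
          using elim by (simp add: powr_minus powr_half_sqrt field_simps)
        then show ?thesis using True n by (simp add: ennreal_mult[symmetric])
      qed (simp add: n)
    qed
    also have "\<dots> = ennreal (sqrt (real n)) * (\<integral>\<^sup>+r. ennreal (r powr - (1 / 2)) \<partial>late a b)"
      by (rule nn_integral_cmult) simp
    also have "\<dots> < \<infinity>" using fin by (simp add: ennreal_mult_less_top)
    finally show "emeasure (late a b) A \<noteq> \<infinity>" by simp
  qed auto
qed simp

section \<open>Integral inequalities in Lebesgue spaces\<close>

lemma powr_tangent:
  fixes y m p :: real
  assumes p: "1 < p" and "0 \<le> y" "0 \<le> m"
  shows "p * m powr (p - 1) * y \<le> y powr p + (p - 1) * m powr p"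
proof -
  define q where "q = p / (p - 1)"
  have q: "1 < q" "1 / p + 1 / q = 1" "(p - 1) * q = p" "p / q = p - 1"
    using p by (auto simp: q_def field_simps)
  have "y * m powr (p - 1) \<le> y powr p / p + (m powr (p - 1)) powr q / q"
    using assms q by (intro Youngs_inequality) auto
  then have "p * (y * m powr (p - 1)) \<le> p * (y powr p / p + m powr p / q)"
    using p q by (intro mult_left_mono) (auto simp: powr_powr)
  also have "\<dots> = y powr p + (p / q) * m powr p" using p by (simp add: field_simps)
  finally show ?thesis using q by (simp add: mult_ac)
qed

lemma powr_weight:
  fixes f c p :: real
  assumes "1 < p" "0 \<le> f" "0 \<le> c" "c = 0 \<Longrightarrow> f = 0" "0 \<le> m"
  shows "p * m powr (p - 1) * f \<le> c powr (1 - p) * f powr p + (p - 1) * m powr p * c"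
proof (cases "c = 0")
  case False
  with assms have c: "0 < c" by simp
  have "p * m powr (p - 1) * (f / c) * c \<le> ((f / c) powr p + (p - 1) * m powr p) * c"
    using assms c by (intro mult_right_mono powr_tangent) auto
  moreover have "(f / c) powr p * c = c powr (1 - p) * f powr p"
    using c assms by (simp add: powr_divide powr_diff)
  ultimately show ?thesis using c by (simp add: algebra_simps)
qed (use assms in auto)

text \<open>Jensen's inequality for \<open>f / c\<close> and the measure with density \<open>c\<close>: the tangent inequality at the mean
  \<open>m\<close> is integrated. A bound \<open>C\<close> for the total mass suffices, since the mass enters with a negative sign.\<close>

lemma weighted_Jensen:
  fixes f c :: "'t \<Rightarrow> real"
  assumes p: "1 < p" and [measurable]: "f \<in> borel_measurable T" "c \<in> borel_measurable T"
    and f: "\<And>t. 0 \<le> f t" and c: "\<And>t. 0 \<le> c t" and cf: "\<And>t. c t = 0 \<Longrightarrow> f t = 0"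
    and C: "(\<integral>\<^sup>+t. ennreal (c t) \<partial>T) \<le> ennreal C" "0 < C"
    and fin: "(\<integral>\<^sup>+t. ennreal (c t powr (1 - p) * f t powr p) \<partial>T) < \<infinity>"
  shows "integrable T f"
    and "ennreal ((LINT t|T. f t) powr p) \<le>
      ennreal (C powr (p - 1)) * (\<integral>\<^sup>+t. ennreal (c t powr (1 - p) * f t powr p) \<partial>T)"
proof -
  let ?h = "\<lambda>t. c t powr (1 - p) * f t powr p"
  have ic: "integrable T c"
    using C by (intro integrableI_nonneg) (auto simp: c intro: le_less_trans)
  have ih: "integrable T ?h" using fin by (intro integrableI_nonneg) auto
  have le: "p * m powr (p - 1) * f t \<le> ?h t + (p - 1) * m powr p * c t" if "0 \<le> m" for m t
    using powr_weight[OF p f c cf that] .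
  show i: "integrable T f"
  proof (rule Bochner_Integration.integrable_bound)
    show "integrable T (\<lambda>t. ?h t + (p - 1) * c t)" using ic ih by auto
    show "AE t in T. norm (f t) \<le> norm (?h t + (p - 1) * c t)"
    proof (rule AE_I2)
      fix t
      have "1 * f t \<le> p * f t" using p f by (intro mult_right_mono) auto
      also have "\<dots> \<le> ?h t + (p - 1) * c t" using le[of 1 t] by simp
      finally show "norm (f t) \<le> norm (?h t + (p - 1) * c t)" using f[of t] by simp
    qed
  qed simp
  \<comment> \<open>The bound \<open>C\<close> plays the part of the total mass, so this is the mean at which the tangent is taken.\<close>
  define m where "m = (LINT t|T. f t) / C"
  have F0: "0 \<le> (LINT t|T. f t)" using f by simp
  have m: "0 \<le> m" using F0 C by (simp add: m_def)
  have cC: "(LINT t|T. c t) \<le> C"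
    using C c by (subst (asm) nn_integral_eq_integral[OF ic]) auto
  have "p * m powr (p - 1) * (LINT t|T. f t) = (LINT t|T. p * m powr (p - 1) * f t)" by simp
  also have "\<dots> \<le> (LINT t|T. ?h t + (p - 1) * m powr p * c t)"
    using i ih ic le[OF m] by (intro integral_mono) auto
  also have "\<dots> = (LINT t|T. ?h t) + (p - 1) * m powr p * (LINT t|T. c t)"
    using ih ic by simp
  also have "\<dots> \<le> (LINT t|T. ?h t) + (p - 1) * m powr p * C"
    using cC p by (intro add_left_mono mult_left_mono) auto
  finally have *: "p * m powr (p - 1) * (LINT t|T. f t) \<le> (LINT t|T. ?h t) + (p - 1) * m powr p * C" .
  have "m powr p * C \<le> (LINT t|T. ?h t)"
  proof -
    have "(LINT t|T. f t) = m * C" using C by (simp add: m_def)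
    moreover have "m powr (p - 1) * m = m powr p" using m powr_mult_base[of m "p - 1"] by (simp add: mult.commute)
    ultimately have "p * m powr (p - 1) * (LINT t|T. f t) = p * (m powr p * C)"
      by (metis mult.assoc)
    with * have "p * (m powr p * C) \<le> (LINT t|T. ?h t) + (p - 1) * (m powr p * C)"
      by (simp only: mult.assoc)
    then show ?thesis by (simp add: algebra_simps)
  qed
  then have "C powr (p - 1) * (m powr p * C) \<le> C powr (p - 1) * (LINT t|T. ?h t)"
    by (intro mult_left_mono) auto
  moreover have "C powr (p - 1) * (m powr p * C) = (LINT t|T. f t) powr p"
    using C F0 powr_mult_base[of C "p - 1"] by (simp add: m_def powr_divide field_simps)
  ultimately have "(LINT t|T. f t) powr p \<le> C powr (p - 1) * (LINT t|T. ?h t)" by simp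
  then show "ennreal ((LINT t|T. f t) powr p) \<le> ennreal (C powr (p - 1)) * (\<integral>\<^sup>+t. ennreal (?h t) \<partial>T)"
    by (subst nn_integral_eq_integral[OF ih]) (auto simp: ennreal_mult[symmetric] ennreal_leI)
qed

text \<open>Minkowski's integral inequality, in the form in which a bound \<open>c t\<close> for the norm of each slice
  is known. Jensen's inequality is applied to the measure with density \<open>c\<close>, and the order of
  integration is exchanged.\<close>

lemma Minkowski_weighted:
  fixes f :: "'x \<Rightarrow> 't \<Rightarrow> real" and c :: "'t \<Rightarrow> real" and I :: ennreal
  assumes p: "1 < p" and X: "sigma_finite_measure X" and T: "sigma_finite_measure T"
    and [measurable]: "(\<lambda>(x, t). f x t) \<in> borel_measurable (X \<Otimes>\<^sub>M T)" "c \<in> borel_measurable T"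
    and f: "\<And>x t. 0 \<le> f x t" and c: "\<And>t. 0 \<le> c t" and cf: "\<And>x t. c t = 0 \<Longrightarrow> f x t = 0"
    and C: "(\<integral>\<^sup>+t. ennreal (c t) \<partial>T) \<le> ennreal C" "0 < C" and I: "I < \<infinity>"
    and b: "\<And>t. t \<in> space T \<Longrightarrow> (\<integral>\<^sup>+x. ennreal (f x t powr p) \<partial>X) \<le> ennreal (c t powr p) * I"
  shows "AE x in X. integrable T (f x)"
    and "(\<integral>\<^sup>+x. ennreal ((LINT t|T. f x t) powr p) \<partial>X) \<le> ennreal (C powr p) * I"
proof -
  interpret X: sigma_finite_measure X by (rule X)
  interpret T: sigma_finite_measure T by (rule T)
  interpret XT: pair_sigma_finite X T ..
  let ?\<Phi> = "\<lambda>x. \<integral>\<^sup>+t. ennreal (c t powr (1 - p) * f x t powr p) \<partial>T"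
  have mf [measurable]: "f x \<in> borel_measurable T" if "x \<in> space X" for x
    using that by measurable
  have "(\<integral>\<^sup>+x. ?\<Phi> x \<partial>X) = (\<integral>\<^sup>+t. \<integral>\<^sup>+x. ennreal (c t powr (1 - p) * f x t powr p) \<partial>X \<partial>T)"
    by (rule XT.Fubini'[symmetric]) measurable
  also have "\<dots> = (\<integral>\<^sup>+t. ennreal (c t powr (1 - p)) * (\<integral>\<^sup>+x. ennreal (f x t powr p) \<partial>X) \<partial>T)"
    by (intro nn_integral_cong, subst nn_integral_cmult[symmetric]) (auto simp: ennreal_mult)
  also have "\<dots> \<le> (\<integral>\<^sup>+t. ennreal (c t) * I \<partial>T)"
  proof (rule nn_integral_mono)
    fix t assume t: "t \<in> space T"
    have "ennreal (c t powr (1 - p)) * (\<integral>\<^sup>+x. ennreal (f x t powr p) \<partial>X) \<le>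
        ennreal (c t powr (1 - p)) * (ennreal (c t powr p) * I)"
      by (intro mult_left_mono b t) auto
    also have "\<dots> = ennreal (c t) * I"
      using c[of t] by (simp add: mult.assoc[symmetric] ennreal_mult[symmetric] powr_add[symmetric])
    finally show "ennreal (c t powr (1 - p)) * (\<integral>\<^sup>+x. ennreal (f x t powr p) \<partial>X) \<le> ennreal (c t) * I" .
  qed
  also have "\<dots> = (\<integral>\<^sup>+t. ennreal (c t) \<partial>T) * I" by (rule nn_integral_multc) simp
  also have "\<dots> \<le> ennreal C * I" by (intro mult_right_mono C) auto
  finally have \<Phi>: "(\<integral>\<^sup>+x. ?\<Phi> x \<partial>X) \<le> ennreal C * I" .
  also have "\<dots> < \<infinity>" using I by (simp add: ennreal_mult_less_top)
  finally have "AE x in X. ?\<Phi> x \<noteq> \<infinity>"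
    by (intro nn_integral_PInf_AE) auto
  then have fin: "AE x in X. ?\<Phi> x < \<infinity>" by eventually_elim (simp add: top.not_eq_extremum)
  show "AE x in X. integrable T (f x)"
    using fin AE_space
  proof eventually_elim
    case (elim x)
    then show ?case by (intro weighted_Jensen(1)[OF p mf _ f c cf C]) auto
  qed
  have "(\<integral>\<^sup>+x. ennreal ((LINT t|T. f x t) powr p) \<partial>X) \<le> (\<integral>\<^sup>+x. ennreal (C powr (p - 1)) * ?\<Phi> x \<partial>X)"
  proof (rule nn_integral_mono_AE, use fin AE_space in eventually_elim)
    case (elim x)
    then show ?case by (intro weighted_Jensen(2)[OF p mf _ f c cf C]) auto
  qed
  also have "\<dots> = ennreal (C powr (p - 1)) * (\<integral>\<^sup>+x. ?\<Phi> x \<partial>X)"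
    by (rule nn_integral_cmult) measurable
  also have "\<dots> \<le> ennreal (C powr (p - 1)) * (ennreal C * I)" by (intro mult_left_mono \<Phi>) auto
  also have "\<dots> = ennreal (C powr p) * I"
  proof -
    have "C powr (p - 1) * C = C powr p"
      using C powr_mult_base[of C "p - 1"] by (simp add: mult.commute)
    then have "ennreal (C powr (p - 1)) * ennreal C = ennreal (C powr p)"
      using C by (simp flip: ennreal_mult)
    then show ?thesis by (simp flip: mult.assoc)
  qed
  finally show "(\<integral>\<^sup>+x. ennreal ((LINT t|T. f x t) powr p) \<partial>X) \<le> ennreal (C powr p) * I" .
qed

lemma Young_sum:
  fixes a b p :: real
  assumes p: "1 < p" and q: "q = p / (p - 1)" and "0 \<le> a" "0 \<le> b"
  shows "a * b \<le> a powr p + b powr q"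
proof -
  have q1: "1 < q" "1 / p + 1 / q = 1" using p by (auto simp: q field_simps)
  have "a * b \<le> a powr p / p + b powr q / q"
    using assms q1 by (intro Youngs_inequality) auto
  also have "\<dots> \<le> a powr p + b powr q"
    using p q1 by (intro add_mono) (auto simp: divide_le_eq mult_le_cancel_left1)
  finally show ?thesis .
qed

text \<open>The \<open>p\<close>-th power of the norm of \<open>L\<^sup>p\<close>, with values in \<open>ennreal\<close> so that finiteness can be derived
  rather than presupposed. It is subadditive up to the factor \<open>2 powr p\<close> only, which limits do not notice.\<close>

definition pint :: "real \<Rightarrow> ('a::euclidean_space \<Rightarrow> 'b::real_normed_vector) \<Rightarrow> ennreal" where
  "pint p f = (\<integral>\<^sup>+x. ennreal (norm (f x) powr p) \<partial>lborel)"

lemma pint_cong_AE: "AE x in lborel. f x = g x \<Longrightarrow> pint p f = pint p g"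
  unfolding pint_def by (intro nn_integral_cong_AE) (auto elim: eventually_mono)

lemma pint_mono: 
  "0 \<le> p \<Longrightarrow> (\<And>x. norm (f x) \<le> norm (g x)) \<Longrightarrow> pint p f \<le> pint p g"
  unfolding pint_def by (intro nn_integral_mono ennreal_leI powr_mono2) auto

lemma powr_add_le:
  fixes a b :: real
  assumes "0 \<le> p" "0 \<le> a" "0 \<le> b"
  shows "(a + b) powr p \<le> 2 powr p * (a powr p + b powr p)"
proof -
  have "(a + b) powr p \<le> (2 * max a b) powr p" using assms by (intro powr_mono2) auto
  also have "\<dots> = 2 powr p * max a b powr p" using assms by (simp add: powr_mult)
  also have "max a b powr p \<le> a powr p + b powr p" by (auto simp: max_def)
  finally show ?thesis by simp
qed

lemma pint_add:
  assumes [measurable]: "f \<in> borel_measurable borel" "g \<in> borel_measurable borel" and p: "0 \<le> p"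
  shows "pint p (\<lambda>x. f x + g x) \<le> ennreal (2 powr p) * (pint p f + pint p g)"
proof -
  have "pint p (\<lambda>x. f x + g x) \<le> (\<integral>\<^sup>+x. ennreal (2 powr p) * (ennreal (norm (f x) powr p) + ennreal (norm (g x) powr p)) \<partial>lborel)"
    unfolding pint_def
  proof (rule nn_integral_mono)
    fix x
    have "norm (f x + g x) powr p \<le> (norm (f x) + norm (g x)) powr p"
      using p by (intro powr_mono2 norm_triangle_ineq) auto
    also have "\<dots> \<le> 2 powr p * (norm (f x) powr p + norm (g x) powr p)"
      using p by (intro powr_add_le) auto
    finally show "ennreal (norm (f x + g x) powr p) \<le>
        ennreal (2 powr p) * (ennreal (norm (f x) powr p) + ennreal (norm (g x) powr p))"
      by (simp add: ennreal_mult[symmetric] ennreal_plus[symmetric] ennreal_leI del: ennreal_plus)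
  qed
  also have "\<dots> = ennreal (2 powr p) * (pint p f + pint p g)"
    by (simp add: nn_integral_cmult nn_integral_add pint_def)
  finally show ?thesis .
qed

lemma pint_scaleR:
  assumes [measurable]: "f \<in> borel_measurable borel"
  shows "pint p (\<lambda>x. c *\<^sub>R f x) = ennreal (\<bar>c\<bar> powr p) * pint p f"
  unfolding pint_def by (subst nn_integral_cmult[symmetric]) (auto simp: powr_mult ennreal_mult)

lemma pint_translate:
  assumes [measurable]: "f \<in> borel_measurable borel"
  shows "pint p (\<lambda>x. f (x - c)) = pint p f"
  unfolding pint_def by (rule nn_integral_translate) simp

lemma pint_bounded_support:
  fixes f :: "'a::euclidean_space \<Rightarrow> 'b::real_normed_vector"
  assumes "\<And>x. norm (f x) \<le> B" "\<And>x. norm x > R \<Longrightarrow> f x = 0" and p: "0 < p"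
  shows "pint p f < \<infinity>"
proof -
  have "pint p f \<le> (\<integral>\<^sup>+(x::'a). ennreal (B powr p) * indicator (cball 0 R) x \<partial>lborel)"
    unfolding pint_def
  proof (rule nn_integral_mono)
    fix x :: 'a show "ennreal (norm (f x) powr p) \<le> ennreal (B powr p) * indicator (cball 0 R) x"
      using assms(1)[of x] assms(2)[of x] p by (cases "norm x \<le> R") (auto intro!: ennreal_leI powr_mono2)
  qed
  also have "\<dots> = ennreal (B powr p) * emeasure lborel (cball (0::'a) R)" by (rule nn_integral_cmult_indicator) simp
  also have "\<dots> < \<infinity>" using emeasure_lborel_cball_finite[of "0::'a" R] by (simp add: ennreal_mult_less_top)
  finally show ?thesis .
qed

text \<open>Hoelder's inequality with a constant that is not optimal; it follows from Young's inequality
  applied to \<open>f\<close> divided by its norm.\<close>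

lemma Hoelder_bound:
  fixes f g :: "'x \<Rightarrow> real"
  assumes p: "1 < p" and q: "q = p / (p - 1)"
    and [measurable]: "f \<in> borel_measurable M" "g \<in> borel_measurable M"
    and f: "(\<integral>\<^sup>+x. ennreal (\<bar>f x\<bar> powr p) \<partial>M) \<le> ennreal A" and A: "0 \<le> A"
    and g: "(\<integral>\<^sup>+x. ennreal (\<bar>g x\<bar> powr q) \<partial>M) \<le> ennreal B" and B: "0 \<le> B"
  shows "integrable M (\<lambda>x. f x * g x)"
    and "(LINT x|M. \<bar>f x * g x\<bar>) \<le> A powr (1 / p) * (1 + B)"
proof -
  have ifp: "integrable M (\<lambda>x. \<bar>f x\<bar> powr p)" using f by (intro integrableI_nonneg) (auto intro: le_less_trans)
  have ig: "integrable M (\<lambda>x. \<bar>g x\<bar> powr q)" using g by (intro integrableI_nonneg) (auto intro: le_less_trans)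
  have fA: "(LINT x|M. \<bar>f x\<bar> powr p) \<le> A" using f A by (subst (asm) nn_integral_eq_integral[OF ifp]) auto
  have gB: "(LINT x|M. \<bar>g x\<bar> powr q) \<le> B" using g B by (subst (asm) nn_integral_eq_integral[OF ig]) auto
  have Y: "\<bar>f x * g x\<bar> \<le> \<bar>f x\<bar> powr p + \<bar>g x\<bar> powr q" for x
    unfolding abs_mult using p q by (intro Young_sum) auto
  show i: "integrable M (\<lambda>x. f x * g x)"
    by (rule Bochner_Integration.integrable_bound[where f="\<lambda>x. \<bar>f x\<bar> powr p + \<bar>g x\<bar> powr q"])
       (use ifp ig Y in \<open>auto intro!: AE_I2\<close>)
  show "(LINT x|M. \<bar>f x * g x\<bar>) \<le> A powr (1 / p) * (1 + B)"
  proof (cases "A = 0")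
    case True
    have "(\<integral>\<^sup>+x. ennreal (\<bar>f x\<bar> powr p) \<partial>M) = 0" using f True by simp
    then have "AE x in M. ennreal (\<bar>f x\<bar> powr p) = 0" by (subst (asm) nn_integral_0_iff_AE) auto
    then have "AE x in M. \<bar>f x * g x\<bar> = 0" by eventually_elim (auto simp: ennreal_eq_0_iff)
    then have "(LINT x|M. \<bar>f x * g x\<bar>) = (LINT x|M. 0)" by (intro integral_cong_AE) auto
    then show ?thesis using True by simp
  next
    case False
    with A have A: "0 < A" by simp
    define N where "N = A powr (1 / p)"
    have N: "0 < N" "N powr - p * A = 1" using A p by (auto simp: N_def powr_powr powr_minus)
    have Y': "\<bar>f x * g x\<bar> \<le> N * (N powr - p * \<bar>f x\<bar> powr p + \<bar>g x\<bar> powr q)" for x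
    proof -
      have "(\<bar>f x\<bar> / N) * \<bar>g x\<bar> \<le> (\<bar>f x\<bar> / N) powr p + \<bar>g x\<bar> powr q"
        using N p q by (intro Young_sum) auto
      moreover have "(\<bar>f x\<bar> / N) powr p = N powr - p * \<bar>f x\<bar> powr p"
        using N(1) by (simp add: powr_divide powr_minus field_simps)
      ultimately have "\<bar>f x\<bar> / N * \<bar>g x\<bar> \<le> N powr - p * \<bar>f x\<bar> powr p + \<bar>g x\<bar> powr q"
        by simp
      then show ?thesis using N by (simp add: abs_mult pos_divide_le_eq mult.commute)
    qed
    have "(LINT x|M. \<bar>f x * g x\<bar>) \<le> (LINT x|M. N * (N powr - p * \<bar>f x\<bar> powr p + \<bar>g x\<bar> powr q))"
      using i ifp ig Y' by (intro integral_mono) auto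
    also have "\<dots> = N * (N powr - p * (LINT x|M. \<bar>f x\<bar> powr p) + (LINT x|M. \<bar>g x\<bar> powr q))"
      using ifp ig by simp
    also have "\<dots> \<le> N * (N powr - p * A + B)"
      using N fA gB by (intro mult_left_mono add_mono) auto
    finally show ?thesis using N by (simp add: N_def)
  qed
qed

section \<open>Averaging translates against the heat kernel\<close>

text \<open>Averages over the times \<open>M\<close> of the heat flow of \<open>g\<close>, and of the gradient of the heat flow of \<open>u\<close> with
  the derivative placed on the kernel.\<close>

definition heat_avg :: "real measure \<Rightarrow> ('a::euclidean_space \<Rightarrow> 'b::{banach, second_countable_topology}) \<Rightarrow> 'a \<Rightarrow> 'b" where
  "heat_avg M g x = (LINT y|(M \<Otimes>\<^sub>M lborel). heat (fst y) (snd y) *\<^sub>R g (x - snd y))"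

definition dheat_avg :: "real measure \<Rightarrow> ('a::euclidean_space \<Rightarrow> real) \<Rightarrow> 'a \<Rightarrow> 'a" where
  "dheat_avg M u x = (LINT y|(M \<Otimes>\<^sub>M lborel). u (x - snd y) *\<^sub>R dheat (fst y) (snd y))"

context time_measure
begin

sublocale pair: pair_sigma_finite M "lborel :: 'a::euclidean_space measure"
  by unfold_locales

lemma sigma_finite_prod: "sigma_finite_measure (M \<Otimes>\<^sub>M (lborel :: 'a::euclidean_space measure))"
proof -
  interpret pair_sigma_finite M "lborel :: 'a measure" ..
  show ?thesis by unfold_locales
qed

lemma AE_pair_pos: "AE y in (M \<Otimes>\<^sub>M (lborel :: 'a::euclidean_space measure)). 0 < fst y"
proof (rule pair.AE_pair_measure)
  show "AE r in M. AE z in (lborel :: 'a measure). 0 < fst (r, z)"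
    using AE_pos by eventually_elim simp
qed measurable

lemma nn_integral_heat_pair:
  "(\<integral>\<^sup>+y. ennreal (heat (fst y) (snd y :: 'a::euclidean_space)) \<partial>(M \<Otimes>\<^sub>M lborel)) = (\<integral>\<^sup>+r. 1 \<partial>M)"
proof -
  have "(\<integral>\<^sup>+y. ennreal (heat (fst y) (snd y :: 'a)) \<partial>(M \<Otimes>\<^sub>M lborel)) =
      (\<integral>\<^sup>+r. \<integral>\<^sup>+z. ennreal (heat r (z :: 'a)) \<partial>lborel \<partial>M)"
    by (subst lborel.nn_integral_fst[symmetric]) auto
  also have "\<dots> = (\<integral>\<^sup>+r. 1 \<partial>M)"
    using AE_pos by (intro nn_integral_cong_AE) (auto elim!: eventually_mono simp: nn_integral_heat)
  finally show ?thesis .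
qed

lemma nn_integral_heat2_pair:
  assumes [measurable]: "w \<in> borel_measurable borel" and w: "\<And>r. 0 \<le> w r"
  shows "(\<integral>\<^sup>+y. ennreal (w (fst y) * heat (2 * fst y) (snd y :: 'a::euclidean_space)) \<partial>(M \<Otimes>\<^sub>M lborel)) =
    (\<integral>\<^sup>+r. ennreal (w r) \<partial>M)"
proof -
  have "(\<integral>\<^sup>+y. ennreal (w (fst y) * heat (2 * fst y) (snd y :: 'a)) \<partial>(M \<Otimes>\<^sub>M lborel)) =
      (\<integral>\<^sup>+r. \<integral>\<^sup>+z. ennreal (w r * heat (2 * r) (z :: 'a)) \<partial>lborel \<partial>M)"
    by (subst lborel.nn_integral_fst[symmetric]) auto
  also have "\<dots> = (\<integral>\<^sup>+r. ennreal (w r) \<partial>M)"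
  proof (rule nn_integral_cong_AE, use AE_pos in eventually_elim)
    case (elim r)
    have "(\<integral>\<^sup>+z. ennreal (w r * heat (2 * r) (z :: 'a)) \<partial>lborel) =
        ennreal (w r) * (\<integral>\<^sup>+z. ennreal (heat (2 * r) (z :: 'a)) \<partial>lborel)"
      using w by (subst nn_integral_cmult[symmetric]) (auto simp: ennreal_mult)
    then show ?case using elim by (simp add: nn_integral_heat)
  qed
  finally show ?thesis .
qed

text \<open>A superposition of translates of \<open>g\<close> is controlled in \<open>L\<^sup>p\<close> by the total mass \<open>C\<close> of the weights,
  by Minkowski's integral inequality and the translation invariance of the norm.\<close>

lemma kernel_bound:
  fixes F :: "'a::euclidean_space \<Rightarrow> real \<times> 'a \<Rightarrow> 'c::{banach, second_countable_topology}"
    and g :: "'a \<Rightarrow> 'b::{banach, second_countable_topology}"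
  assumes p: "1 < p"
    and F [measurable]: "(\<lambda>(x, y). F x y) \<in> borel_measurable (lborel \<Otimes>\<^sub>M (M \<Otimes>\<^sub>M lborel))"
    and [measurable]: "k \<in> borel_measurable (M \<Otimes>\<^sub>M lborel)" and k: "\<And>y. 0 \<le> k y"
    and [measurable]: "g \<in> borel_measurable borel"
    and Fk: "AE y in (M \<Otimes>\<^sub>M lborel). \<forall>x. norm (F x y) \<le> k y * norm (g (x - snd y))"
    and C: "(\<integral>\<^sup>+y. ennreal (k y) \<partial>(M \<Otimes>\<^sub>M lborel)) \<le> ennreal C" "0 < C" and g: "pint p g < \<infinity>"
  shows "AE x in lborel. integrable (M \<Otimes>\<^sub>M lborel) (F x)"
    and "pint p (\<lambda>x. LINT y|(M \<Otimes>\<^sub>M lborel). F x y) \<le> ennreal (C powr p) * pint p g"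
proof -
  let ?T = "M \<Otimes>\<^sub>M (lborel :: 'a measure)"
  let ?f = "\<lambda>x y. k y * norm (g (x - snd y))"
  have b: "(\<integral>\<^sup>+x. ennreal (?f x y powr p) \<partial>lborel) \<le> ennreal (k y powr p) * pint p g" for y :: "real \<times> 'a"
  proof -
    have "(\<integral>\<^sup>+x. ennreal (?f x y powr p) \<partial>lborel) = (\<integral>\<^sup>+x. ennreal (k y powr p) * ennreal (norm (g (x - snd y)) powr p) \<partial>lborel)"
      using k by (simp add: powr_mult ennreal_mult)
    also have "\<dots> = ennreal (k y powr p) * pint p (\<lambda>x. g (x - snd y))"
      unfolding pint_def by (rule nn_integral_cmult) simp
    also have "\<dots> = ennreal (k y powr p) * pint p g" by (simp add: pint_translate)
    finally show ?thesis by simp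
  qed
  have m: "(\<lambda>(x, y). ?f x y) \<in> borel_measurable (lborel \<Otimes>\<^sub>M ?T)" by measurable
  note Mink = Minkowski_weighted[OF p lborel.sigma_finite_measure_axioms sigma_finite_prod m
      _ _ k _ C g b]
  have int: "AE x in lborel. integrable ?T (?f x)"
    by (rule Mink(1)) (use k in auto)
  have mF: "F x \<in> borel_measurable ?T" for x
    using measurable_compose[OF measurable_Pair1' F, of x] by simp
  have iF: "integrable ?T (F x)" "norm (LINT y|?T. F x y) \<le> (LINT y|?T. ?f x y)" if "integrable ?T (?f x)" for x
  proof -
    show i: "integrable ?T (F x)"
      by (rule Bochner_Integration.integrable_bound[OF that mF]) (use Fk k in \<open>auto elim!: eventually_mono\<close>)
    have "norm (LINT y|?T. F x y) \<le> (LINT y|?T. norm (F x y))" by (rule integral_norm_bound)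
    also have "\<dots> \<le> (LINT y|?T. ?f x y)"
      using that i Fk by (intro integral_mono_AE) (auto elim!: eventually_mono)
    finally show "norm (LINT y|?T. F x y) \<le> (LINT y|?T. ?f x y)" .
  qed
  show "AE x in lborel. integrable ?T (F x)" using int by eventually_elim (rule iF)
  have "pint p (\<lambda>x. LINT y|?T. F x y) \<le> (\<integral>\<^sup>+x. ennreal ((LINT y|?T. ?f x y) powr p) \<partial>lborel)"
    unfolding pint_def
  proof (rule nn_integral_mono_AE, use int in eventually_elim)
    case (elim x)
    then show ?case using p iF(2)[OF elim] by (intro ennreal_leI powr_mono2) auto
  qed
  also have "\<dots> \<le> ennreal (C powr p) * pint p g"
    by (rule Mink(2)) (use k in auto)
  finally show "pint p (\<lambda>x. LINT y|?T. F x y) \<le> ennreal (C powr p) * pint p g" .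
qed

lemma measurable_heat_avg_integrand [measurable]:
  fixes g :: "'a::euclidean_space \<Rightarrow> 'b::{banach, second_countable_topology}"
  assumes [measurable]: "g \<in> borel_measurable borel"
  shows "(\<lambda>(x, y). heat (fst y) (snd y) *\<^sub>R g (x - snd y)) \<in> borel_measurable (lborel \<Otimes>\<^sub>M (M \<Otimes>\<^sub>M lborel))"
  by measurable

lemma measurable_dheat_avg_integrand [measurable]:
  fixes u :: "'a::euclidean_space \<Rightarrow> real"
  assumes [measurable]: "u \<in> borel_measurable borel"
  shows "(\<lambda>(x, y). u (x - snd y) *\<^sub>R dheat (fst y) (snd y)) \<in> borel_measurable (lborel \<Otimes>\<^sub>M (M \<Otimes>\<^sub>M lborel))"
  by measurable

lemma borel_heat_avg [measurable (raw)]: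
  assumes [measurable]: "g \<in> borel_measurable borel"
  shows "heat_avg M g \<in> borel_measurable borel"
proof -
  have "(\<lambda>x. LINT y|(M \<Otimes>\<^sub>M lborel). heat (fst y) (snd y) *\<^sub>R g (x - snd y)) \<in> borel_measurable lborel"
    by (rule sigma_finite_measure.borel_measurable_lebesgue_integral[OF sigma_finite_prod]) measurable
  then show ?thesis by (simp add: heat_avg_def[abs_def])
qed

lemma borel_dheat_avg [measurable (raw)]:
  assumes [measurable]: "u \<in> borel_measurable borel"
  shows "dheat_avg M u \<in> borel_measurable borel"
proof -
  have "(\<lambda>x. LINT y|(M \<Otimes>\<^sub>M lborel). u (x - snd y) *\<^sub>R dheat (fst y) (snd y)) \<in> borel_measurable lborel"
    by (rule sigma_finite_measure.borel_measurable_lebesgue_integral[OF sigma_finite_prod]) measurable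
  then show ?thesis by (simp add: dheat_avg_def[abs_def])
qed

lemma heat_avg_bound:
  fixes g :: "'a::euclidean_space \<Rightarrow> 'b::{banach, second_countable_topology}"
  assumes p: "1 < p" and g [measurable]: "g \<in> borel_measurable borel" and gp: "pint p g < \<infinity>"
    and C: "(\<integral>\<^sup>+r. 1 \<partial>M) \<le> ennreal C" "0 < C"
  shows "AE x in lborel. integrable (M \<Otimes>\<^sub>M lborel) (\<lambda>y. heat (fst y) (snd y) *\<^sub>R g (x - snd y))"
    and "pint p (heat_avg M g) \<le> ennreal (C powr p) * pint p g"
proof -
  note K = kernel_bound[OF p measurable_heat_avg_integrand[OF g], of "\<lambda>y. heat (fst y) (snd y)", OF _ _ g _ _ C(2) gp]
  show "AE x in lborel. integrable (M \<Otimes>\<^sub>M lborel) (\<lambda>y. heat (fst y) (snd y) *\<^sub>R g (x - snd y))"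
    by (rule K) (use C in \<open>auto simp: nn_integral_heat_pair\<close>)
  show "pint p (heat_avg M g) \<le> ennreal (C powr p) * pint p g"
    unfolding heat_avg_def[abs_def] by (rule K) (use C in \<open>auto simp: nn_integral_heat_pair\<close>)
qed

lemma dheat_avg_bound:
  fixes u :: "'a::euclidean_space \<Rightarrow> real"
  assumes p: "1 < p" and u [measurable]: "u \<in> borel_measurable borel" and up: "pint p u < \<infinity>"
    and C: "(\<integral>\<^sup>+r. ennreal (r powr - (1 / 2)) \<partial>M) \<le> ennreal C" "0 < C"
  shows "AE x in lborel. integrable (M \<Otimes>\<^sub>M lborel) (\<lambda>y. u (x - snd y) *\<^sub>R dheat (fst y) (snd y))"
    and "pint p (dheat_avg M u) \<le> ennreal ((heat_mom TYPE('a) * C) powr p) * pint p u"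
proof -
  let ?h = "heat_mom TYPE('a)"
  let ?k = "\<lambda>y::real \<times> 'a. ?h * fst y powr - (1 / 2) * heat (2 * fst y) (snd y)"
  have hC: "0 < ?h * C" using C heat_mom_pos[where 'a='a] by simp
  have k0: "\<And>y. 0 \<le> ?k y" using heat_mom_pos[where 'a='a] by (simp add: less_imp_le)
  have kC: "(\<integral>\<^sup>+y. ennreal (?k y) \<partial>(M \<Otimes>\<^sub>M lborel)) \<le> ennreal (?h * C)"
  proof -
    have "(\<integral>\<^sup>+y. ennreal (?k y) \<partial>(M \<Otimes>\<^sub>M lborel)) = (\<integral>\<^sup>+r. ennreal (?h * r powr - (1 / 2)) \<partial>M)"
      using heat_mom_pos[where 'a='a] by (intro nn_integral_heat2_pair) (auto simp: less_imp_le)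
    also have "\<dots> = ennreal ?h * (\<integral>\<^sup>+r. ennreal (r powr - (1 / 2)) \<partial>M)"
      using heat_mom_pos[where 'a='a] by (subst nn_integral_cmult[symmetric]) (auto simp: ennreal_mult less_imp_le)
    also have "\<dots> \<le> ennreal ?h * ennreal C" by (intro mult_left_mono C) auto
    finally show ?thesis using C heat_mom_pos[where 'a='a] by (simp add: ennreal_mult)
  qed
  have dom: "AE y in (M \<Otimes>\<^sub>M lborel). \<forall>x. norm (u (x - snd y) *\<^sub>R dheat (fst y) (snd y))
      \<le> ?k y * norm (u (x - snd y))"
    using AE_pair_pos
  proof eventually_elim
    case (elim y)
    show ?case
    proof
      fix x
      show "norm (u (x - snd y) *\<^sub>R dheat (fst y) (snd y)) \<le> ?k y * norm (u (x - snd y))"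
        using mult_right_mono[OF norm_dheat_le[OF elim, of "snd y"], of "norm (u (x - snd y))"] by (simp add: mult.commute)
    qed
  qed
  note K = kernel_bound[OF p measurable_dheat_avg_integrand[OF u], of ?k, OF _ k0 u dom kC hC up]
  show "AE x in lborel. integrable (M \<Otimes>\<^sub>M lborel) (\<lambda>y. u (x - snd y) *\<^sub>R dheat (fst y) (snd y))"
    by (rule K) measurable
  show "pint p (dheat_avg M u) \<le> ennreal ((?h * C) powr p) * pint p u"
    unfolding dheat_avg_def[abs_def] by (rule K) measurable
qed

end

section \<open>The heat flow of the gradient of a test function\<close>

text \<open>\<open>heat_grad \<phi> r\<close> is the heat flow of the gradient at time \<open>r\<close>, and \<open>flow_grad b \<phi>\<close> turns out to be the
  gradient of order \<open>1 - 2 * b\<close>. The case \<open>b = 0\<close> is separate because the heat kernel at time 0 is not a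
  function.\<close>

definition heat_grad :: "('a::euclidean_space \<Rightarrow> real) \<Rightarrow> real \<Rightarrow> 'a \<Rightarrow> 'a" where
  "heat_grad \<phi> r x = (LINT z|lborel. heat r z *\<^sub>R grad \<phi> (x - z))"

definition flow_grad :: "real \<Rightarrow> ('a::euclidean_space \<Rightarrow> real) \<Rightarrow> 'a \<Rightarrow> 'a" where
  "flow_grad b \<phi> x = (if b = 0 then grad \<phi> x else (LINT r|nu b. heat_grad \<phi> r x))"

lemma Cc_infty_grad_borel: "\<phi> \<in> Cc_infty \<Omega> \<Longrightarrow> grad \<phi> \<in> borel_measurable borel"
  using Cc_infty_borel[OF Cc_infty_grad] .

lemma integrable_heat_bounded:
  fixes f :: "'a::euclidean_space \<Rightarrow> 'b::{banach, second_countable_topology}"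
  assumes r: "0 < r" and [measurable]: "f \<in> borel_measurable borel" and B: "\<And>x. norm (f x) \<le> B"
  shows "integrable lborel (\<lambda>z. heat r z *\<^sub>R f (x - z))" "norm (LINT z|lborel. heat r z *\<^sub>R f (x - z)) \<le> B"
proof -
  show i: "integrable lborel (\<lambda>z. heat r z *\<^sub>R f (x - z))"
    by (rule Bochner_Integration.integrable_bound[where f="\<lambda>z. B * heat r z"])
       (use r B order_trans[OF norm_ge_zero B[of 0]] in
         \<open>auto intro!: integrable_heat AE_I2 simp: abs_mult mult.commute[of B] mult_left_mono\<close>)
  have "norm (LINT z|lborel. heat r z *\<^sub>R f (x - z)) \<le> (LINT z|lborel. norm (heat r z *\<^sub>R f (x - z)))"
    by (rule integral_norm_bound)
  also have "\<dots> \<le> (LINT z|lborel. heat r (z::'a) * B)"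
  proof (rule integral_mono)
    show "integrable lborel (\<lambda>z. norm (heat r z *\<^sub>R f (x - z)))" using i by (rule integrable_norm)
    show "integrable lborel (\<lambda>z::'a. heat r z * B)" by (intro integrable_mult_left integrable_heat r)
  qed (use B in \<open>auto intro!: mult_left_mono\<close>)
  also have "\<dots> = B" using r by (simp add: integral_heat)
  finally show "norm (LINT z|lborel. heat r z *\<^sub>R f (x - z)) \<le> B" .
qed

locale test_function =
  fixes \<phi> :: "'a::euclidean_space \<Rightarrow> real"
  assumes test: "\<phi> \<in> Cc_infty UNIV"
begin

lemma borel_phi [measurable]: "\<phi> \<in> borel_measurable borel"
  using test by (rule Cc_infty_borel)

lemma borel_grad [measurable]: "grad \<phi> \<in> borel_measurable borel"
  using test by (rule Cc_infty_grad_borel)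

lemma grad_bound: obtains B where "0 < B" "\<And>x. norm (grad \<phi> x) \<le> B"
  using Cc_infty_bounded[OF Cc_infty_grad[OF test]] by metis

lemma phi_bound: obtains B where "0 < B" "\<And>x. \<bar>\<phi> x\<bar> \<le> B"
  using Cc_infty_bounded[OF test] by (metis real_norm_def)

lemma heat_grad_integrable: "0 < r \<Longrightarrow> integrable lborel (\<lambda>z. heat r z *\<^sub>R grad \<phi> (x - z))"
  by (rule grad_bound, rule integrable_heat_bounded) auto

lemma measurable_heat_grad [measurable (raw)]:
  assumes [measurable]: "f \<in> borel_measurable M" "g \<in> borel_measurable M"
  shows "(\<lambda>x. heat_grad \<phi> (f x) (g x)) \<in> borel_measurable M"
proof -
  have "(\<lambda>p. LINT z|lborel. heat (fst p) z *\<^sub>R grad \<phi> (snd p - z)) \<in> borel_measurable (borel \<Otimes>\<^sub>M borel)"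
    by (rule lborel.borel_measurable_lebesgue_integral) measurable
  from measurable_compose[OF _ this, of "\<lambda>x. (f x, g x)" M] show ?thesis
    by (simp add: heat_grad_def)
qed

lemma dheat_integrable:
  assumes r: "0 < r" and that: "\<And>x. \<bar>\<phi> x\<bar> \<le> A"
  shows "integrable lborel (\<lambda>z. \<phi> (x - z) *\<^sub>R dheat r z)"
    and "norm (LINT z|lborel. \<phi> (x - z) *\<^sub>R dheat r z) \<le> A * heat_mom TYPE('a) * r powr - (1 / 2)"
proof -
  let ?h = "heat_mom TYPE('a) * r powr - (1 / 2)"
  have n: "norm (\<phi> (x - z) *\<^sub>R dheat r z) \<le> A * ?h * heat (2 * r) z" for z
  proof -
    have "norm (\<phi> (x - z) *\<^sub>R dheat r z) = \<bar>\<phi> (x - z)\<bar> * norm (dheat r z)" by simp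
    also have "\<dots> \<le> A * (?h * heat (2 * r) z)"
      using that[of "x - z"] r by (intro mult_mono norm_dheat_le) (auto intro: order_trans[OF abs_ge_zero])
    finally show ?thesis by (simp add: mult.assoc)
  qed
  show i: "integrable lborel (\<lambda>z. \<phi> (x - z) *\<^sub>R dheat r z)"
  proof (rule Bochner_Integration.integrable_bound[where f="\<lambda>z::'a. A * ?h * heat (2 * r) z"], goal_cases)
    case 1 show ?case using r by (intro integrable_mult_right integrable_heat) auto
  next
    case 3 show ?case by (intro AE_I2 order_trans[OF n]) (simp only: real_norm_def abs_ge_self)
  qed measurable
  have "norm (LINT z|lborel. \<phi> (x - z) *\<^sub>R dheat r z) \<le>
      (LINT z|lborel. norm (\<phi> (x - z) *\<^sub>R dheat r z))"
    by (rule integral_norm_bound)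
  also have "\<dots> \<le> (LINT z|lborel. A * ?h * heat (2 * r) (z::'a))"
  proof (rule integral_mono)
    show "integrable lborel (\<lambda>z. norm (\<phi> (x - z) *\<^sub>R dheat r z))" using i by (rule integrable_norm)
    show "integrable lborel (\<lambda>z::'a. A * ?h * heat (2 * r) z)"
      using r by (intro integrable_mult_right integrable_heat) auto
  qed (rule n)
  also have "\<dots> = A * ?h" using r by (simp add: integral_heat)
  finally show "norm (LINT z|lborel. \<phi> (x - z) *\<^sub>R dheat r z) \<le> A * heat_mom TYPE('a) * r powr - (1 / 2)"
    by (simp add: mult.assoc)
qed

text \<open>Moving the derivative from \<open>\<phi>\<close> to the kernel gains the decay in \<open>r\<close>.\<close>

lemma heat_grad_by_parts:
  assumes r: "0 < r"
  shows "heat_grad \<phi> r x = (LINT z|lborel. \<phi> (x - z) *\<^sub>R dheat r z)"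
proof (rule euclidean_eqI)
  fix b :: 'a assume "b \<in> Basis"
  let ?K = "(4 * pi * r) powr - (real DIM('a) / 2)" and ?K2 = "(4 * pi * (2 * r)) powr - (real DIM('a) / 2)"
  obtain A where A: "\<And>x. \<bar>\<phi> x\<bar> \<le> A" using phi_bound by metis
  have "heat_grad \<phi> r x \<bullet> b = (LINT z|lborel. heat r z *\<^sub>R grad \<phi> (x - z) \<bullet> b)"
    unfolding heat_grad_def by (rule integral_inner_left[symmetric]) (rule heat_grad_integrable[OF r])
  also have "\<dots> = (LINT z|lborel. (\<lambda>z. heat r z * (b \<bullet> grad \<phi> (x - z))) z)"
    by (simp add: inner_commute)
  also have "\<dots> = (LINT y|lborel. heat r (x - y) * (b \<bullet> grad \<phi> y))"
    by (subst integral_reflect[symmetric, of _ x]) simp_all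
  also have "\<dots> = - (LINT y|lborel. - (b \<bullet> dheat r (x - y)) * \<phi> y)"
  proof (rule integral_by_parts[OF _ test, where B="?K" and B'="norm b * (heat_mom TYPE('a) * r powr - (1 / 2) * ?K2)"
        and f'="\<lambda>y h. - (h \<bullet> dheat r (x - y))"])
    fix y
    have 1: "((\<lambda>y. x - y) has_derivative (\<lambda>h. - h)) (at y)" by (auto intro!: derivative_eq_intros)
    show "((\<lambda>y. heat r (x - y)) has_derivative (\<lambda>h. - (h \<bullet> dheat r (x - y)))) (at y)"
      using has_derivative_compose[OF 1 heat_has_derivative[OF r]] by simp
    show "\<bar>heat r (x - y)\<bar> \<le> ?K" using heat_le[OF r, of "x - y"] by simp
    have "\<bar>- (b \<bullet> dheat r (x - y))\<bar> \<le> norm b * norm (dheat r (x - y))" by (simp add: Cauchy_Schwarz_ineq2)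
    also have "\<dots> \<le> norm b * (heat_mom TYPE('a) * r powr - (1 / 2) * heat (2 * r) (x - y))"
      using r by (intro mult_left_mono norm_dheat_le) auto
    also have "\<dots> \<le> norm b * (heat_mom TYPE('a) * r powr - (1 / 2) * ?K2)"
      using r heat_mom_pos[where 'a='a] by (intro mult_left_mono heat_le) (auto intro: less_imp_le)
    finally show "\<bar>- (b \<bullet> dheat r (x - y))\<bar> \<le> norm b * (heat_mom TYPE('a) * r powr - (1 / 2) * ?K2)" .
  qed measurable
  also have "\<dots> = (LINT y|lborel. (\<lambda>z. \<phi> (x - z) * (b \<bullet> dheat r z)) (x - y))" by (simp add: mult.commute)
  also have "\<dots> = (LINT z|lborel. \<phi> (x - z) * (b \<bullet> dheat r z))" by (rule integral_reflect) measurable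
  also have "\<dots> = (LINT z|lborel. \<phi> (x - z) *\<^sub>R dheat r z \<bullet> b)" by (simp add: inner_commute)
  also have "\<dots> = (LINT z|lborel. \<phi> (x - z) *\<^sub>R dheat r z) \<bullet> b"
    by (rule integral_inner_left) (rule dheat_integrable(1)[OF r A])
  finally show "heat_grad \<phi> r x \<bullet> b = (LINT z|lborel. \<phi> (x - z) *\<^sub>R dheat r z) \<bullet> b" .
qed

text \<open>Up to time 1 the gradient of \<open>\<phi>\<close> gives a constant bound, later the gradient of the kernel gives
  \<open>r powr - (1 / 2)\<close>; together they are integrable exactly because \<open>0 < b < 1 / 2\<close>.\<close>

lemma heat_grad_bound:
  assumes b: "0 < b" "b < 1 / 2"
  obtains h where "integrable (nu b) h" "\<And>r. 0 \<le> h r" "\<And>r x. 0 < r \<Longrightarrow> norm (heat_grad \<phi> r x) \<le> h r"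
proof -
  obtain B where B: "0 < B" "\<And>x. norm (grad \<phi> x) \<le> B" using grad_bound by metis
  obtain A where A: "0 < A" "\<And>x. \<bar>\<phi> x\<bar> \<le> A" using phi_bound by metis
  define A' where "A' = A * heat_mom TYPE('a)"
  have A': "0 < A'" using A heat_mom_pos[where 'a='a] by (simp add: A'_def)
  define h where "h r = B * (indicator {..1} r * r powr 0) + A' * (indicator {1<..} r * r powr - (1 / 2))" for r :: real
  have i1: "integrable (nu b) (\<lambda>r. indicator {..1} r * r powr 0)"
    using nn_integral_nu_low[of b 0] b by (intro integrableI_nonneg) auto
  have i2: "integrable (nu b) (\<lambda>r. indicator {1<..} r * r powr - (1 / 2))"
    using nn_integral_nu_high[of b "1 / 2"] b by (intro integrableI_nonneg) auto
  show ?thesis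
  proof
    show "integrable (nu b) h" unfolding h_def using i1 i2 by (intro Bochner_Integration.integrable_add integrable_mult_right)
    show "0 \<le> h r" for r using A' B by (simp add: h_def)
    fix r x assume r: "0 < (r::real)"
    show "norm (heat_grad \<phi> r x) \<le> h r"
    proof (cases "r \<le> 1")
      case True
      have "norm (heat_grad \<phi> r x) \<le> B"
        unfolding heat_grad_def by (rule integrable_heat_bounded(2)[OF r borel_grad B(2)])
      then show ?thesis using True r by (simp add: h_def)
    next
      case False
      then show ?thesis using heat_grad_by_parts[OF r, of x] dheat_integrable(2)[OF r A(2), of x]
        by (simp add: h_def A'_def)
    qed
  qed
qed

lemma heat_grad_nu_integrable:
  assumes b: "0 < b" "b < 1 / 2"
  shows "integrable (nu b) (\<lambda>r. heat_grad \<phi> r x)"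
proof -
  obtain h where h: "integrable (nu b) h" "\<And>r. 0 \<le> h r" "\<And>r x. 0 < r \<Longrightarrow> norm (heat_grad \<phi> r x) \<le> h r"
    using heat_grad_bound[OF b] by metis
  show ?thesis
    by (rule Bochner_Integration.integrable_bound[OF h(1)])
       (use AE_nu_pos[OF b(1)] h in \<open>auto elim!: eventually_mono\<close>)
qed

lemma flow_grad_bounded:
  assumes b: "0 \<le> b" "b < 1 / 2"
  obtains B where "0 < B" "\<And>x. norm (flow_grad b \<phi> x) \<le> B"
proof (cases "b = 0")
  case True
  then show ?thesis using grad_bound that by (auto simp: flow_grad_def)
next
  case False
  with b have b0: "0 < b" by simp
  obtain h where h: "integrable (nu b) h" "\<And>r. 0 \<le> h r" "\<And>r x. 0 < r \<Longrightarrow> norm (heat_grad \<phi> r x) \<le> h r"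
    using heat_grad_bound[OF b0 b(2)] by metis
  have "norm (flow_grad b \<phi> x) \<le> (LINT r|nu b. h r)" for x
  proof -
    have "norm (LINT r|nu b. heat_grad \<phi> r x) \<le> (LINT r|nu b. norm (heat_grad \<phi> r x))"
      by (rule integral_norm_bound)
    also have "\<dots> \<le> (LINT r|nu b. h r)"
      using heat_grad_nu_integrable[OF b0 b(2)] h AE_nu_pos[OF b0]
      by (intro integral_mono_AE) (auto elim!: eventually_mono)
    finally show ?thesis using False by (simp add: flow_grad_def)
  qed
  moreover have "0 \<le> (LINT r|nu b. h r)" using h by simp
  ultimately show ?thesis using that[of "(LINT r|nu b. h r) + 1"] by (smt (verit))
qed

lemma borel_flow_grad [measurable]: "flow_grad b \<phi> \<in> borel_measurable borel"
proof (cases "b = 0")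
  case True then show ?thesis by (simp add: flow_grad_def[abs_def])
next
  case False
  have "(\<lambda>x. LINT r|nu b. heat_grad \<phi> r x) \<in> borel_measurable borel"
    by (rule nu.borel_measurable_lebesgue_integral) measurable
  then show ?thesis using False by (simp add: flow_grad_def[abs_def])
qed

lemma heat_semigroup_grad:
  assumes t: "0 < t" "0 < \<tau>"
  shows "(LINT z|lborel. heat t z *\<^sub>R heat_grad \<phi> \<tau> (x - z)) = heat_grad \<phi> (t + \<tau>) x"
proof -
  obtain B where B: "0 < B" "\<And>x. norm (grad \<phi> x) \<le> B" using grad_bound by metis
  let ?F = "\<lambda>z w. (heat t z * heat \<tau> (w - z)) *\<^sub>R grad \<phi> (x - w)"
  have int: "integrable (lborel \<Otimes>\<^sub>M lborel) (\<lambda>(z, w). ?F z w)"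
  proof (rule Bochner_Integration.integrable_bound)
    show "integrable (lborel \<Otimes>\<^sub>M lborel) (\<lambda>y::'a \<times> 'a. B * (heat t (fst y) * heat \<tau> (snd y - fst y)))"
    proof (intro integrable_mult_right integrableI_nonneg)
      have "(\<integral>\<^sup>+y. ennreal (heat t (fst y) * heat \<tau> (snd y - fst y :: 'a)) \<partial>(lborel \<Otimes>\<^sub>M lborel)) =
          (\<integral>\<^sup>+w. \<integral>\<^sup>+z. ennreal (heat t z * heat \<tau> (w - z :: 'a)) \<partial>lborel \<partial>lborel)"
        by (subst lborel_pair.nn_integral_snd[symmetric]) auto
      also have "\<dots> = 1" using t by (simp add: nn_integral_heat_conv nn_integral_heat)
      finally show "(\<integral>\<^sup>+y. ennreal (heat t (fst y) * heat \<tau> (snd y - fst y :: 'a)) \<partial>(lborel \<Otimes>\<^sub>M lborel)) < \<infinity>" by simp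
    qed auto
    show "AE y in (lborel \<Otimes>\<^sub>M lborel). norm (case y of (z, w) \<Rightarrow> ?F z w) \<le> norm (B * (heat t (fst y) * heat \<tau> (snd y - fst y)))"
      using B by (auto intro!: AE_I2 simp: abs_mult mult.commute[of B] mult_left_mono split_beta)
  qed measurable
  have "(LINT z|lborel. heat t z *\<^sub>R heat_grad \<phi> \<tau> (x - z)) = (LINT z|lborel. LINT w|lborel. ?F z w)"
  proof (rule Bochner_Integration.integral_cong[OF refl])
    fix z
    have "heat_grad \<phi> \<tau> (x - z) = (LINT w|lborel. (\<lambda>y. heat \<tau> y *\<^sub>R grad \<phi> (x - z - y)) (w - z))"
      unfolding heat_grad_def by (rule integral_translate[symmetric]) measurable
    then show "heat t z *\<^sub>R heat_grad \<phi> \<tau> (x - z) = (LINT w|lborel. ?F z w)"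
      by (simp add: algebra_simps flip: scaleR_scaleR)
  qed
  also have "\<dots> = (LINT w|lborel. LINT z|lborel. ?F z w)"
    by (rule lborel_pair.Fubini_integral[symmetric]) (rule int)
  also have "\<dots> = (LINT w|lborel. heat (t + \<tau>) w *\<^sub>R grad \<phi> (x - w))"
  proof (rule Bochner_Integration.integral_cong[OF refl])
    fix w :: 'a
    have nn: "(\<integral>\<^sup>+z. ennreal (heat t z * heat \<tau> (w - z)) \<partial>lborel) = ennreal (heat (t + \<tau>) w)"
      by (rule nn_integral_heat_conv[OF t])
    then have i: "integrable lborel (\<lambda>z. heat t z * heat \<tau> (w - z))" by (intro integrableI_nonneg) auto
    then have "(LINT z|lborel. heat t z * heat \<tau> (w - z)) = heat (t + \<tau>) w"
      using nn by (subst (asm) nn_integral_eq_integral) auto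
    then show "(LINT z|lborel. ?F z w) = heat (t + \<tau>) w *\<^sub>R grad \<phi> (x - w)"
      using i by simp
  qed
  finally show ?thesis by (simp add: heat_grad_def)
qed

text \<open>The semigroup laws of the heat flow: running the flow for the time \<open>t\<close> shifts all times of the mixture
  by \<open>t\<close>.\<close>

lemma heat_flow_grad:
  assumes t: "0 < t" and b: "0 \<le> b" "b < 1 / 2"
  shows "(LINT z|lborel. heat t z *\<^sub>R flow_grad b \<phi> (x - z)) = (LINT \<tau>|nu b. heat_grad \<phi> (t + \<tau>) x)"
proof (cases "b = 0")
  case True
  have "(LINT \<tau>|nu 0. heat_grad \<phi> (t + \<tau>) x) = heat_grad \<phi> t x"
    unfolding nu_def by (simp add: integral_return)
  then show ?thesis using True by (simp add: flow_grad_def heat_grad_def)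
next
  case False
  with b have b0: "0 < b" by simp
  obtain h where h: "integrable (nu b) h" "\<And>r. 0 \<le> h r" "\<And>r x. 0 < r \<Longrightarrow> norm (heat_grad \<phi> r x) \<le> h r"
    using heat_grad_bound[OF b0 b(2)] by metis
  interpret P: pair_sigma_finite "nu b" "lborel :: 'a measure" ..
  have [measurable]: "h \<in> borel_measurable borel" using h(1) by auto
  have pos: "AE y in (nu b \<Otimes>\<^sub>M (lborel :: 'a measure)). 0 < fst y"
    by (rule time_measure.AE_pair_pos[OF time_measure_nu[OF b0]])
  have int: "integrable (nu b \<Otimes>\<^sub>M lborel) (\<lambda>(\<tau>, z). heat t z *\<^sub>R heat_grad \<phi> \<tau> (x - z))"
  proof (rule Bochner_Integration.integrable_bound)
    show "integrable (nu b \<Otimes>\<^sub>M lborel) (\<lambda>(\<tau>, z::'a). h \<tau> * heat t z)"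
      using h(1) integrable_heat[OF t, where 'a='a] h(2)
      by (intro P.Fubini_integrable) (auto simp: split_beta)
    show "AE y in (nu b \<Otimes>\<^sub>M lborel). norm (case y of (\<tau>, z) \<Rightarrow> heat t z *\<^sub>R heat_grad \<phi> \<tau> (x - z))
        \<le> norm (case y of (\<tau>, z) \<Rightarrow> h \<tau> * heat t z)"
      using pos by eventually_elim (use h in \<open>auto simp: abs_mult mult.commute[of "h _"] split_beta intro!: mult_left_mono\<close>)
  qed measurable
  have "(LINT z|lborel. heat t z *\<^sub>R flow_grad b \<phi> (x - z)) = (LINT z|lborel. LINT \<tau>|nu b. heat t z *\<^sub>R heat_grad \<phi> \<tau> (x - z))"
    using False by (simp add: flow_grad_def)
  also have "\<dots> = (LINT \<tau>|nu b. LINT z|lborel. heat t z *\<^sub>R heat_grad \<phi> \<tau> (x - z))"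
    by (rule P.Fubini_integral[OF int])
  also have "\<dots> = (LINT \<tau>|nu b. heat_grad \<phi> (t + \<tau>) x)"
    using AE_nu_pos[OF b0] t
  proof (intro integral_cong_AE)
    show "(\<lambda>\<tau>. LINT z|lborel. heat t z *\<^sub>R heat_grad \<phi> \<tau> (x - z)) \<in> borel_measurable (nu b)"
      by (rule lborel.borel_measurable_lebesgue_integral) measurable
  qed (auto elim!: eventually_mono simp: heat_semigroup_grad)
  finally show ?thesis .
qed

text \<open>The step from order \<open>1 - 2 b\<close> to the lower order \<open>1 - 2 (a + b)\<close>. Times up to 1 leave the
  higher-order gradient in place, and for times beyond 1 all derivatives are moved to the heat
  kernel.\<close>

lemma flow_grad_decomposition:
  assumes a: "0 < a" and b: "0 \<le> b" and ab: "a + b < 1 / 2"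
  shows "flow_grad (a + b) \<phi> x = heat_avg (early a) (flow_grad b \<phi>) x + dheat_avg (late a b) \<phi> x"
proof -
  have b2: "b < 1 / 2" "0 < a + b" using a b ab by auto
  interpret L: time_measure "early a" by (rule time_measure_early[OF a])
  interpret H: time_measure "late a b" by (rule time_measure_late[OF a b ab])
  obtain B where B: "0 < B" "\<And>x. norm (flow_grad b \<phi> x) \<le> B" using flow_grad_bounded[OF b b2(1)] by metis
  obtain A where A: "0 < A" "\<And>x. \<bar>\<phi> x\<bar> \<le> A" using phi_bound by metis
  have P: "integrable (nu (a + b)) (\<lambda>r. heat_grad \<phi> r x)"
    by (rule heat_grad_nu_integrable[OF b2(2) ab])
  have iL: "integrable (early a \<Otimes>\<^sub>M lborel) (\<lambda>y. heat (fst y) (snd y) *\<^sub>R flow_grad b \<phi> (x - snd y))"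
  proof (rule Bochner_Integration.integrable_bound)
    show "integrable (early a \<Otimes>\<^sub>M lborel) (\<lambda>y. B * heat (fst y) (snd y :: 'a))"
      by (intro integrable_mult_right integrableI_nonneg)
         (auto simp: L.nn_integral_heat_pair early_mass[OF a, simplified])
    show "AE y in (early a \<Otimes>\<^sub>M lborel). norm (heat (fst y) (snd y) *\<^sub>R flow_grad b \<phi> (x - snd y)) \<le> norm (B * heat (fst y) (snd y))"
      using B by (auto intro!: AE_I2 simp: abs_mult mult.commute[of B] mult_left_mono)
  qed measurable
  have iH: "integrable (late a b \<Otimes>\<^sub>M lborel) (\<lambda>y. \<phi> (x - snd y) *\<^sub>R dheat (fst y) (snd y))"
  proof (rule Bochner_Integration.integrable_bound)
    let ?h = "heat_mom TYPE('a)"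
    show "integrable (late a b \<Otimes>\<^sub>M lborel) (\<lambda>y. (A * ?h) * (fst y powr - (1 / 2) * heat (2 * fst y) (snd y :: 'a)))"
      using late_finite[OF a b ab] H.nn_integral_heat2_pair[of "\<lambda>r. r powr - (1 / 2)", where 'a='a]
      by (intro integrable_mult_right integrableI_nonneg) auto
    show "AE y in (late a b \<Otimes>\<^sub>M lborel). norm (\<phi> (x - snd y) *\<^sub>R dheat (fst y) (snd y))
        \<le> norm ((A * ?h) * (fst y powr - (1 / 2) * heat (2 * fst y) (snd y)))"
      using H.AE_pair_pos
    proof eventually_elim
      case (elim y)
      have "norm (\<phi> (x - snd y) *\<^sub>R dheat (fst y) (snd y)) =
          \<bar>\<phi> (x - snd y)\<bar> * norm (dheat (fst y) (snd y))" by simp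
      also have "\<dots> \<le> A * (?h * fst y powr - (1 / 2) * heat (2 * fst y) (snd y))"
        using A elim by (intro mult_mono norm_dheat_le) auto
      finally show ?case using A heat_mom_pos[where 'a='a] by (simp add: abs_mult mult.assoc)
    qed
  qed measurable
  have "flow_grad (a + b) \<phi> x = (LINT r|nu (a + b). heat_grad \<phi> r x)" using b2 by (simp add: flow_grad_def)
  also have "\<dots> = (LINT t|early a. LINT \<tau>|nu b. heat_grad \<phi> (t + \<tau>) x) + (LINT r|late a b. heat_grad \<phi> r x)"
    by (rule integral_nu_split[OF a b P])
  also have "(LINT t|early a. LINT \<tau>|nu b. heat_grad \<phi> (t + \<tau>) x) = (LINT t|early a. LINT z|lborel. heat t z *\<^sub>R flow_grad b \<phi> (x - z))"
  proof (rule integral_cong_AE)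
    show "(\<lambda>t. LINT \<tau>|nu b. heat_grad \<phi> (t + \<tau>) x) \<in> borel_measurable (early a)"
      by (rule nu.borel_measurable_lebesgue_integral) measurable
    show "(\<lambda>t. LINT z|lborel. heat t z *\<^sub>R flow_grad b \<phi> (x - z)) \<in> borel_measurable (early a)"
      by (rule lborel.borel_measurable_lebesgue_integral) measurable
    show "AE t in early a. (LINT \<tau>|nu b. heat_grad \<phi> (t + \<tau>) x) = (LINT z|lborel. heat t z *\<^sub>R flow_grad b \<phi> (x - z))"
      using L.AE_pos by eventually_elim (simp add: heat_flow_grad[OF _ b b2(1)])
  qed
  also have "\<dots> = heat_avg (early a) (flow_grad b \<phi>) x"
    unfolding heat_avg_def using L.pair.integral_fst'[OF iL] by simp
  also have "(LINT r|late a b. heat_grad \<phi> r x) =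
      (LINT r|late a b. LINT z|lborel. \<phi> (x - z) *\<^sub>R dheat r z)"
  proof (rule integral_cong_AE)
    show "(\<lambda>r. LINT z|lborel. \<phi> (x - z) *\<^sub>R dheat r z) \<in> borel_measurable (late a b)"
      by (rule lborel.borel_measurable_lebesgue_integral) measurable
  qed (use H.AE_pos in \<open>auto elim!: eventually_mono simp: heat_grad_by_parts\<close>)
  also have "\<dots> = dheat_avg (late a b) \<phi> x"
    unfolding dheat_avg_def using H.pair.integral_fst'[OF iH] by simp
  finally show ?thesis .
qed

lemma phi_pint: "0 < p \<Longrightarrow> pint p \<phi> < \<infinity>"
  using Cc_infty_bounded[OF test] pint_bounded_support by metis

lemma grad_pint: "0 < p \<Longrightarrow> pint p (grad \<phi>) < \<infinity>"
  using Cc_infty_bounded[OF Cc_infty_grad[OF test]] pint_bounded_support by metis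

end

lemma late_const:
  assumes "0 < a" "0 \<le> b" "a + b < 1 / 2"
  obtains C where "0 < C" "(\<integral>\<^sup>+r. ennreal (r powr - (1 / 2)) \<partial>late a b) \<le> ennreal C"
proof -
  define I where "I = (\<integral>\<^sup>+r. ennreal (r powr - (1 / 2)) \<partial>late a b)"
  show ?thesis
    using that[of "enn2real I + 1"] late_finite[OF assms] unfolding I_def[symmetric]
    by (cases I) (auto intro!: ennreal_leI)
qed

text \<open>Both terms of the decomposition are superpositions of translates with weights of finite total mass,
  so the constant does not depend on \<open>\<phi>\<close>.\<close>

lemma flow_grad_pint_le:
  fixes \<phi> :: "'a::euclidean_space \<Rightarrow> real"
  assumes p: "1 < p" and a: "0 < a" and b: "0 \<le> b" and ab: "a + b < 1 / 2"
  shows "\<exists>C. \<forall>\<phi>::'a \<Rightarrow> real. \<phi> \<in> Cc_infty UNIV \<longrightarrow> pint p (flow_grad b \<phi>) < \<infinity> \<longrightarrow>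
    pint p (flow_grad (a + b) \<phi>) \<le> ennreal C * (pint p (flow_grad b \<phi>) + pint p \<phi>)"
proof -
  interpret L: time_measure "early a" by (rule time_measure_early[OF a])
  interpret H: time_measure "late a b" by (rule time_measure_late[OF a b ab])
  obtain C where C: "0 < C" "(\<integral>\<^sup>+r. ennreal (r powr - (1 / 2)) \<partial>late a b) \<le> ennreal C"
    using late_const[OF a b ab] by metis
  define D where "D = 1 / Gamma (a + 1)"
  have D: "0 < D" "(\<integral>\<^sup>+r. 1 \<partial>early a) \<le> ennreal D" using a early_mass[OF a] by (simp_all add: D_def)
  define E where "E = max (D powr p) ((heat_mom TYPE('a) * C) powr p)"
  have E: "0 \<le> E" by (simp add: E_def le_max_iff_disj)
  show ?thesis
  proof (intro exI allI impI)
    fix \<phi> :: "'a \<Rightarrow> real" assume "\<phi> \<in> Cc_infty UNIV" and fin: "pint p (flow_grad b \<phi>) < \<infinity>"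
    then interpret test_function \<phi> by unfold_locales
    have 1: "pint p (heat_avg (early a) (flow_grad b \<phi>)) \<le> ennreal E * pint p (flow_grad b \<phi>)"
      by (rule order_trans[OF L.heat_avg_bound(2)[OF p borel_flow_grad fin D(2,1)]])
         (auto intro!: mult_right_mono ennreal_leI simp: E_def)
    have 2: "pint p (dheat_avg (late a b) \<phi>) \<le> ennreal E * pint p \<phi>"
      by (rule order_trans[OF H.dheat_avg_bound(2)[OF p borel_phi phi_pint C(2,1)]])
         (use p in \<open>auto intro!: mult_right_mono ennreal_leI simp: E_def\<close>)
    have "pint p (flow_grad (a + b) \<phi>) = pint p (\<lambda>x. heat_avg (early a) (flow_grad b \<phi>) x + dheat_avg (late a b) \<phi> x)"
      by (rule arg_cong[of _ _ "pint p"], rule ext, rule flow_grad_decomposition[OF a b ab])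
    also have "\<dots> \<le> ennreal (2 powr p) * (pint p (heat_avg (early a) (flow_grad b \<phi>)) + pint p (dheat_avg (late a b) \<phi>))"
      using p by (intro pint_add) auto
    also have "\<dots> \<le> ennreal (2 powr p) * (ennreal E * pint p (flow_grad b \<phi>) + ennreal E * pint p \<phi>)"
      by (intro mult_left_mono add_mono 1 2) auto
    also have "\<dots> = ennreal (2 powr p * E) * (pint p (flow_grad b \<phi>) + pint p \<phi>)"
      using E by (simp add: ennreal_mult distrib_left mult.assoc)
    finally show "pint p (flow_grad (a + b) \<phi>) \<le> ennreal (2 powr p * E) * (pint p (flow_grad b \<phi>) + pint p \<phi>)" .
  qed
qed

lemma flow_grad_pint_finite:
  assumes p: "1 < p" and b: "0 \<le> b" "b < 1 / 2" and \<phi>: "\<phi> \<in> Cc_infty UNIV"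
  shows "pint p (flow_grad b \<phi>) < \<infinity>"
proof (cases "b = 0")
  case True
  have "flow_grad 0 \<phi> = grad \<phi>" by (simp add: flow_grad_def fun_eq_iff)
  then show ?thesis using True p test_function.grad_pint[OF test_function.intro[OF \<phi>], of p] by simp
next
  case False
  interpret test_function \<phi> by unfold_locales (rule \<phi>)
  have g: "flow_grad 0 \<phi> = grad \<phi>" by (simp add: flow_grad_def fun_eq_iff)
  obtain C where "pint p (flow_grad b \<phi>) \<le> ennreal C * (pint p (grad \<phi>) + pint p \<phi>)"
    using flow_grad_pint_le[OF p, of b 0] b False grad_pint[of p] p \<phi> unfolding g[symmetric] by auto
  also have "\<dots> < \<infinity>" using grad_pint[of p] phi_pint[of p] p by (simp add: ennreal_mult_less_top)
  finally show ?thesis .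
qed

section \<open>Algebraic properties and integration by parts\<close>

lemma flow_grad_0: "flow_grad 0 \<phi> = grad \<phi>"
  by (simp add: flow_grad_def fun_eq_iff)

lemma heat_grad_lincomb:
  assumes r: "0 < r" and \<phi>: "\<phi> \<in> Cc_infty UNIV" and \<psi>: "\<psi> \<in> Cc_infty UNIV"
  shows "heat_grad (\<lambda>x. c * \<phi> x + d * \<psi> x) r x = c *\<^sub>R heat_grad \<phi> r x + d *\<^sub>R heat_grad \<psi> r x"
proof -
  have i: "integrable lborel (\<lambda>z. heat r z *\<^sub>R grad \<phi> (x - z))" "integrable lborel (\<lambda>z. heat r z *\<^sub>R grad \<psi> (x - z))"
    using test_function.heat_grad_integrable[OF test_function.intro[OF \<phi>] r]
      test_function.heat_grad_integrable[OF test_function.intro[OF \<psi>] r] by auto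
  have "heat_grad (\<lambda>x. c * \<phi> x + d * \<psi> x) r x =
      (LINT z|lborel. c *\<^sub>R (heat r z *\<^sub>R grad \<phi> (x - z)) + d *\<^sub>R (heat r z *\<^sub>R grad \<psi> (x - z)))"
    unfolding heat_grad_def grad_lincomb[OF \<phi> \<psi>]
    by (intro Bochner_Integration.integral_cong) (auto simp: scaleR_add_right mult.commute)
  also have "\<dots> = (LINT z|lborel. c *\<^sub>R (heat r z *\<^sub>R grad \<phi> (x - z))) + (LINT z|lborel. d *\<^sub>R (heat r z *\<^sub>R grad \<psi> (x - z)))"
    by (intro Bochner_Integration.integral_add integrable_scaleR_right i)
  finally show ?thesis by (simp only: heat_grad_def integral_scaleR_right)
qed

lemma flow_grad_lincomb:
  assumes b: "0 \<le> b" "b < 1 / 2" and \<phi>: "\<phi> \<in> Cc_infty UNIV" and \<psi>: "\<psi> \<in> Cc_infty UNIV"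
  shows "flow_grad b (\<lambda>x. c * \<phi> x + d * \<psi> x) x = c *\<^sub>R flow_grad b \<phi> x + d *\<^sub>R flow_grad b \<psi> x"
proof (cases "b = 0")
  case True then show ?thesis by (simp add: flow_grad_0 grad_lincomb[OF \<phi> \<psi>])
next
  case False
  with b have b0: "0 < b" by simp
  have l: "(\<lambda>x. c * \<phi> x + d * \<psi> x) \<in> Cc_infty UNIV" by (rule Cc_infty_lincomb[OF \<phi> \<psi>])
  interpret p: test_function \<phi> by unfold_locales (rule \<phi>)
  interpret q: test_function \<psi> by unfold_locales (rule \<psi>)
  interpret l: test_function "\<lambda>x. c * \<phi> x + d * \<psi> x" by unfold_locales (rule l)
  have "(LINT r|nu b. heat_grad (\<lambda>x. c * \<phi> x + d * \<psi> x) r x) =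
      (LINT r|nu b. c *\<^sub>R heat_grad \<phi> r x + d *\<^sub>R heat_grad \<psi> r x)"
  proof (rule integral_cong_AE)
    show "AE r in nu b. heat_grad (\<lambda>x. c * \<phi> x + d * \<psi> x) r x = c *\<^sub>R heat_grad \<phi> r x + d *\<^sub>R heat_grad \<psi> r x"
      using AE_nu_pos[OF b0] by eventually_elim (rule heat_grad_lincomb[OF _ \<phi> \<psi>])
  qed measurable
  also have "\<dots> = c *\<^sub>R (LINT r|nu b. heat_grad \<phi> r x) + d *\<^sub>R (LINT r|nu b. heat_grad \<psi> r x)"
    using p.heat_grad_nu_integrable[OF b0 b(2), of x] q.heat_grad_nu_integrable[OF b0 b(2), of x] by simp
  finally show ?thesis using False by (simp add: flow_grad_def)
qed

lemma flow_grad_translate: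
  fixes \<phi> :: "'a::euclidean_space \<Rightarrow> real"
  assumes \<phi>: "\<phi> \<in> Cc_infty UNIV"
  shows "flow_grad b (\<lambda>x. \<phi> (x - c)) x = flow_grad b \<phi> (x - c)"
proof -
  have "heat_grad (\<lambda>x. \<phi> (x - c)) r x = heat_grad \<phi> r (x - c)" for r
    unfolding heat_grad_def grad_translate[OF \<phi>]
    by (intro Bochner_Integration.integral_cong) (auto simp: algebra_simps)
  then show ?thesis by (simp add: flow_grad_def grad_translate[OF \<phi>])
qed

lemma integral_mult_heat_grad:
  assumes r: "0 < r" and \<phi>: "\<phi> \<in> Cc_infty UNIV" and \<psi>: "\<psi> \<in> Cc_infty UNIV"
  shows "(LINT x|lborel. \<psi> x * (v \<bullet> heat_grad \<phi> r x)) =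
    (LINT z|lborel. heat r z * (LINT x|lborel. \<psi> x * (v \<bullet> grad \<phi> (x - z))))"
proof -
  interpret p: test_function \<phi> by unfold_locales (rule \<phi>)
  interpret q: test_function \<psi> by unfold_locales (rule \<psi>)
  obtain B where B: "0 < B" "\<And>x. norm (grad \<phi> x) \<le> B" using p.grad_bound by metis
  let ?F = "\<lambda>z x. heat r z * (\<psi> x * (v \<bullet> grad \<phi> (x - z)))"
  have i\<psi>: "integrable lborel \<psi>" by (rule Cc_infty_integrable[OF \<psi>])
  have int: "integrable (lborel \<Otimes>\<^sub>M lborel) (\<lambda>(z, x). ?F z x)"
  proof (rule Bochner_Integration.integrable_bound)
    show "integrable (lborel \<Otimes>\<^sub>M lborel) (\<lambda>(z::'a, x). heat r z * (\<bar>\<psi> x\<bar> * (norm v * B)))"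
      using i\<psi> integrable_heat[OF r, where 'a='a] B(1)
      by (intro lborel_pair.Fubini_integrable) (auto simp: split_beta abs_mult)
    show "AE y in (lborel \<Otimes>\<^sub>M lborel). norm (case y of (z, x) \<Rightarrow> ?F z x) \<le>
        norm (case y of (z, x) \<Rightarrow> heat r z * (\<bar>\<psi> x\<bar> * (norm v * B)))"
    proof (rule AE_I2)
      fix y :: "'a \<times> 'a"
      obtain z x where y: "y = (z, x)" by (cases y)
      have "\<bar>v \<bullet> grad \<phi> (x - z)\<bar> \<le> norm v * norm (grad \<phi> (x - z))" by (rule Cauchy_Schwarz_ineq2)
      also have "\<dots> \<le> norm v * B" using B by (intro mult_left_mono) auto
      finally have "heat r z * (\<bar>\<psi> x\<bar> * \<bar>v \<bullet> grad \<phi> (x - z)\<bar>) \<le> heat r z * (\<bar>\<psi> x\<bar> * (norm v * B))"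
        by (intro mult_left_mono) auto
      then show "norm (case y of (z, x) \<Rightarrow> ?F z x) \<le> norm (case y of (z, x) \<Rightarrow> heat r z * (\<bar>\<psi> x\<bar> * (norm v * B)))"
        using B(1) y by (simp add: abs_mult)
    qed
  qed measurable
  have "(LINT x|lborel. \<psi> x * (v \<bullet> heat_grad \<phi> r x)) = (LINT x|lborel. LINT z|lborel. ?F z x)"
  proof (rule Bochner_Integration.integral_cong[OF refl])
    fix x
    have "v \<bullet> heat_grad \<phi> r x = (LINT z|lborel. v \<bullet> (heat r z *\<^sub>R grad \<phi> (x - z)))"
      unfolding heat_grad_def by (rule integral_inner_right[symmetric]) (rule p.heat_grad_integrable[OF r])
    then have "\<psi> x * (v \<bullet> heat_grad \<phi> r x) = (LINT z|lborel. \<psi> x * (v \<bullet> (heat r z *\<^sub>R grad \<phi> (x - z))))"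
      by simp
    also have "\<dots> = (LINT z|lborel. ?F z x)"
      by (intro Bochner_Integration.integral_cong) (auto simp: mult_ac)
    finally show "\<psi> x * (v \<bullet> heat_grad \<phi> r x) = (LINT z|lborel. ?F z x)" .
  qed
  also have "\<dots> = (LINT z|lborel. LINT x|lborel. ?F z x)" by (rule lborel_pair.Fubini_integral[OF int])
  finally show ?thesis by simp
qed

text \<open>The heat kernel is even, so the sign change of integration by parts survives the convolution.\<close>

lemma heat_grad_antisymmetric:
  assumes r: "0 < r" and \<phi>: "\<phi> \<in> Cc_infty UNIV" and \<psi>: "\<psi> \<in> Cc_infty UNIV"
  shows "(LINT x|lborel. \<psi> x * (v \<bullet> heat_grad \<phi> r x)) = - (LINT x|lborel. \<phi> x * (v \<bullet> heat_grad \<psi> r x))"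
proof -
  interpret p: test_function \<phi> by unfold_locales (rule \<phi>)
  interpret q: test_function \<psi> by unfold_locales (rule \<psi>)
  have *: "(LINT x|lborel. \<psi> x * (v \<bullet> grad \<phi> (x - z))) = - (LINT x|lborel. \<phi> x * (v \<bullet> grad \<psi> (x - (- z))))" for z
  proof -
    have "(LINT x|lborel. \<psi> x * (v \<bullet> grad \<phi> (x - z))) = - (LINT x|lborel. (v \<bullet> grad \<psi> x) * \<phi> (x - z))"
      using Cc_infty_by_parts[OF \<psi> Cc_infty_translate[OF \<phi>, of z], of v] by (simp add: grad_translate[OF \<phi>])
    also have "(LINT x|lborel. (v \<bullet> grad \<psi> x) * \<phi> (x - z)) = (LINT x|lborel. (\<lambda>x. (v \<bullet> grad \<psi> x) * \<phi> (x - z)) (x - (- z)))"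
      by (rule integral_translate[symmetric]) measurable
    finally show ?thesis by (simp add: mult.commute)
  qed
  have [measurable]: "(\<lambda>z. LINT x|lborel. \<phi> x * (v \<bullet> grad \<psi> (x - z))) \<in> borel_measurable borel"
    by (rule lborel.borel_measurable_lebesgue_integral) measurable
  have "(LINT x|lborel. \<psi> x * (v \<bullet> heat_grad \<phi> r x)) =
      - (LINT z|lborel. (\<lambda>z. heat r z * (LINT x|lborel. \<phi> x * (v \<bullet> grad \<psi> (x - z)))) (0 - z))"
    unfolding integral_mult_heat_grad[OF r \<phi> \<psi>] * by simp
  also have "(LINT z|lborel. (\<lambda>z. heat r z * (LINT x|lborel. \<phi> x * (v \<bullet> grad \<psi> (x - z)))) (0 - z)) =
      (LINT z|lborel. heat r z * (LINT x|lborel. \<phi> x * (v \<bullet> grad \<psi> (x - z))))"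
    by (rule integral_reflect) measurable
  finally show ?thesis unfolding integral_mult_heat_grad[OF r \<psi> \<phi>] .
qed

lemma integral_mult_flow_grad:
  assumes b: "0 < b" "b < 1 / 2" and \<phi>: "\<phi> \<in> Cc_infty UNIV" and \<psi>: "\<psi> \<in> Cc_infty UNIV"
  shows "(LINT x|lborel. \<psi> x * (v \<bullet> flow_grad b \<phi> x)) = (LINT r|nu b. LINT x|lborel. \<psi> x * (v \<bullet> heat_grad \<phi> r x))"
proof -
  interpret p: test_function \<phi> by unfold_locales (rule \<phi>)
  interpret q: test_function \<psi> by unfold_locales (rule \<psi>)
  interpret P: pair_sigma_finite "nu b" "lborel :: 'a measure" ..
  obtain h where h: "integrable (nu b) h" "\<And>r. 0 \<le> h r" "\<And>r x. 0 < r \<Longrightarrow> norm (heat_grad \<phi> r x) \<le> h r"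
    using p.heat_grad_bound[OF b] by metis
  have [measurable]: "h \<in> borel_measurable borel" using h(1) by auto
  have i\<psi>: "integrable lborel \<psi>" by (rule Cc_infty_integrable[OF \<psi>])
  let ?F = "\<lambda>r x. \<psi> x * (v \<bullet> heat_grad \<phi> r x)"
  have int: "integrable (nu b \<Otimes>\<^sub>M lborel) (\<lambda>(r, x). ?F r x)"
  proof (rule Bochner_Integration.integrable_bound)
    show "integrable (nu b \<Otimes>\<^sub>M lborel) (\<lambda>(r, x). h r * (norm v * \<bar>\<psi> x\<bar>))"
      using i\<psi> h(1,2) by (intro P.Fubini_integrable) (auto simp: split_beta abs_mult)
    show "AE y in (nu b \<Otimes>\<^sub>M lborel). norm (case y of (r, x) \<Rightarrow> ?F r x) \<le> norm (case y of (r, x) \<Rightarrow> h r * (norm v * \<bar>\<psi> x\<bar>))"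
      using time_measure.AE_pair_pos[OF time_measure_nu[OF b(1)], where 'a='a]
    proof eventually_elim
      case (elim y)
      obtain r x where y: "y = (r, x)" by (cases y)
      have "\<bar>v \<bullet> heat_grad \<phi> r x\<bar> \<le> norm v * norm (heat_grad \<phi> r x)" by (rule Cauchy_Schwarz_ineq2)
      also have "\<dots> \<le> norm v * h r" using h(3)[of r x] elim y by (intro mult_left_mono) auto
      finally have "\<bar>\<psi> x\<bar> * \<bar>v \<bullet> heat_grad \<phi> r x\<bar> \<le> \<bar>\<psi> x\<bar> * (norm v * h r)"
        by (intro mult_left_mono) auto
      then show ?case using h(2)[of r] y by (simp add: abs_mult mult_ac)
    qed
  qed measurable
  have "(LINT x|lborel. \<psi> x * (v \<bullet> flow_grad b \<phi> x)) = (LINT x|lborel. LINT r|nu b. ?F r x)"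
  proof (rule Bochner_Integration.integral_cong[OF refl])
    fix x
    have "v \<bullet> flow_grad b \<phi> x = (LINT r|nu b. v \<bullet> heat_grad \<phi> r x)"
      using b p.heat_grad_nu_integrable[OF b, of x] by (simp add: flow_grad_def)
    then show "\<psi> x * (v \<bullet> flow_grad b \<phi> x) = (LINT r|nu b. ?F r x)" by simp
  qed
  also have "\<dots> = (LINT r|nu b. LINT x|lborel. ?F r x)" by (rule P.Fubini_integral[OF int])
  finally show ?thesis .
qed

text \<open>This identity is the reason why the pointwise fractional gradient of a test function is also its weak
  fractional gradient.\<close>

lemma flow_grad_antisymmetric:
  assumes b: "0 \<le> b" "b < 1 / 2" and \<phi>: "\<phi> \<in> Cc_infty UNIV" and \<psi>: "\<psi> \<in> Cc_infty UNIV"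
  shows "(LINT x|lborel. \<psi> x * (v \<bullet> flow_grad b \<phi> x)) = - (LINT x|lborel. \<phi> x * (v \<bullet> flow_grad b \<psi> x))"
proof (cases "b = 0")
  case True
  then show ?thesis using Cc_infty_by_parts[OF \<psi> \<phi>, of v] by (simp add: flow_grad_0 mult.commute)
next
  case False
  with b have b0: "0 < b" by simp
  interpret p: test_function \<phi> by unfold_locales (rule \<phi>)
  interpret q: test_function \<psi> by unfold_locales (rule \<psi>)
  have "(LINT r|nu b. LINT x|lborel. \<psi> x * (v \<bullet> heat_grad \<phi> r x)) =
      (LINT r|nu b. - (LINT x|lborel. \<phi> x * (v \<bullet> heat_grad \<psi> r x)))"
  proof (rule integral_cong_AE)
    show "(\<lambda>r. LINT x|lborel. \<psi> x * (v \<bullet> heat_grad \<phi> r x)) \<in> borel_measurable (nu b)"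
      by (rule lborel.borel_measurable_lebesgue_integral) measurable
    have "(\<lambda>r. LINT x|lborel. \<phi> x * (v \<bullet> heat_grad \<psi> r x)) \<in> borel_measurable (nu b)"
      by (rule lborel.borel_measurable_lebesgue_integral) measurable
    then show "(\<lambda>r. - (LINT x|lborel. \<phi> x * (v \<bullet> heat_grad \<psi> r x))) \<in> borel_measurable (nu b)" by simp
  qed (use AE_nu_pos[OF b0] in \<open>auto elim!: eventually_mono intro: heat_grad_antisymmetric[OF _ \<phi> \<psi>]\<close>)
  then show ?thesis
    unfolding integral_mult_flow_grad[OF b0 b(2) \<phi> \<psi>] integral_mult_flow_grad[OF b0 b(2) \<psi> \<phi>] by simp
qed

section \<open>Heat averages over short times\<close>

lemma Cc_infty_translation_pint:
  fixes \<psi> :: "'a::euclidean_space \<Rightarrow> 'b::euclidean_space"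
  assumes p: "0 < p" and \<psi>: "\<psi> \<in> Cc_infty UNIV"
  shows "\<exists>C\<ge>0. \<forall>z. pint p (\<lambda>x. \<psi> (x - z) - \<psi> x) \<le> ennreal (C * norm z powr p)"
proof -
  obtain L where L: "0 < L" "\<And>x y. norm (\<psi> x - \<psi> y) \<le> L * norm (x - y)" using Cc_infty_Lipschitz[OF \<psi>] by metis
  obtain R where R: "0 < R" "\<And>x. norm x > R \<Longrightarrow> \<psi> x = 0" using Cc_infty_bounded[OF \<psi>] by metis
  define V where "V = measure lborel (cball (0::'a) R)"
  have V: "emeasure lborel (cball (0::'a) R) = ennreal V" "0 \<le> V"
    using emeasure_lborel_cball_finite[of "0::'a" R] by (simp_all add: V_def emeasure_eq_ennreal_measure)
  have "pint p (\<lambda>x. \<psi> (x - z) - \<psi> x) \<le> ennreal (L powr p * (2 * V) * norm z powr p)" for z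
  proof -
    let ?c = "ennreal ((L * norm z) powr p)" and ?i = "\<lambda>x::'a. indicator (cball 0 R) x :: ennreal"
    have "pint p (\<lambda>x. \<psi> (x - z) - \<psi> x) \<le> (\<integral>\<^sup>+x. ?c * (?i (x - z) + ?i x) \<partial>lborel)"
      unfolding pint_def
    proof (rule nn_integral_mono)
      fix x :: 'a
      show "ennreal (norm (\<psi> (x - z) - \<psi> x) powr p) \<le> ?c * (?i (x - z) + ?i x)"
      proof (cases "norm x \<le> R \<or> norm (x - z) \<le> R")
        case True
        have "norm (\<psi> (x - z) - \<psi> x) \<le> L * norm z" using L(2)[of "x - z" x] by simp
        then have "ennreal (norm (\<psi> (x - z) - \<psi> x) powr p) \<le> ?c * 1"
          using p by (auto intro!: ennreal_leI powr_mono2)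
        also have "\<dots> \<le> ?c * (?i (x - z) + ?i x)"
          using True by (intro mult_left_mono) (auto simp: indicator_def)
        finally show ?thesis .
      next
        case False then show ?thesis using R(2)[of x] R(2)[of "x - z"] p by simp
      qed
    qed
    also have "\<dots> = ?c * ((\<integral>\<^sup>+x. ?i (x - z) \<partial>lborel) + (\<integral>\<^sup>+x. ?i x \<partial>lborel))"
    proof -
      define J :: "'a \<Rightarrow> ennreal" where "J = indicator (cball 0 R)"
      have [measurable]: "J \<in> borel_measurable borel" by (simp add: J_def borel_measurable_indicator)
      have "(\<integral>\<^sup>+x. ?c * (J (x - z) + J x) \<partial>lborel) = ?c * ((\<integral>\<^sup>+x. J (x - z) \<partial>lborel) + (\<integral>\<^sup>+x. J x \<partial>lborel))"
        by (simp add: nn_integral_cmult nn_integral_add)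
      then show ?thesis by (simp only: J_def)
    qed
    also have "(\<integral>\<^sup>+x. ?i (x - z) \<partial>lborel) = (\<integral>\<^sup>+x. ?i x \<partial>lborel)" by (rule nn_integral_translate, rule borel_measurable_indicator, simp)
    also have "(\<integral>\<^sup>+x. ?i x \<partial>lborel) = ennreal V" using V by simp
    also have "?c * (ennreal V + ennreal V) = ennreal (L powr p * (2 * V) * norm z powr p)"
      using V L by (simp add: ennreal_plus[symmetric] ennreal_mult[symmetric] powr_mult mult_ac del: ennreal_plus)
    finally show ?thesis .
  qed
  then show ?thesis using V(2) by (intro exI[of _ "L powr p * (2 * V)"]) auto
qed

text \<open>The increment of \<open>flow_grad b \<phi>\<close> is the gradient of the increment of \<open>\<phi>\<close>, to which the bound by
  the classical gradient applies. Both the increment of \<open>\<phi>\<close> and that of its gradient are Lipschitz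
  with support in two balls.\<close>

lemma flow_grad_translation_pint:
  fixes \<phi> :: "'a::euclidean_space \<Rightarrow> real"
  assumes p: "1 < p" and b: "0 \<le> b" "b < 1 / 2" and \<phi>: "\<phi> \<in> Cc_infty UNIV"
  shows "\<exists>C\<ge>0. \<forall>z. pint p (\<lambda>x. flow_grad b \<phi> (x - z) - flow_grad b \<phi> x) \<le> ennreal (C * norm z powr p)"
proof -
  have p0: "0 < p" using p by simp
  obtain C1 where C1: "0 \<le> C1" "\<And>z. pint p (\<lambda>x. grad \<phi> (x - z) - grad \<phi> x) \<le> ennreal (C1 * norm z powr p)"
    using Cc_infty_translation_pint[OF p0 Cc_infty_grad[OF \<phi>]] by metis
  show ?thesis
  proof (cases "b = 0")
    case True then show ?thesis using C1 by (auto simp: flow_grad_0)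
  next
    case False
    with b have b0: "0 < b" by simp
    obtain C2 where C2: "0 \<le> C2" "\<And>z. pint p (\<lambda>x. \<phi> (x - z) - \<phi> x) \<le> ennreal (C2 * norm z powr p)"
      using Cc_infty_translation_pint[OF p0 \<phi>] by metis
    obtain C where C: "\<And>\<phi>::'a \<Rightarrow> real. \<phi> \<in> Cc_infty UNIV \<Longrightarrow> pint p (flow_grad 0 \<phi>) < \<infinity> \<Longrightarrow>
        pint p (flow_grad (b + 0) \<phi>) \<le> ennreal C * (pint p (flow_grad 0 \<phi>) + pint p \<phi>)"
      using flow_grad_pint_le[OF p b0, of 0, where 'a='a] b by (metis add.right_neutral order.refl)
    define D where "D = max 0 C"
    have D: "0 \<le> D" "C \<le> D" by (auto simp: D_def)
    have "pint p (\<lambda>x. flow_grad b \<phi> (x - z) - flow_grad b \<phi> x) \<le> ennreal (D * (C1 + C2) * norm z powr p)" for z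
    proof -
      let ?\<eta> = "\<lambda>x. 1 * \<phi> (x - z) + (- 1) * \<phi> x"
      have t: "(\<lambda>x. \<phi> (x - z)) \<in> Cc_infty UNIV" by (rule Cc_infty_translate[OF \<phi>])
      have \<eta>: "?\<eta> \<in> Cc_infty UNIV" by (rule Cc_infty_lincomb[OF t \<phi>])
      have "flow_grad c ?\<eta> x = flow_grad c \<phi> (x - z) - flow_grad c \<phi> x" if "0 \<le> c" "c < 1 / 2" for c x
        unfolding flow_grad_lincomb[OF that t \<phi>] flow_grad_translate[OF \<phi>] by simp
      note f = this[OF b] this[of 0, simplified]
      have "pint p (\<lambda>x. flow_grad b \<phi> (x - z) - flow_grad b \<phi> x) = pint p (flow_grad (b + 0) ?\<eta>)"
        by (simp only: f[symmetric] add.right_neutral)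
      also have "\<dots> \<le> ennreal C * (pint p (flow_grad 0 ?\<eta>) + pint p ?\<eta>)"
        by (rule C[OF \<eta> flow_grad_pint_finite[OF p _ _ \<eta>]]) auto
      also have "\<dots> \<le> ennreal D * (ennreal (C1 * norm z powr p) + ennreal (C2 * norm z powr p))"
      proof (intro mult_mono add_mono)
        have "flow_grad 0 ?\<eta> = (\<lambda>x. grad \<phi> (x - z) - grad \<phi> x)"
          using flow_grad_lincomb[OF _ _ t \<phi>, of 0 1 "-1"] by (simp add: fun_eq_iff flow_grad_0 grad_translate[OF \<phi>])
        then show "pint p (flow_grad 0 ?\<eta>) \<le> ennreal (C1 * norm z powr p)" using C1(2)[of z] by simp
        show "pint p ?\<eta> \<le> ennreal (C2 * norm z powr p)" using C2(2)[of z] by simp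
      qed (use D in \<open>auto intro: ennreal_leI\<close>)
      also have "\<dots> = ennreal (D * (C1 + C2) * norm z powr p)"
        using C1(1) C2(1) D by (simp add: ennreal_plus[symmetric] ennreal_mult[symmetric] algebra_simps del: ennreal_plus)
      finally show ?thesis .
    qed
    then show ?thesis using C1(1) C2(1) D by (intro exI[of _ "D * (C1 + C2)"]) auto
  qed
qed

text \<open>The average of a translate over the short-time heat flow differs from the identity by a total
  mass that tends to 1 and by a mean displacement that tends to 0.\<close>

lemma heat_avg_early_minus_id:
  fixes g :: "'a::euclidean_space \<Rightarrow> 'b::{banach, second_countable_topology}"
  assumes p: "1 < p" and a: "0 < a" and g [measurable]: "g \<in> borel_measurable borel" and gp: "pint p g < \<infinity>"
    and C: "0 \<le> C" "\<And>z. pint p (\<lambda>x. g (x - z) - g x) \<le> ennreal (C * norm z powr p)"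
  shows "pint p (\<lambda>x. heat_avg (early a) g x - g x) \<le> ennreal (2 powr p) *
     (ennreal ((2 * heat_mom TYPE('a) / (Gamma a * (a + 1 / 2))) powr p * C) +
      ennreal (\<bar>1 / Gamma (a + 1) - 1\<bar> powr p) * pint p g)"
proof -
  interpret L: time_measure "early a" by (rule time_measure_early[OF a])
  let ?T = "early a \<Otimes>\<^sub>M (lborel :: 'a measure)"
  let ?h = "heat_mom TYPE('a)"
  define m where "m = 1 / Gamma (a + 1)"
  define K where "K = 2 * ?h / (Gamma a * (a + 1 / 2))"
  have m: "0 < m" "(\<integral>\<^sup>+t. 1 \<partial>early a) = ennreal m" using a early_mass[OF a] by (auto simp: m_def)
  have K: "0 < K" using a heat_mom_pos[where 'a='a] by (simp add: K_def)
  have hT: "(\<integral>\<^sup>+y. ennreal (heat (fst y) (snd y)) \<partial>?T) = ennreal m"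
    using L.nn_integral_heat_pair[where 'a='a] m by simp
  have ih: "integrable ?T (\<lambda>y. heat (fst y) (snd y))" by (rule integrableI_nonneg) (auto simp: hT)
  have hI: "(LINT y|?T. heat (fst y) (snd y)) = m"
    using hT m by (subst (asm) nn_integral_eq_integral[OF ih]) auto
  let ?f = "\<lambda>x y. heat (fst y) (snd y) * norm (g (x - snd y) - g x)"
  let ?c = "\<lambda>y::real \<times> 'a. heat (fst y) (snd y) * norm (snd y)"
  have mf: "(\<lambda>(x, y). ?f x y) \<in> borel_measurable (lborel \<Otimes>\<^sub>M ?T)" by measurable
  have mc: "?c \<in> borel_measurable ?T" by measurable
  have cK: "(\<integral>\<^sup>+y. ennreal (?c y) \<partial>?T) \<le> ennreal K"
  proof -
    have "(\<integral>\<^sup>+y. ennreal (?c y) \<partial>?T) \<le> (\<integral>\<^sup>+y. ennreal ((2 * ?h * \<bar>sqrt (fst y)\<bar>) * heat (2 * fst y) (snd y)) \<partial>?T)"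
    proof (rule nn_integral_mono_AE, use L.AE_pair_pos[where 'a='a] in eventually_elim)
      case (elim y)
      then show ?case using norm_mult_heat_le[OF elim, of "snd y"] by (intro ennreal_leI) (simp add: mult_ac)
    qed
    also have "\<dots> = (\<integral>\<^sup>+r. ennreal (2 * ?h * \<bar>sqrt r\<bar>) \<partial>early a)"
      using heat_mom_pos[where 'a='a] by (intro L.nn_integral_heat2_pair) auto
    also have "\<dots> = (\<integral>\<^sup>+r. ennreal (2 * ?h) * ennreal (sqrt r) \<partial>early a)"
      using heat_mom_pos[where 'a='a] L.AE_pos
      by (intro nn_integral_cong_AE) (auto elim!: eventually_mono simp: ennreal_mult)
    also have "\<dots> = ennreal (2 * ?h) * ennreal (1 / (Gamma a * (a + 1 / 2)))"
      by (subst nn_integral_cmult) (auto simp: early_sqrt[OF a])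
    also have "\<dots> = ennreal K" using heat_mom_pos[where 'a='a] a by (simp add: K_def ennreal_mult[symmetric])
    finally show ?thesis .
  qed
  have b: "(\<integral>\<^sup>+x. ennreal (?f x y powr p) \<partial>lborel) \<le> ennreal (?c y powr p) * ennreal C" for y
  proof -
    have "(\<integral>\<^sup>+x. ennreal (?f x y powr p) \<partial>lborel) =
        (\<integral>\<^sup>+x. ennreal (heat (fst y) (snd y) powr p) * ennreal (norm (g (x - snd y) - g x) powr p) \<partial>lborel)"
      by (simp add: powr_mult ennreal_mult)
    also have "\<dots> = ennreal (heat (fst y) (snd y) powr p) * pint p (\<lambda>x. g (x - snd y) - g x)"
      unfolding pint_def by (rule nn_integral_cmult) measurable
    also have "\<dots> \<le> ennreal (heat (fst y) (snd y) powr p) * ennreal (C * norm (snd y) powr p)"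
      by (intro mult_left_mono C) auto
    also have "\<dots> = ennreal (?c y powr p) * ennreal C"
      using C(1) by (simp add: powr_mult ennreal_mult[symmetric] mult_ac)
    finally show ?thesis .
  qed
  have cf: "?c y = 0 \<Longrightarrow> ?f x y = 0" for x y by auto
  note Mink = Minkowski_weighted[OF p lborel.sigma_finite_measure_axioms L.sigma_finite_prod mf mc
      _ _ cf cK K _ b]
  have int: "AE x in lborel. integrable ?T (?f x)" by (rule Mink(1)) auto
  have le: "(\<integral>\<^sup>+x. ennreal ((LINT y|?T. ?f x y) powr p) \<partial>lborel) \<le> ennreal (K powr p) * ennreal C"
    by (rule Mink(2)) auto
  have int2: "AE x in lborel. integrable ?T (\<lambda>y. heat (fst y) (snd y) *\<^sub>R g (x - snd y))"
    by (rule L.heat_avg_bound(1)[OF p g gp _ m(1)]) (rule eq_refl, rule m(2))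
  have 1: "pint p (\<lambda>x. heat_avg (early a) g x - m *\<^sub>R g x) \<le> ennreal (K powr p * C)"
  proof -
    have "pint p (\<lambda>x. heat_avg (early a) g x - m *\<^sub>R g x) \<le> (\<integral>\<^sup>+x. ennreal ((LINT y|?T. ?f x y) powr p) \<partial>lborel)"
      unfolding pint_def
    proof (rule nn_integral_mono_AE, use int int2 in eventually_elim)
      case (elim x)
      have "heat_avg (early a) g x - m *\<^sub>R g x =
          (LINT y|?T. heat (fst y) (snd y) *\<^sub>R g (x - snd y)) - (LINT y|?T. heat (fst y) (snd y) *\<^sub>R g x)"
        using ih by (simp add: heat_avg_def hI)
      also have "\<dots> = (LINT y|?T. heat (fst y) (snd y) *\<^sub>R (g (x - snd y) - g x))"
        unfolding scaleR_diff_right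
        by (rule Bochner_Integration.integral_diff[symmetric, OF elim(2)]) (use ih in simp)
      finally have "norm (heat_avg (early a) g x - m *\<^sub>R g x) \<le> (LINT y|?T. norm (heat (fst y) (snd y) *\<^sub>R (g (x - snd y) - g x)))"
        by (simp only: integral_norm_bound)
      also have "\<dots> = (LINT y|?T. ?f x y)" by simp
      finally show ?case using p by (intro ennreal_leI powr_mono2) auto
    qed
    also have "\<dots> \<le> ennreal (K powr p) * ennreal C" by (rule le)
    finally show ?thesis using C by (simp add: ennreal_mult)
  qed
  have "pint p (\<lambda>x. heat_avg (early a) g x - g x) = pint p (\<lambda>x. (heat_avg (early a) g x - m *\<^sub>R g x) + (m - 1) *\<^sub>R g x)"
    by (simp add: algebra_simps)
  also have "\<dots> \<le> ennreal (2 powr p) * (pint p (\<lambda>x. heat_avg (early a) g x - m *\<^sub>R g x) + pint p (\<lambda>x. (m - 1) *\<^sub>R g x))"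
    using p by (intro pint_add) auto
  also have "\<dots> \<le> ennreal (2 powr p) * (ennreal (K powr p * C) + ennreal (\<bar>m - 1\<bar> powr p) * pint p g)"
    using 1 by (intro mult_left_mono add_mono) (auto simp: pint_scaleR)
  finally show ?thesis unfolding m_def K_def .
qed

lemma inverse_Gamma_tendsto: "((\<lambda>a::real. 1 / Gamma a) \<longlongrightarrow> 0) (at_right 0)"
  and inverse_Gamma1_tendsto: "((\<lambda>a::real. 1 / Gamma (a + 1)) \<longlongrightarrow> 1) (at_right 0)"
proof -
  have c: "isCont (rGamma :: real \<Rightarrow> real) x" for x
  proof -
    have "continuous_on UNIV (rGamma :: real \<Rightarrow> real)" by (rule continuous_on_rGamma)
    then show ?thesis by (simp add: continuous_on_eq_continuous_at)
  qed
  have e: "1 / Gamma x = rGamma x" for x :: real by (simp add: Gamma_def divide_inverse)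
  have "((rGamma :: real \<Rightarrow> real) \<longlongrightarrow> rGamma 0) (at_right 0)"
    using c[of 0] by (simp add: isCont_def filterlim_at_split)
  then show "((\<lambda>a::real. 1 / Gamma a) \<longlongrightarrow> 0) (at_right 0)" by (simp add: e)
  have "((\<lambda>a::real. rGamma (a + 1)) \<longlongrightarrow> rGamma (0 + 1)) (at_right 0)"
    by (rule isCont_tendsto_compose[OF c]) (intro tendsto_intros)
  then show "((\<lambda>a::real. 1 / Gamma (a + 1)) \<longlongrightarrow> 1) (at_right 0)" by (simp add: e)
qed

lemma heat_avg_early_tendsto:
  fixes \<phi> :: "'a::euclidean_space \<Rightarrow> real"
  assumes p: "1 < p" and b: "0 \<le> b" "b < 1 / 2" and \<phi>: "\<phi> \<in> Cc_infty UNIV"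
  shows "((\<lambda>a. pint p (\<lambda>x. heat_avg (early a) (flow_grad b \<phi>) x - flow_grad b \<phi> x)) \<longlongrightarrow> 0) (at_right 0)"
proof -
  interpret test_function \<phi> by unfold_locales (rule \<phi>)
  let ?g = "flow_grad b \<phi>" and ?h = "heat_mom TYPE('a)"
  have gp: "pint p ?g < \<infinity>" by (rule flow_grad_pint_finite[OF p b \<phi>])
  obtain C where C: "0 \<le> C" "\<And>z. pint p (\<lambda>x. ?g (x - z) - ?g x) \<le> ennreal (C * norm z powr p)"
    using flow_grad_translation_pint[OF p b \<phi>] by metis
  obtain I where I: "pint p ?g = ennreal I" "0 \<le> I" using gp by (cases "pint p ?g") auto
  let ?u = "\<lambda>a. 2 powr p * ((2 * ?h * (1 / Gamma a) * (1 / (a + 1 / 2))) powr p * C + \<bar>1 / Gamma (a + 1) - 1\<bar> powr p * I)"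
  have ev: "\<forall>\<^sub>F a in at_right (0::real). 0 < a" by (simp add: eventually_at_filter)
  have ev2: "\<forall>\<^sub>F a in at_right 0. 0 \<le> 2 * ?h / (Gamma a * (a + 1 / 2))"
    using ev by eventually_elim (use heat_mom_pos[where 'a='a] in \<open>auto intro!: divide_nonneg_nonneg less_imp_le[OF Gamma_real_pos]\<close>)
  have "(?u \<longlongrightarrow> 2 powr p * ((2 * ?h * 0 * (1 / (0 + 1 / 2))) powr p * C + \<bar>1 - 1\<bar> powr p * I)) (at_right 0)"
    using p by (intro tendsto_intros inverse_Gamma_tendsto inverse_Gamma1_tendsto) (use ev2 in auto)
  then have "(?u \<longlongrightarrow> 0) (at_right 0)" using p by simp
  then have u: "((\<lambda>a. ennreal (?u a)) \<longlongrightarrow> 0) (at_right 0)"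
    using tendsto_ennrealI[of ?u 0] by simp
  show ?thesis
  proof (rule tendsto_sandwich[OF _ _ tendsto_const u])
    show "\<forall>\<^sub>F a in at_right 0. pint p (\<lambda>x. heat_avg (early a) ?g x - ?g x) \<le> ennreal (?u a)"
      using ev
    proof eventually_elim
      case (elim a)
      have "pint p (\<lambda>x. heat_avg (early a) ?g x - ?g x) \<le> ennreal (2 powr p) *
         (ennreal ((2 * ?h / (Gamma a * (a + 1 / 2))) powr p * C) + ennreal (\<bar>1 / Gamma (a + 1) - 1\<bar> powr p) * pint p ?g)"
        by (rule heat_avg_early_minus_id[OF p elim borel_flow_grad gp C])
      also have "\<dots> = ennreal (?u a)"
        using C(1) I by (simp add: ennreal_plus[symmetric] ennreal_mult[symmetric] del: ennreal_plus)
      finally show ?case .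
    qed
  qed simp
qed

section \<open>The fractional gradient as a mixture of heat flows\<close>

text \<open>Short times are controlled by the mass of \<open>nu k\<close>, long times by the supremum of the heat kernel.
  This replaces the local integrability of the Riesz kernel.\<close>

lemma nu_heat_potential_bounded:
  fixes G :: "'a::euclidean_space \<Rightarrow> real"
  assumes k: "0 < k" "k < 1 / 2" and [measurable]: "G \<in> borel_measurable borel"
    and G: "\<And>x. 0 \<le> G x" "\<And>x. G x \<le> B" "\<And>x. norm x > R \<Longrightarrow> G x = 0"
  shows "\<exists>C\<ge>0. \<forall>x. (\<integral>\<^sup>+y. ennreal (heat (fst y) (snd y) * G (x - snd y)) \<partial>(nu k \<Otimes>\<^sub>M lborel)) \<le> ennreal C"
proof -
  have iG: "integrable lborel G" by (rule integrable_bounded_support[of _ B R]) (use G in auto)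
  define I where "I = (LINT x|lborel. G x)"
  have I: "0 \<le> I" using G by (simp add: I_def)
  have B: "0 \<le> B" using G(1)[of 0] G(2)[of 0] by linarith
  define C where "C = B * (1 / (Gamma k * (k + 0))) + I * (1 / (Gamma k * (1 / 2 - k)))"
  have "(\<integral>\<^sup>+y. ennreal (heat (fst y) (snd y) * G (x - snd y)) \<partial>(nu k \<Otimes>\<^sub>M lborel)) \<le> ennreal C" for x
  proof -
    have "(\<integral>\<^sup>+y. ennreal (heat (fst y) (snd y) * G (x - snd y)) \<partial>(nu k \<Otimes>\<^sub>M lborel)) =
        (\<integral>\<^sup>+r. \<integral>\<^sup>+z. ennreal (heat r z * G (x - z)) \<partial>lborel \<partial>nu k)"
      by (subst lborel.nn_integral_fst[symmetric]) auto
    also have "\<dots> \<le> (\<integral>\<^sup>+r. ennreal B * ennreal (indicator {..1} r * r powr 0) +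
        ennreal I * ennreal (indicator {1<..} r * r powr - (1 / 2)) \<partial>nu k)"
    proof (rule nn_integral_mono_AE, use AE_nu_pos[OF k(1)] in eventually_elim)
      case (elim r)
      show ?case
      proof (cases "r \<le> 1")
        case True
        have "(\<integral>\<^sup>+z. ennreal (heat r z * G (x - z)) \<partial>lborel) \<le> (\<integral>\<^sup>+z. ennreal B * ennreal (heat r (z::'a)) \<partial>lborel)"
          using G B by (intro nn_integral_mono) (auto simp: ennreal_mult[symmetric] mult.commute[of B] intro!: ennreal_leI mult_left_mono)
        also have "\<dots> = ennreal B" using elim by (subst nn_integral_cmult) (auto simp: nn_integral_heat)
        finally show ?thesis using True elim by simp
      next
        case False
        have hr: "heat r z \<le> r powr - (1 / 2)" for z :: 'a
        proof -
          have "1 * r \<le> (4 * pi) * r" using pi_gt3 elim by (intro mult_right_mono) auto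
          then have pr: "1 \<le> 4 * pi * r" "r \<le> 4 * pi * r" using False by linarith+
          have "heat r z \<le> (4 * pi * r) powr - (real DIM('a) / 2)" using elim by (rule heat_le)
          also have "\<dots> \<le> (4 * pi * r) powr - (1 / 2)" using pr DIM_positive[where 'a='a] by (intro powr_mono) auto
          also have "\<dots> \<le> r powr - (1 / 2)" using pr elim by (intro powr_mono2') auto
          finally show ?thesis .
        qed
        have "(\<integral>\<^sup>+z. ennreal (heat r z * G (x - z)) \<partial>lborel) \<le> (\<integral>\<^sup>+z. ennreal (r powr - (1 / 2)) * ennreal (G (x - z)) \<partial>lborel)"
          using G hr by (intro nn_integral_mono) (auto simp: ennreal_mult[symmetric] intro!: ennreal_leI mult_right_mono)
        also have "\<dots> = ennreal (r powr - (1 / 2)) * (\<integral>\<^sup>+z. ennreal (G (x - z)) \<partial>lborel)"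
          by (rule nn_integral_cmult) simp
        also have "(\<integral>\<^sup>+z. ennreal (G (x - z)) \<partial>lborel) = (\<integral>\<^sup>+z. ennreal (G z) \<partial>lborel)"
          by (rule nn_integral_reflect[of "\<lambda>z. ennreal (G z)"]) simp
        also have "(\<integral>\<^sup>+z. ennreal (G z) \<partial>lborel) = ennreal I"
          unfolding I_def using G by (intro nn_integral_eq_integral iG) auto
        finally show ?thesis using False elim by (simp add: mult.commute)
      qed
    qed
    also have "\<dots> = ennreal B * ennreal (1 / (Gamma k * (k + 0))) + ennreal I * ennreal (1 / (Gamma k * (1 / 2 - k)))"
      using nn_integral_nu_low[of k 0] nn_integral_nu_high[of k "1 / 2"] k
      by (subst nn_integral_add) (auto simp: nn_integral_cmult)
    also have "\<dots> = ennreal C"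
      using I B k by (simp add: C_def ennreal_mult[symmetric] ennreal_plus[symmetric] del: ennreal_plus)
    finally show ?thesis .
  qed
  moreover have "0 \<le> C" using I B k by (simp add: C_def)
  ultimately show ?thesis by blast
qed

definition riesz_kernel :: "real \<Rightarrow> 'a::euclidean_space \<Rightarrow> real" where
  "riesz_kernel s z = frac_const DIM('a) s / (real DIM('a) - (1 - s)) / norm z powr (real DIM('a) - (1 - s))"

lemma borel_riesz_kernel [measurable]: "riesz_kernel s \<in> borel_measurable borel"
  unfolding riesz_kernel_def[abs_def] by measurable

lemma riesz_kernel_nonneg:
  fixes z :: "'a::euclidean_space"
  assumes s: "0 < s" "s < 1"
  shows "0 \<le> riesz_kernel s z"
proof -
  have "1 \<le> real DIM('a)" using DIM_positive[where 'a='a] by linarith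
  then have "0 \<le> real DIM('a) - (1 - s)" using s by linarith
  moreover have "0 < Gamma ((real DIM('a) + s + 1) / 2)" "0 < Gamma ((1 - s) / 2)" using s by (auto intro!: Gamma_real_pos)
  ultimately show ?thesis using s unfolding riesz_kernel_def frac_const_def by (auto intro!: divide_nonneg_nonneg mult_nonneg_nonneg)
qed

text \<open>The constant \<open>frac_const\<close> is exactly the one produced by the mixture of heat kernels.\<close>

lemma riesz_kernel_heat:
  fixes z :: "'a::euclidean_space"
  assumes s: "0 < s" "s < 1" and z: "z \<noteq> 0"
  shows "(\<integral>\<^sup>+r. ennreal (heat r z) \<partial>nu ((1 - s) / 2)) = ennreal (riesz_kernel s z)"
proof -
  let ?d = "real DIM('a)"
  define k where "k = (1 - s) / 2"
  have d: "1 \<le> ?d" using DIM_positive[where 'a='a] by linarith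
  define g where "g = (?d - 1 + s) / 2"
  have g: "0 < g" "?d / 2 - k = g" "(?d + s + 1) / 2 = g + 1" "?d - (1 - s) = 2 * g" "2 * k - ?d = - (2 * g)"
  proof -
    have "0 < (c - 1 + s) / 2" if "1 \<le> c" for c :: real using that s by simp
    then show "0 < g" using d unfolding g_def .
  qed (simp_all add: g_def k_def field_simps)
  have k: "0 < k" using s by (simp add: k_def)
  have "(1 - s) / 2 < c / 2" if "1 \<le> c" for c :: real using that s by simp
  then have kd: "k < ?d / 2" using d unfolding k_def .
  have Gam: "Gamma (g + 1) = g * Gamma g" using g(1) by (intro Gamma_plus1) (auto elim!: nonpos_Ints_cases)
  have "2 powr s / 2 = 1 / 4 powr k"
  proof -
    have "(4::real) powr k = 2 powr (2 * k)" using powr_powr[of 2 2 k] by simp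
    also have "2 * k = 1 - s" by (simp add: k_def)
    finally show ?thesis by (simp add: powr_diff)
  qed
  then have e: "2 powr s = 2 / 4 powr k" by simp
  have "frac_const DIM('a) s / (?d - (1 - s)) = Gamma g / (Gamma k * pi powr (?d / 2) * 4 powr k)"
    unfolding frac_const_def g(3) g(4) k_def[symmetric] e Gam
    using g(1) Gamma_real_pos[OF k] by (simp add: field_simps)
  then have "riesz_kernel s z = Gamma g / (Gamma k * pi powr (?d / 2) * 4 powr k) * norm z powr (- (2 * g))"
    unfolding riesz_kernel_def by (simp only: g(4) powr_minus_divide times_divide_eq_right mult_1_right)
  then show ?thesis
    using nn_integral_heat_nu[OF k kd z] unfolding g(2) g(5) k_def[symmetric] by simp
qed

lemma AE_lborel_nonzero: "AE z in (lborel :: 'a::euclidean_space measure). z \<noteq> 0"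
  by (rule AE_lborel_singleton)

lemma riesz_potential_bounded:
  fixes G :: "'a::euclidean_space \<Rightarrow> real"
  assumes s: "0 < s" "s < 1" and [measurable]: "G \<in> borel_measurable borel"
    and G: "\<And>x. 0 \<le> G x" "\<And>x. G x \<le> B" "\<And>x. norm x > R \<Longrightarrow> G x = 0"
  shows "\<exists>C\<ge>0. \<forall>x. (\<integral>\<^sup>+z. ennreal (riesz_kernel s z * G (x - z)) \<partial>lborel) \<le> ennreal C"
proof -
  define k where "k = (1 - s) / 2"
  have k: "0 < k" "k < 1 / 2" using s by (auto simp: k_def)
  obtain C where C: "0 \<le> C" "\<And>x. (\<integral>\<^sup>+y. ennreal (heat (fst y) (snd y) * G (x - snd y)) \<partial>(nu k \<Otimes>\<^sub>M lborel)) \<le> ennreal C"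
    using nu_heat_potential_bounded[OF k \<open>G \<in> _\<close> G] by blast
  interpret P: pair_sigma_finite "nu k" "lborel :: 'a measure" ..
  have "(\<integral>\<^sup>+z. ennreal (riesz_kernel s z * G (x - z)) \<partial>lborel) \<le> ennreal C" for x
  proof -
    have "(\<integral>\<^sup>+z. ennreal (riesz_kernel s z * G (x - z)) \<partial>lborel) =
        (\<integral>\<^sup>+z. \<integral>\<^sup>+r. ennreal (heat r z * G (x - z)) \<partial>nu k \<partial>lborel)"
    proof (rule nn_integral_cong_AE, use AE_lborel_nonzero in eventually_elim)
      case (elim z)
      have "ennreal (riesz_kernel s z * G (x - z)) = (\<integral>\<^sup>+r. ennreal (heat r z) \<partial>nu k) * ennreal (G (x - z))"
        using riesz_kernel_heat[OF s elim] riesz_kernel_nonneg[OF s, of z] G by (simp add: k_def ennreal_mult)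
      also have "\<dots> = (\<integral>\<^sup>+r. ennreal (heat r z * G (x - z)) \<partial>nu k)"
        using G by (subst nn_integral_multc[symmetric]) (auto simp: ennreal_mult)
      finally show ?case .
    qed
    also have "\<dots> = (\<integral>\<^sup>+y. ennreal (heat (fst y) (snd y) * G (x - snd y)) \<partial>(nu k \<Otimes>\<^sub>M lborel))"
      by (subst P.nn_integral_snd[symmetric]) auto
    finally show ?thesis using C(2)[of x] by simp
  qed
  then show ?thesis using C(1) by blast
qed

lemma riesz_integrable:
  fixes f :: "'a::euclidean_space \<Rightarrow> 'b::{banach, second_countable_topology}"
  assumes s: "0 < s" "s < 1" and [measurable]: "f \<in> borel_measurable borel"
    and f: "\<And>x. norm (f x) \<le> B" "\<And>x. norm x > R \<Longrightarrow> f x = 0"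
  shows "integrable lborel (\<lambda>z. riesz_kernel s z *\<^sub>R f (x - z))"
proof -
  obtain C where C: "\<And>x. (\<integral>\<^sup>+z. ennreal (riesz_kernel s z * norm (f (x - z))) \<partial>lborel) \<le> ennreal C"
  proof -
    have "\<exists>C\<ge>0. \<forall>x. (\<integral>\<^sup>+z. ennreal (riesz_kernel s z * norm (f (x - z))) \<partial>lborel) \<le> ennreal C"
      by (rule riesz_potential_bounded[OF s, of _ B R]) (use f in auto)
    then show ?thesis using that by blast
  qed
  show ?thesis
    using C[of x] riesz_kernel_nonneg[OF s, where 'a='a]
    by (intro integrableI_bounded) (auto intro: le_less_trans)
qed

lemma riesz_eq_convolution:
  fixes \<phi> :: "'a::euclidean_space \<Rightarrow> real"
  assumes [measurable]: "\<phi> \<in> borel_measurable borel"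
  shows "riesz (1 - s) \<phi> x = (LINT z|lborel. riesz_kernel s z * \<phi> (x - z))"
proof -
  let ?c = "frac_const DIM('a) s / (real DIM('a) - (1 - s))"
  have "riesz (1 - s) \<phi> x = ?c * (LINT y|lborel. \<phi> y / norm (x - y) powr (real DIM('a) - (1 - s)))"
    unfolding riesz_def by (subst integral_completion) auto
  also have "\<dots> = (LINT y|lborel. (\<lambda>z. riesz_kernel s z * \<phi> (x - z)) (x - y))"
    by (subst integral_mult_right_zero[symmetric])
       (auto intro!: Bochner_Integration.integral_cong simp: riesz_kernel_def)
  also have "\<dots> = (LINT z|lborel. riesz_kernel s z * \<phi> (x - z))"
    by (rule integral_reflect) measurable
  finally show ?thesis .
qed

lemma Cc_infty_Taylor:
  fixes \<phi> :: "'a::euclidean_space \<Rightarrow> real"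
  assumes \<phi>: "\<phi> \<in> Cc_infty UNIV"
  obtains L where "0 < L" "\<And>w h. \<bar>\<phi> (w + h) - \<phi> w - h \<bullet> grad \<phi> w\<bar> \<le> L * (norm h)\<^sup>2"
proof -
  obtain L where L: "0 < L" "\<And>x y. norm (grad \<phi> x - grad \<phi> y) \<le> L * norm (x - y)"
    using Cc_infty_Lipschitz[OF Cc_infty_grad[OF \<phi>]] by metis
  have "\<bar>\<phi> (w + h) - \<phi> w - h \<bullet> grad \<phi> w\<bar> \<le> L * (norm h)\<^sup>2" for w h
  proof -
    let ?S = "closed_segment w (w + h)" and ?f = "\<lambda>y. \<phi> y - y \<bullet> grad \<phi> w"
    have "norm (?f (w + h) - ?f w) \<le> (L * norm h) * norm ((w + h) - w)"
    proof (rule differentiable_bound[of ?S ?f "\<lambda>y v. v \<bullet> (grad \<phi> y - grad \<phi> w)"])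
      fix y assume y: "y \<in> ?S"
      have "(?f has_derivative (\<lambda>v. v \<bullet> (grad \<phi> y - grad \<phi> w))) (at y)"
        using Cc_infty_GDERIV[OF \<phi>, of y] unfolding gderiv_def
        by (auto intro!: derivative_eq_intros simp: inner_diff_right)
      then show "(?f has_derivative (\<lambda>v. v \<bullet> (grad \<phi> y - grad \<phi> w))) (at y within ?S)"
        by (rule has_derivative_at_withinI)
      have yw: "norm (y - w) \<le> norm h"
        using y segment_bound(1)[of y w "w + h"] by (simp add: norm_minus_commute)
      show "onorm (\<lambda>v. v \<bullet> (grad \<phi> y - grad \<phi> w)) \<le> L * norm h"
      proof (rule onorm_le)
        fix v
        have "norm (v \<bullet> (grad \<phi> y - grad \<phi> w)) \<le> norm v * norm (grad \<phi> y - grad \<phi> w)"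
          by (simp add: Cauchy_Schwarz_ineq2)
        also have "\<dots> \<le> norm v * (L * norm h)"
          using L yw by (intro mult_left_mono order_trans[OF L(2)]) auto
        finally show "norm (v \<bullet> (grad \<phi> y - grad \<phi> w)) \<le> L * norm h * norm v" by (simp add: mult.commute)
      qed
    qed auto
    then show ?thesis by (simp add: inner_add_left power2_eq_square algebra_simps)
  qed
  then show ?thesis using that L by blast
qed

text \<open>For small increments the Taylor remainder of \<open>\<phi>\<close> is quadratic and supported in a fixed ball, where
  the potential of the kernel is bounded.\<close>

lemma riesz_GDERIV:
  fixes \<phi> :: "'a::euclidean_space \<Rightarrow> real"
  assumes s: "0 < s" "s < 1" and \<phi>: "\<phi> \<in> Cc_infty UNIV"
  shows "GDERIV (riesz (1 - s) \<phi>) x :> (LINT z|lborel. riesz_kernel s z *\<^sub>R grad \<phi> (x - z))"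
proof -
  interpret test_function \<phi> by unfold_locales (rule \<phi>)
  obtain B R where B: "0 < B" "0 < R" "\<And>x. norm (\<phi> x) \<le> B" "\<And>x. norm x > R \<Longrightarrow> \<phi> x = 0"
    using Cc_infty_bounded[OF \<phi>] by metis
  obtain B' R' where B': "0 < R'" "\<And>x. norm (grad \<phi> x) \<le> B'" "\<And>x. norm x > R' \<Longrightarrow> grad \<phi> x = 0"
    using Cc_infty_bounded[OF Cc_infty_grad[OF \<phi>]] by metis
  obtain L where L: "0 < L" "\<And>w h. \<bar>\<phi> (w + h) - \<phi> w - h \<bullet> grad \<phi> w\<bar> \<le> L * (norm h)\<^sup>2"
    using Cc_infty_Taylor[OF \<phi>] by metis
  \<comment> \<open>For increments of norm at most 1 the remainder vanishes outside this radius.\<close>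
  define Q where "Q = max R R' + 1"
  define G :: "'a \<Rightarrow> real" where "G = indicator (cball 0 Q)"
  have Gm [measurable]: "G \<in> borel_measurable borel" unfolding G_def by (rule borel_measurable_indicator) simp
  obtain C where C: "0 \<le> C" "\<And>x. (\<integral>\<^sup>+z. ennreal (riesz_kernel s z * G (x - z)) \<partial>lborel) \<le> ennreal C"
  proof -
    have "\<exists>C\<ge>0. \<forall>x. (\<integral>\<^sup>+z. ennreal (riesz_kernel s z * G (x - z)) \<partial>lborel) \<le> ennreal C"
      by (rule riesz_potential_bounded[OF s Gm, of 1 Q]) (auto simp: G_def)
    then show ?thesis using that by blast
  qed
  have iG: "integrable lborel (\<lambda>z. riesz_kernel s z * G (x - z))"
    using riesz_integrable[OF s Gm, of 1 Q x] by (simp add: G_def)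
  have GC: "(LINT z|lborel. riesz_kernel s z * G (x - z)) \<le> C"
    using C(2)[of x] C(1) riesz_kernel_nonneg[OF s, where 'a='a]
    by (subst (asm) nn_integral_eq_integral[OF iG]) (auto simp: G_def)
  have i\<phi>: "integrable lborel (\<lambda>z. riesz_kernel s z * \<phi> (y - z))" for y
    using riesz_integrable[OF s borel_phi B(3,4), where x=y] by simp
  have ig: "integrable lborel (\<lambda>z. riesz_kernel s z *\<^sub>R grad \<phi> (x - z))"
    by (rule riesz_integrable[OF s borel_grad B'(2,3)])
  define D where "D = (LINT z|lborel. riesz_kernel s z *\<^sub>R grad \<phi> (x - z))"
  have pt: "\<bar>\<phi> (w + h) - \<phi> w - h \<bullet> grad \<phi> w\<bar> \<le> L * (norm h)\<^sup>2 * G w" if "norm h \<le> 1" for w h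
  proof (cases "norm w \<le> Q")
    case True then show ?thesis using L(2)[of w h] by (simp add: G_def)
  next
    case False
    moreover have "norm (w + h) \<ge> norm w - norm h" using norm_diff_ineq by blast
    ultimately have "norm w > R" "norm (w + h) > R" "norm w > R'" using that by (auto simp: Q_def)
    then show ?thesis using B(4) B'(3) L(1) by (simp add: G_def)
  qed
  have rem: "\<bar>riesz (1 - s) \<phi> y - riesz (1 - s) \<phi> x - (y - x) \<bullet> D\<bar> \<le> L * C * (norm (y - x))\<^sup>2" if "norm (y - x) \<le> 1" for y
  proof -
    define h where "h = y - x"
    have ih: "integrable lborel (\<lambda>z. riesz_kernel s z * (h \<bullet> grad \<phi> (x - z)))"
    proof -
      have "integrable lborel (\<lambda>z. h \<bullet> (riesz_kernel s z *\<^sub>R grad \<phi> (x - z)))"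
        by (rule integrable_inner_right, rule ig)
      then show ?thesis by simp
    qed
    have hD: "h \<bullet> D = (LINT z|lborel. riesz_kernel s z * (h \<bullet> grad \<phi> (x - z)))"
      unfolding D_def by (subst integral_inner_right[OF ig, symmetric]) simp
    have eq: "riesz (1 - s) \<phi> y - riesz (1 - s) \<phi> x - h \<bullet> D =
       (LINT z|lborel. riesz_kernel s z * \<phi> (y - z) - riesz_kernel s z * \<phi> (x - z) - riesz_kernel s z * (h \<bullet> grad \<phi> (x - z)))"
      unfolding riesz_eq_convolution[OF borel_phi] hD
      by (simp only: Bochner_Integration.integral_diff[OF Bochner_Integration.integrable_diff[OF i\<phi> i\<phi>] ih]
          Bochner_Integration.integral_diff[OF i\<phi> i\<phi>])
    have "\<bar>riesz (1 - s) \<phi> y - riesz (1 - s) \<phi> x - h \<bullet> D\<bar> \<le> (LINT z|lborel. \<bar>riesz_kernel s z * \<phi> (y - z) - riesz_kernel s z * \<phi> (x - z) - riesz_kernel s z * (h \<bullet> grad \<phi> (x - z))\<bar>)"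
      unfolding eq by (rule integral_abs_bound)
    also have "\<dots> \<le> (LINT z|lborel. L * (norm h)\<^sup>2 * (riesz_kernel s z * G (x - z)))"
    proof (rule integral_mono)
      fix z
      have "\<bar>riesz_kernel s z * \<phi> (y - z) - riesz_kernel s z * \<phi> (x - z) - riesz_kernel s z * (h \<bullet> grad \<phi> (x - z))\<bar> =
          riesz_kernel s z * \<bar>\<phi> ((x - z) + h) - \<phi> (x - z) - h \<bullet> grad \<phi> (x - z)\<bar>"
        using riesz_kernel_nonneg[OF s, of z] by (simp add: h_def right_diff_distrib[symmetric] abs_mult)
      also have "\<dots> \<le> riesz_kernel s z * (L * (norm h)\<^sup>2 * G (x - z))"
        using that by (intro mult_left_mono pt riesz_kernel_nonneg s) (simp add: h_def)
      finally show "\<bar>riesz_kernel s z * \<phi> (y - z) - riesz_kernel s z * \<phi> (x - z) - riesz_kernel s z * (h \<bullet> grad \<phi> (x - z))\<bar>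
         \<le> L * (norm h)\<^sup>2 * (riesz_kernel s z * G (x - z))" by (simp add: mult_ac)
    next
      show "integrable lborel (\<lambda>z. \<bar>riesz_kernel s z * \<phi> (y - z) - riesz_kernel s z * \<phi> (x - z) - riesz_kernel s z * (h \<bullet> grad \<phi> (x - z))\<bar>)"
        by (intro integrable_abs Bochner_Integration.integrable_diff i\<phi> ih)
      show "integrable lborel (\<lambda>z. L * (norm h)\<^sup>2 * (riesz_kernel s z * G (x - z)))"
        by (intro integrable_mult_right iG)
    qed
    also have "\<dots> = L * (norm h)\<^sup>2 * (LINT z|lborel. riesz_kernel s z * G (x - z))" by simp
    also have "\<dots> \<le> L * (norm h)\<^sup>2 * C" using L(1) by (intro mult_left_mono GC) auto
    finally show ?thesis by (simp add: h_def mult_ac)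
  qed
  have "(riesz (1 - s) \<phi> has_derivative (\<lambda>h. h \<bullet> D)) (at x)"
  proof (rule has_derivativeI_sandwich[where e=1 and H="\<lambda>y. L * C * norm (y - x)"])
    show "bounded_linear (\<lambda>h. h \<bullet> D)" by (rule bounded_linear_inner_left)
    fix y assume "y \<noteq> x" "dist y x < 1"
    then show "norm (riesz (1 - s) \<phi> y - riesz (1 - s) \<phi> x - (y - x) \<bullet> D) / norm (y - x) \<le> L * C * norm (y - x)"
      using rem[of y] by (simp add: dist_norm pos_divide_le_eq power2_eq_square mult_ac)
  next
    have "((\<lambda>y. L * C * norm (y - x)) \<longlongrightarrow> L * C * norm (x - x)) (at x)" by (intro tendsto_intros)
    then show "((\<lambda>y. L * C * norm (y - x)) \<longlongrightarrow> 0) (at x)" by simp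
  qed simp
  then show ?thesis by (simp add: gderiv_def D_def)
qed

text \<open>The link to the definition by Riesz potentials: the derivative passes to \<open>\<phi>\<close>, and the kernel is
  written as a mixture of heat kernels.\<close>

theorem fgrad_eq_flow_grad:
  fixes \<phi> :: "'a::euclidean_space \<Rightarrow> real"
  assumes s: "0 < s" "s \<le> 1" and \<phi>: "\<phi> \<in> Cc_infty UNIV"
  shows "fgrad s \<phi> = flow_grad ((1 - s) / 2) \<phi>"
proof (cases "s = 1")
  case True then show ?thesis by (simp add: fgrad_def flow_grad_0)
next
  case False
  with s have s1: "s < 1" by simp
  interpret test_function \<phi> by unfold_locales (rule \<phi>)
  define k where "k = (1 - s) / 2"
  have k: "0 < k" "k < 1 / 2" using s s1 by (auto simp: k_def)
  interpret P: pair_sigma_finite "nu k" "lborel :: 'a measure" ..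
  obtain B' R' where B': "0 < R'" "\<And>x. norm (grad \<phi> x) \<le> B'" "\<And>x. norm x > R' \<Longrightarrow> grad \<phi> x = 0"
    using Cc_infty_bounded[OF Cc_infty_grad[OF \<phi>]] by metis
  show ?thesis
  proof
    fix x
    obtain C where C: "\<And>x. (\<integral>\<^sup>+y. ennreal (heat (fst y) (snd y) * norm (grad \<phi> (x - snd y))) \<partial>(nu k \<Otimes>\<^sub>M lborel)) \<le> ennreal C"
    proof -
      have "\<exists>C\<ge>0. \<forall>x. (\<integral>\<^sup>+y. ennreal (heat (fst y) (snd y) * norm (grad \<phi> (x - snd y))) \<partial>(nu k \<Otimes>\<^sub>M lborel)) \<le> ennreal C"
        by (rule nu_heat_potential_bounded[OF k, of _ B' R']) (use B' in auto)
      then show ?thesis using that by blast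
    qed
    have int: "integrable (nu k \<Otimes>\<^sub>M lborel) (\<lambda>(r, z). heat r z *\<^sub>R grad \<phi> (x - z))"
      using C[of x] by (intro integrableI_bounded) (auto simp: split_beta intro: le_less_trans)
    have "fgrad s \<phi> x = (LINT z|lborel. riesz_kernel s z *\<^sub>R grad \<phi> (x - z))"
      using False by (simp add: fgrad_def grad_eqI[OF riesz_GDERIV[OF s(1) s1 \<phi>]])
    also have "\<dots> = (LINT z|lborel. LINT r|nu k. heat r z *\<^sub>R grad \<phi> (x - z))"
    proof (rule integral_cong_AE)
      show "(\<lambda>z. LINT r|nu k. heat r z *\<^sub>R grad \<phi> (x - z)) \<in> borel_measurable lborel"
        by (rule nu.borel_measurable_lebesgue_integral) measurable
      show "AE z in lborel. riesz_kernel s z *\<^sub>R grad \<phi> (x - z) = (LINT r|nu k. heat r z *\<^sub>R grad \<phi> (x - z))"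
        using AE_lborel_nonzero
      proof eventually_elim
        case (elim z)
        have e: "(\<integral>\<^sup>+r. ennreal (heat r z) \<partial>nu k) = ennreal (riesz_kernel s z)"
          using riesz_kernel_heat[OF s(1) s1 elim] by (simp add: k_def)
        then have i: "integrable (nu k) (\<lambda>r. heat r z)" by (intro integrableI_nonneg) auto
        have "(LINT r|nu k. heat r z) = riesz_kernel s z"
          using e riesz_kernel_nonneg[OF s(1) s1, of z] by (subst (asm) nn_integral_eq_integral[OF i]) auto
        then show ?case using i by simp
      qed
    qed measurable
    also have "\<dots> = (LINT r|nu k. LINT z|lborel. heat r z *\<^sub>R grad \<phi> (x - z))"
      by (rule P.Fubini_integral[OF int])
    also have "\<dots> = flow_grad k \<phi> x" using k by (simp add: flow_grad_def heat_grad_def)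
    finally show "fgrad s \<phi> x = flow_grad ((1 - s) / 2) \<phi> x" by (simp add: k_def)
  qed
qed

section \<open>Lebesgue measurable representatives\<close>

text \<open>Convolutions need joint measurability in product spaces. They are therefore formed with Borel
  representatives of Lebesgue measurable functions.\<close>

lemma lebesgue_borel_rep:
  fixes f :: "'a::euclidean_space \<Rightarrow> 'b::euclidean_space"
  assumes f: "f \<in> borel_measurable lebesgue"
  obtains g where "g \<in> borel_measurable borel" "AE x in lborel. f x = g x"
proof -
  have "\<forall>b. \<exists>h. h \<in> borel_measurable borel \<and> (AE x in lborel. f x \<bullet> b = h x)"
  proof
    fix b
    have "(\<lambda>x. f x \<bullet> b) \<in> borel_measurable lebesgue" using f by measurable
    from completion_ex_borel_measurable_real[OF this]
    show "\<exists>h. h \<in> borel_measurable borel \<and> (AE x in lborel. f x \<bullet> b = h x)" by simp blast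
  qed
  from choice[OF this] obtain h where h: "\<And>b. h b \<in> borel_measurable borel" "\<And>b. AE x in lborel. f x \<bullet> b = h b x"
    by blast
  show ?thesis
  proof
    show "(\<lambda>x. \<Sum>b\<in>Basis. h b x *\<^sub>R b) \<in> borel_measurable borel" using h(1) by measurable
    have "AE x in lborel. \<forall>b\<in>Basis. f x \<bullet> b = h b x" by (rule AE_finite_allI) (use h(2) in auto)
    then show "AE x in lborel. f x = (\<Sum>b\<in>Basis. h b x *\<^sub>R b)"
    proof eventually_elim
      case (elim x)
      have "f x = (\<Sum>b\<in>Basis. (f x \<bullet> b) *\<^sub>R b)" by (simp add: euclidean_representation)
      also have "\<dots> = (\<Sum>b\<in>Basis. h b x *\<^sub>R b)" using elim by (intro sum.cong) auto
      finally show ?case .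
    qed
  qed
qed

lemma borel_imp_lebesgue: "f \<in> borel_measurable borel \<Longrightarrow> f \<in> borel_measurable lebesgue"
  by (simp add: measurable_completion)

lemma lebesgue_cong_AE:
  fixes f g :: "'a::euclidean_space \<Rightarrow> 'b::euclidean_space"
  assumes "f \<in> borel_measurable lebesgue" "AE x in lborel. f x = g x"
  shows "g \<in> borel_measurable lebesgue"
  by (rule borel_measurable_AE[OF assms(1) AE_completion[OF assms(2)]])

lemma pint_lebesgue: "(\<integral>\<^sup>+x. ennreal (norm (f x) powr p) \<partial>lebesgue) = pint p f"
  by (simp add: pint_def nn_integral_completion)

lemma Lp_iff: "f \<in> Lp p \<longleftrightarrow> f \<in> borel_measurable lebesgue \<and> pint p f < \<infinity>"
proof -
  have "integrable lebesgue (\<lambda>x. norm (f x) powr p) \<longleftrightarrow> pint p f < \<infinity>" if "f \<in> borel_measurable lebesgue"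
  proof -
    have "(\<lambda>x. norm (f x) powr p) \<in> borel_measurable lebesgue" using that by measurable
    then show ?thesis by (simp add: integrable_iff_bounded pint_lebesgue)
  qed
  then show ?thesis by (auto simp: Lp_def)
qed

lemma Lp_measurable: "f \<in> Lp p \<Longrightarrow> f \<in> borel_measurable lebesgue"
  by (simp add: Lp_iff)

lemma Lp_norm_powr:
  assumes f: "f \<in> Lp p" and p: "0 < p"
  shows "ennreal (Lp_norm p f powr p) = pint p f"
proof -
  have i: "integrable lebesgue (\<lambda>x. norm (f x) powr p)" using f by (simp add: Lp_def)
  have "pint p f = ennreal (LINT x|lebesgue. norm (f x) powr p)"
    unfolding pint_lebesgue[symmetric] by (rule nn_integral_eq_integral[OF i]) auto
  then show ?thesis using p by (simp add: Lp_norm_def powr_powr)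
qed

lemma pint_add_leb:
  fixes f g :: "'a::euclidean_space \<Rightarrow> 'b::euclidean_space"
  assumes "f \<in> borel_measurable lebesgue" "g \<in> borel_measurable lebesgue" "0 \<le> p"
  shows "pint p (\<lambda>x. f x + g x) \<le> ennreal (2 powr p) * (pint p f + pint p g)"
proof -
  obtain f' where f': "f' \<in> borel_measurable borel" "AE x in lborel. f x = f' x"
    using lebesgue_borel_rep[OF assms(1)] by metis
  obtain g' where g': "g' \<in> borel_measurable borel" "AE x in lborel. g x = g' x"
    using lebesgue_borel_rep[OF assms(2)] by metis
  have "AE x in lborel. f x + g x = f' x + g' x" using f'(2) g'(2) by eventually_elim auto
  from pint_cong_AE[OF this] pint_cong_AE[OF f'(2)] pint_cong_AE[OF g'(2)] pint_add[OF f'(1) g'(1) assms(3)]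
  show ?thesis by simp
qed

lemma pint_scaleR_leb:
  fixes f :: "'a::euclidean_space \<Rightarrow> 'b::euclidean_space"
  assumes "f \<in> borel_measurable lebesgue"
  shows "pint p (\<lambda>x. c *\<^sub>R f x) = ennreal (\<bar>c\<bar> powr p) * pint p f"
proof -
  obtain f' where f': "f' \<in> borel_measurable borel" "AE x in lborel. f x = f' x"
    using lebesgue_borel_rep[OF assms(1)] by metis
  have "AE x in lborel. c *\<^sub>R f x = c *\<^sub>R f' x" using f'(2) by eventually_elim auto
  from pint_cong_AE[OF this] pint_cong_AE[OF f'(2)] pint_scaleR[OF f'(1)] show ?thesis by simp
qed

lemma pint_lincomb:
  fixes f g :: "'a::euclidean_space \<Rightarrow> 'b::euclidean_space"
  assumes [measurable]: "f \<in> borel_measurable lebesgue" "g \<in> borel_measurable lebesgue" and p: "0 \<le> p"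
  shows "pint p (\<lambda>x. c *\<^sub>R f x + d *\<^sub>R g x) \<le>
    ennreal (2 powr p) * (ennreal (\<bar>c\<bar> powr p) * pint p f + ennreal (\<bar>d\<bar> powr p) * pint p g)"
  using pint_add_leb[of "\<lambda>x. c *\<^sub>R f x" "\<lambda>x. d *\<^sub>R g x" p] p by (simp add: pint_scaleR_leb)

lemma Lp_lincomb:
  fixes f g :: "'a::euclidean_space \<Rightarrow> 'b::euclidean_space"
  assumes f: "f \<in> Lp p" and g: "g \<in> Lp p" and p: "0 \<le> p"
  shows "(\<lambda>x. c *\<^sub>R f x + d *\<^sub>R g x) \<in> Lp p"
proof -
  have [measurable]: "f \<in> borel_measurable lebesgue" "g \<in> borel_measurable lebesgue" using f g by (auto simp: Lp_iff)
  have "pint p (\<lambda>x. c *\<^sub>R f x + d *\<^sub>R g x) < \<infinity>"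
    by (rule le_less_trans[OF pint_lincomb]) (use f g p in \<open>auto simp: Lp_iff ennreal_mult_less_top\<close>)
  then show ?thesis by (simp add: Lp_iff)
qed

lemma Lp_diff:
  fixes f g :: "'a::euclidean_space \<Rightarrow> 'b::euclidean_space"
  assumes "f \<in> Lp p" "g \<in> Lp p" "0 \<le> p" shows "(\<lambda>x. f x - g x) \<in> Lp p"
  using Lp_lincomb[OF assms, of 1 "-1"] by simp

lemma Lp_cong_AE:
  fixes f g :: "'a::euclidean_space \<Rightarrow> 'b::euclidean_space"
  assumes "f \<in> Lp p" "AE x in lborel. f x = g x" shows "g \<in> Lp p"
  using assms lebesgue_cong_AE[of f g] pint_cong_AE[OF assms(2), of p] by (auto simp: Lp_iff)

lemma Lp_subset_L1_loc:
  fixes f :: "'a::euclidean_space \<Rightarrow> 'b::euclidean_space"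
  assumes f: "f \<in> Lp p" and p: "1 \<le> p" shows "f \<in> L1_loc"
proof -
  have m [measurable]: "f \<in> borel_measurable lebesgue" and i: "integrable lebesgue (\<lambda>x. norm (f x) powr p)"
    using f by (auto simp: Lp_def)
  have "set_integrable lebesgue C f" if "compact C" for C
    unfolding set_integrable_def
  proof (rule Bochner_Integration.integrable_bound)
    have C: "C \<in> lmeasurable" using that by (rule lmeasurable_compact)
    then show "integrable lebesgue (\<lambda>x. indicator C x + norm (f x) powr p)"
      using i by (intro Bochner_Integration.integrable_add) (auto simp: fmeasurable_def less_top)
    show "(\<lambda>x. indicator C x *\<^sub>R f x) \<in> borel_measurable lebesgue" using fmeasurableD[OF C] by measurable
    show "AE x in lebesgue. norm (indicator C x *\<^sub>R f x) \<le> norm (indicator C x + norm (f x) powr p)"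
    proof (rule AE_I2)
      fix x
      have "norm (f x) \<le> 1 + norm (f x) powr p"
      proof (cases "norm (f x) \<le> 1")
        case True then show ?thesis using powr_ge_zero[of "norm (f x)" p] by linarith
      next
        case False
        then have "norm (f x) powr 1 \<le> norm (f x) powr p" using p by (intro powr_mono) auto
        then show ?thesis using False by simp
      qed
      then show "norm (indicator C x *\<^sub>R f x) \<le> norm (indicator C x + norm (f x) powr p)"
        by (auto simp: indicator_def)
    qed
  qed
  then show ?thesis using m by (simp add: L1_loc_def)
qed

lemma Hoelder_pint:
  fixes g :: "'a::euclidean_space \<Rightarrow> real"
  assumes p: "1 < p" and gm: "g \<in> borel_measurable lebesgue" and g: "pint (p / (p - 1)) g < \<infinity>"
  shows "\<exists>K\<ge>0. \<forall>u\<in>Lp p. integrable lebesgue (\<lambda>x. u x * g x) \<and>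
     (LINT x|lebesgue. \<bar>u x * g x\<bar>) \<le> K * enn2real (pint p u) powr (1 / p)"
proof -
  obtain B where B: "pint (p / (p - 1)) g = ennreal B" "0 \<le> B" using g by (cases "pint (p / (p - 1)) g") auto
  show ?thesis
  proof (intro exI[of _ "1 + B"] conjI ballI)
    fix u :: "'a \<Rightarrow> real" assume u: "u \<in> Lp p"
    have um: "u \<in> borel_measurable lebesgue" using u by (simp add: Lp_iff)
    have A: "pint p u = ennreal (enn2real (pint p u))" using u by (simp add: Lp_iff)
    have f: "(\<integral>\<^sup>+x. ennreal (\<bar>u x\<bar> powr p) \<partial>lebesgue) \<le> ennreal (enn2real (pint p u))"
      using A pint_lebesgue[of u p] by simp
    have g': "(\<integral>\<^sup>+x. ennreal (\<bar>g x\<bar> powr (p / (p - 1))) \<partial>lebesgue) \<le> ennreal B"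
      using B pint_lebesgue[of g "p / (p - 1)"] by simp
    note H = Hoelder_bound[OF p refl um gm f enn2real_nonneg g' B(2)]
    show "integrable lebesgue (\<lambda>x. u x * g x)" by (rule H(1))
    show "(LINT x|lebesgue. \<bar>u x * g x\<bar>) \<le> (1 + B) * enn2real (pint p u) powr (1 / p)"
      using H(2) by (simp only: mult.commute)
  qed (use B in auto)
qed

section \<open>Weak fractional gradients\<close>

lemma fdiv_eq:
  assumes s: "0 < s" "s \<le> 1" and \<Phi>: "\<Phi> \<in> Cc_infty UNIV"
  shows "fdiv s \<Phi> x = (\<Sum>b\<in>Basis. flow_grad ((1 - s) / 2) (\<lambda>y. \<Phi> y \<bullet> b) x \<bullet> b)"
  unfolding fdiv_def by (simp add: fgrad_eq_flow_grad[OF s Cc_infty_inner[OF \<Phi>]])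

lemma flow_grad_borel: "\<phi> \<in> Cc_infty UNIV \<Longrightarrow> flow_grad b \<phi> \<in> borel_measurable borel"
  by (rule test_function.borel_flow_grad[OF test_function.intro])

lemma flow_grad_Lp:
  fixes \<phi> :: "'a::euclidean_space \<Rightarrow> real"
  assumes "1 < p" "0 \<le> b" "b < 1 / 2" "\<phi> \<in> Cc_infty UNIV" shows "flow_grad b \<phi> \<in> Lp p"
  using flow_grad_pint_finite[OF assms] borel_imp_lebesgue[OF flow_grad_borel[OF assms(4), of b]] by (simp add: Lp_iff)

lemma Cc_infty_Lp:
  fixes \<phi> :: "'a::euclidean_space \<Rightarrow> 'b::euclidean_space"
  assumes "0 < p" "\<phi> \<in> Cc_infty \<Omega>" shows "\<phi> \<in> Lp p"
proof -
  obtain B R where "\<And>x. norm (\<phi> x) \<le> B" "\<And>x. norm x > R \<Longrightarrow> \<phi> x = 0" using Cc_infty_bounded[OF assms(2)] by metis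
  then have "pint p \<phi> < \<infinity>" using pint_bounded_support assms(1) by blast
  then show ?thesis using borel_imp_lebesgue[OF Cc_infty_borel[OF assms(2)]] by (simp add: Lp_iff)
qed

lemma Lp_sum:
  fixes f :: "'i \<Rightarrow> 'a::euclidean_space \<Rightarrow> 'b::euclidean_space"
  assumes "finite I" "\<And>i. i \<in> I \<Longrightarrow> f i \<in> Lp p" "0 \<le> p"
  shows "(\<lambda>x. \<Sum>i\<in>I. f i x) \<in> Lp p"
  using assms(1,2)
proof (induction I rule: finite_induct)
  case empty
  then show ?case by (auto simp: Lp_iff pint_def)
next
  case (insert i I)
  then show ?case using Lp_lincomb[of "f i" p "\<lambda>x. \<Sum>i\<in>I. f i x" 1 1] assms(3) by auto
qed

lemma Lp_inner:
  fixes f :: "'a::euclidean_space \<Rightarrow> 'b::euclidean_space"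
  assumes f: "f \<in> Lp p" and p: "0 \<le> p" and b: "b \<in> Basis" shows "(\<lambda>x. f x \<bullet> b) \<in> Lp p"
proof -
  have "pint p (\<lambda>x. f x \<bullet> b) \<le> pint p f" by (rule pint_mono[OF p]) (use b Basis_le_norm in auto)
  then show ?thesis using f by (auto simp: Lp_iff)
qed

lemma fdiv_Lp:
  fixes \<Phi> :: "'a::euclidean_space \<Rightarrow> 'a"
  assumes q: "1 < q" and s: "0 < s" "s \<le> 1" and \<Phi>: "\<Phi> \<in> Cc_infty UNIV"
  shows "fdiv s \<Phi> \<in> Lp q"
proof -
  have "(\<lambda>x. \<Sum>b\<in>Basis. flow_grad ((1 - s) / 2) (\<lambda>y. \<Phi> y \<bullet> b) x \<bullet> b) \<in> Lp q"
    by (intro Lp_sum Lp_inner flow_grad_Lp Cc_infty_inner) (use q s \<Phi> in auto)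
  then show ?thesis by (simp add: fdiv_eq[OF s \<Phi>, abs_def])
qed

lemma L1_loc_inner_integrable:
  fixes \<Gamma> \<Phi> :: "'a::euclidean_space \<Rightarrow> 'a"
  assumes \<Gamma>: "\<Gamma> \<in> L1_loc" and \<Phi>: "\<Phi> \<in> Cc_infty UNIV"
  shows "integrable lebesgue (\<lambda>x. \<Gamma> x \<bullet> \<Phi> x)"
proof -
  obtain B R where B: "0 < B" "\<And>x. norm (\<Phi> x) \<le> B" "\<And>x. norm x > R \<Longrightarrow> \<Phi> x = 0" using Cc_infty_bounded[OF \<Phi>] by metis
  have [measurable]: "\<Gamma> \<in> borel_measurable lebesgue" "\<Phi> \<in> borel_measurable lebesgue"
    using \<Gamma> borel_imp_lebesgue[OF Cc_infty_borel[OF \<Phi>]] by (auto simp: L1_loc_def)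
  have "set_integrable lebesgue (cball 0 R) \<Gamma>" using \<Gamma> by (simp add: L1_loc_def)
  then have i: "integrable lebesgue (\<lambda>x. B * norm (indicator (cball 0 R) x *\<^sub>R \<Gamma> x))"
    unfolding set_integrable_def by (intro integrable_mult_right integrable_norm)
  show ?thesis
  proof (rule Bochner_Integration.integrable_bound[OF i])
    show "AE x in lebesgue. norm (\<Gamma> x \<bullet> \<Phi> x) \<le> norm (B * norm (indicator (cball 0 R) x *\<^sub>R \<Gamma> x))"
    proof (rule AE_I2)
      fix x
      show "norm (\<Gamma> x \<bullet> \<Phi> x) \<le> norm (B * norm (indicator (cball 0 R) x *\<^sub>R \<Gamma> x))"
      proof (cases "norm x \<le> R")
        case True
        have "norm (\<Gamma> x \<bullet> \<Phi> x) \<le> norm (\<Gamma> x) * norm (\<Phi> x)" by (simp add: Cauchy_Schwarz_ineq2)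
        also have "\<dots> \<le> norm (\<Gamma> x) * B" using B by (intro mult_left_mono) auto
        finally show ?thesis using True B by (simp add: mult.commute)
      next
        case False then show ?thesis using B by simp
      qed
    qed
  qed measurable
qed

lemma mult_fdiv_integrable:
  assumes p: "1 < p" and s: "0 < s" "s \<le> 1" and u: "u \<in> Lp p" and \<Phi>: "\<Phi> \<in> Cc_infty UNIV"
  shows "integrable lebesgue (\<lambda>x. u x * fdiv s \<Phi> x)"
proof -
  have q: "1 < p / (p - 1)" using p by (simp add: field_simps)
  have "fdiv s \<Phi> \<in> Lp (p / (p - 1))" by (rule fdiv_Lp[OF q s \<Phi>])
  then show ?thesis using Hoelder_pint[OF p, of "fdiv s \<Phi>"] u by (auto simp: Lp_iff)
qed

text \<open>Testing with the fields \<open>\<phi> b\<close> reduces the uniqueness to the fundamental lemma for each component.\<close>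

lemma is_weak_fgrad_unique:
  fixes \<Gamma> \<Delta> :: "'a::euclidean_space \<Rightarrow> 'a"
  assumes "is_weak_fgrad s u \<Gamma>" "is_weak_fgrad s u \<Delta>"
  shows "AE x in lborel. \<Gamma> x = \<Delta> x"
proof -
  have L: "\<Gamma> \<in> L1_loc" "\<Delta> \<in> L1_loc" using assms by (auto simp: is_weak_fgrad_def)
  have m: "\<Gamma> \<in> borel_measurable lebesgue" "\<Delta> \<in> borel_measurable lebesgue" using L by (auto simp: L1_loc_def)
  obtain g where g [measurable]: "g \<in> borel_measurable borel" and ge: "AE x in lborel. \<Gamma> x = g x"
    using lebesgue_borel_rep[OF m(1)] by metis
  obtain d where d [measurable]: "d \<in> borel_measurable borel" and de: "AE x in lborel. \<Delta> x = d x"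
    using lebesgue_borel_rep[OF m(2)] by metis
  have Z: "AE x in lborel. (g x - d x) \<bullet> b = 0" if b: "b \<in> Basis" for b
  proof (rule AE_zero_of_test_functions_real)
    show "(\<lambda>x. (g x - d x) \<bullet> b) \<in> borel_measurable borel" by measurable
    fix R
    have "integrable lebesgue (\<lambda>x. indicator (cball 0 R) x *\<^sub>R \<Gamma> x - indicator (cball 0 R) x *\<^sub>R \<Delta> x)"
      using L by (intro Bochner_Integration.integrable_diff) (auto simp: L1_loc_def set_integrable_def)
    then have i: "integrable lebesgue (\<lambda>x. (indicator (cball 0 R) x *\<^sub>R \<Gamma> x - indicator (cball 0 R) x *\<^sub>R \<Delta> x) \<bullet> b)"
      by (intro integrable_inner_left)
    have e: "AE x in lborel. (indicator (cball 0 R) x *\<^sub>R \<Gamma> x - indicator (cball 0 R) x *\<^sub>R \<Delta> x) \<bullet> b =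
        indicator (cball 0 R) x * ((g x - d x) \<bullet> b)"
      using ge de by eventually_elim (simp add: inner_diff_left algebra_simps)
    have m1: "(indicator (cball 0 R) :: 'a \<Rightarrow> real) \<in> borel_measurable borel"
      by (rule borel_measurable_indicator) simp
    have m2: "(\<lambda>x. (g x - d x) \<bullet> b) \<in> borel_measurable borel" by measurable
    have m: "(\<lambda>x. indicator (cball 0 R) x * ((g x - d x) \<bullet> b)) \<in> borel_measurable borel"
      by (rule borel_measurable_times[OF m1 m2])
    have "integrable lebesgue (\<lambda>x. indicator (cball 0 R) x * ((g x - d x) \<bullet> b))"
      by (rule integrable_cong_AE_imp[OF i borel_imp_lebesgue[OF m]])
         (use AE_completion[OF e] in \<open>auto elim: eventually_mono\<close>)
    then show "integrable lborel (\<lambda>x. indicator (cball 0 R) x * ((g x - d x) \<bullet> b))"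
      using m by (subst (asm) integrable_completion) auto
  next
    fix \<phi> :: "'a \<Rightarrow> real" assume \<phi>: "\<phi> \<in> Cc_infty UNIV"
    let ?\<Phi> = "\<lambda>x. \<phi> x *\<^sub>R b"
    have \<Phi>: "?\<Phi> \<in> Cc_infty UNIV" by (rule Cc_infty_linear[OF bounded_linear_scaleR_left \<phi>])
    have [measurable]: "\<phi> \<in> borel_measurable borel" by (rule Cc_infty_borel[OF \<phi>])
    have "(LINT x|lebesgue. \<Gamma> x \<bullet> ?\<Phi> x) = (LINT x|lebesgue. \<Delta> x \<bullet> ?\<Phi> x)"
    proof -
      have "(LINT x|lebesgue. u x * fdiv s ?\<Phi> x) = - (LINT x|lebesgue. \<Gamma> x \<bullet> ?\<Phi> x)"
        "(LINT x|lebesgue. u x * fdiv s ?\<Phi> x) = - (LINT x|lebesgue. \<Delta> x \<bullet> ?\<Phi> x)"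
        using assms \<Phi> unfolding is_weak_fgrad_def by blast+
      then show ?thesis by linarith
    qed
    then have "(LINT x|lebesgue. \<Gamma> x \<bullet> ?\<Phi> x - \<Delta> x \<bullet> ?\<Phi> x) = 0"
      using L1_loc_inner_integrable[OF L(1) \<Phi>] L1_loc_inner_integrable[OF L(2) \<Phi>] by simp
    moreover have "(LINT x|lebesgue. \<Gamma> x \<bullet> ?\<Phi> x - \<Delta> x \<bullet> ?\<Phi> x) = (LINT x|lebesgue. (g x - d x) \<bullet> b * \<phi> x)"
    proof (rule integral_cong_AE)
      show "(\<lambda>x. \<Gamma> x \<bullet> ?\<Phi> x - \<Delta> x \<bullet> ?\<Phi> x) \<in> borel_measurable lebesgue"
        using L1_loc_inner_integrable[OF L(1) \<Phi>] L1_loc_inner_integrable[OF L(2) \<Phi>]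
        by (intro borel_measurable_diff) auto
      show "(\<lambda>x. (g x - d x) \<bullet> b * \<phi> x) \<in> borel_measurable lebesgue" by (rule borel_imp_lebesgue) measurable
      have "AE x in lborel. \<Gamma> x \<bullet> ?\<Phi> x - \<Delta> x \<bullet> ?\<Phi> x = (g x - d x) \<bullet> b * \<phi> x"
        using ge de by eventually_elim (simp add: inner_diff_left algebra_simps)
      then show "AE x in lebesgue. \<Gamma> x \<bullet> ?\<Phi> x - \<Delta> x \<bullet> ?\<Phi> x = (g x - d x) \<bullet> b * \<phi> x" by (rule AE_completion)
    qed
    ultimately show "(LINT x|lborel. (g x - d x) \<bullet> b * \<phi> x) = 0"
      by (subst (asm) integral_completion) auto
  qed
  then have "AE x in lborel. \<forall>b\<in>Basis. (g x - d x) \<bullet> b = 0" by (intro AE_finite_allI Z) auto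
  then show ?thesis
    using ge de
  proof eventually_elim
    case (elim x)
    have "g x - d x = 0" by (rule euclidean_eqI) (use elim(1) in auto)
    then show ?case using elim by simp
  qed
qed

lemma is_weak_fgrad_wgrad: "is_weak_fgrad s u \<Gamma> \<Longrightarrow> is_weak_fgrad s u (wgrad s u)"
  unfolding wgrad_def by (rule someI[of "is_weak_fgrad s u"])

lemma wgrad_AE_eq: "is_weak_fgrad s u \<Gamma> \<Longrightarrow> AE x in lborel. wgrad s u x = \<Gamma> x"
  using is_weak_fgrad_unique is_weak_fgrad_wgrad by blast

lemma LamE:
  assumes "u \<in> Lam s p"
  shows "u \<in> Lp p" "wgrad s u \<in> Lp p" "is_weak_fgrad s u (wgrad s u)"
proof -
  obtain \<Gamma> where G: "\<Gamma> \<in> Lp p" "is_weak_fgrad s u \<Gamma>" using assms by (auto simp: Lam_def)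
  show "u \<in> Lp p" using assms by (simp add: Lam_def)
  show "is_weak_fgrad s u (wgrad s u)" by (rule is_weak_fgrad_wgrad[OF G(2)])
  have "AE x in lborel. \<Gamma> x = wgrad s u x" using wgrad_AE_eq[OF G(2)] by eventually_elim simp
  then show "wgrad s u \<in> Lp p" by (rule Lp_cong_AE[OF G(1)])
qed

lemma LamI: "u \<in> Lp p \<Longrightarrow> \<Gamma> \<in> Lp p \<Longrightarrow> is_weak_fgrad s u \<Gamma> \<Longrightarrow> u \<in> Lam s p"
  by (auto simp: Lam_def)

lemma is_weak_fgrad_lincomb:
  assumes p: "1 < p" and s: "0 < s" "s \<le> 1" and u: "u \<in> Lp p" "v \<in> Lp p"
    and G: "\<Gamma> \<in> Lp p" "\<Delta> \<in> Lp p" and w: "is_weak_fgrad s u \<Gamma>" "is_weak_fgrad s v \<Delta>"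
  shows "is_weak_fgrad s (\<lambda>x. c * u x + d * v x) (\<lambda>x. c *\<^sub>R \<Gamma> x + d *\<^sub>R \<Delta> x)"
  unfolding is_weak_fgrad_def
proof (intro conjI ballI)
  show "(\<lambda>x. c *\<^sub>R \<Gamma> x + d *\<^sub>R \<Delta> x) \<in> L1_loc"
    using p by (intro Lp_subset_L1_loc[of _ p] Lp_lincomb G) auto
  fix \<Phi> :: "'a \<Rightarrow> 'a" assume \<Phi>: "\<Phi> \<in> Cc_infty UNIV"
  note i = mult_fdiv_integrable[OF p s u(1) \<Phi>] mult_fdiv_integrable[OF p s u(2) \<Phi>]
    L1_loc_inner_integrable[OF Lp_subset_L1_loc[OF G(1)] \<Phi>] L1_loc_inner_integrable[OF Lp_subset_L1_loc[OF G(2)] \<Phi>]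
  have "(LINT x|lebesgue. (c * u x + d * v x) * fdiv s \<Phi> x) =
      (LINT x|lebesgue. c * (u x * fdiv s \<Phi> x) + d * (v x * fdiv s \<Phi> x))"
    by (simp add: algebra_simps)
  also have "\<dots> = c * (LINT x|lebesgue. u x * fdiv s \<Phi> x) + d * (LINT x|lebesgue. v x * fdiv s \<Phi> x)"
    using i by simp
  also have "\<dots> = - (c * (LINT x|lebesgue. \<Gamma> x \<bullet> \<Phi> x) + d * (LINT x|lebesgue. \<Delta> x \<bullet> \<Phi> x))"
    using w \<Phi> by (simp add: is_weak_fgrad_def)
  also have "\<dots> = - (LINT x|lebesgue. c * (\<Gamma> x \<bullet> \<Phi> x) + d * (\<Delta> x \<bullet> \<Phi> x))" using i p by simp
  finally show "(LINT x|lebesgue. (c * u x + d * v x) * fdiv s \<Phi> x) = - (LINT x|lebesgue. (c *\<^sub>R \<Gamma> x + d *\<^sub>R \<Delta> x) \<bullet> \<Phi> x)"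
    by (simp add: inner_add_left)
qed

lemma is_weak_fgrad_test:
  fixes \<phi> :: "'a::euclidean_space \<Rightarrow> real"
  assumes s: "0 < s" "s \<le> 1" and \<phi>: "\<phi> \<in> Cc_infty UNIV"
  shows "is_weak_fgrad s \<phi> (flow_grad ((1 - s) / 2) \<phi>)"
proof -
  define k where "k = (1 - s) / 2"
  have k: "0 \<le> k" "k < 1 / 2" using s by (auto simp: k_def)
  show ?thesis unfolding is_weak_fgrad_def k_def[symmetric]
  proof (intro conjI ballI)
    show "flow_grad k \<phi> \<in> L1_loc" by (rule Lp_subset_L1_loc[OF flow_grad_Lp[of 2]]) (use k \<phi> in auto)
    fix \<Phi> :: "'a \<Rightarrow> 'a" assume \<Phi>: "\<Phi> \<in> Cc_infty UNIV"
    have int: "integrable lborel (\<lambda>x. \<psi> x * (b \<bullet> flow_grad k \<eta> x))"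
      if \<psi>: "\<psi> \<in> Cc_infty UNIV" and \<eta>: "\<eta> \<in> Cc_infty UNIV" and b: "b \<in> Basis" for \<psi> \<eta> :: "'a \<Rightarrow> real" and b
    proof -
      interpret test_function \<eta> by unfold_locales (rule \<eta>)
      obtain B where B: "0 < B" "\<And>x. norm (flow_grad k \<eta> x) \<le> B" using flow_grad_bounded[OF k] by metis
      have [measurable]: "\<psi> \<in> borel_measurable borel" by (rule Cc_infty_borel[OF \<psi>])
      show ?thesis
      proof (rule Bochner_Integration.integrable_bound)
        show "integrable lborel (\<lambda>x. B * norm (\<psi> x))"
          using Cc_infty_integrable[OF \<psi>] by (intro integrable_mult_right integrable_norm)
        show "AE x in lborel. norm (\<psi> x * (b \<bullet> flow_grad k \<eta> x)) \<le> norm (B * norm (\<psi> x))"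
        proof (rule AE_I2)
          fix x
          have "\<bar>b \<bullet> flow_grad k \<eta> x\<bar> \<le> B" using Basis_le_norm[OF b, of "flow_grad k \<eta> x"] B(2)[of x] by (simp add: inner_commute)
          then have "\<bar>b \<bullet> flow_grad k \<eta> x\<bar> * \<bar>\<psi> x\<bar> \<le> B * \<bar>\<psi> x\<bar>" by (rule mult_right_mono) auto
          then show "norm (\<psi> x * (b \<bullet> flow_grad k \<eta> x)) \<le> norm (B * norm (\<psi> x))" using B(1) by (simp add: abs_mult mult.commute)
        qed
      qed measurable
    qed
    have \<Phi>b: "(\<lambda>y. \<Phi> y \<bullet> b) \<in> Cc_infty UNIV" for b by (rule Cc_infty_inner[OF \<Phi>])
    have [measurable]: "\<phi> \<in> borel_measurable borel" "\<Phi> \<in> borel_measurable borel" "flow_grad k \<phi> \<in> borel_measurable borel"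
      "\<And>b. flow_grad k (\<lambda>y. \<Phi> y \<bullet> b) \<in> borel_measurable borel"
      using Cc_infty_borel[OF \<phi>] Cc_infty_borel[OF \<Phi>] flow_grad_borel[OF \<phi>] flow_grad_borel[OF \<Phi>b] by auto
    have "(LINT x|lebesgue. \<phi> x * fdiv s \<Phi> x) = (LINT x|lebesgue. (\<Sum>b\<in>Basis. \<phi> x * (b \<bullet> flow_grad k (\<lambda>y. \<Phi> y \<bullet> b) x)))"
      by (simp add: fdiv_eq[OF s \<Phi>] k_def sum_distrib_left inner_commute)
    also have "\<dots> = (LINT x|lborel. (\<Sum>b\<in>Basis. \<phi> x * (b \<bullet> flow_grad k (\<lambda>y. \<Phi> y \<bullet> b) x)))"
      by (rule integral_completion) measurable
    also have "\<dots> = (\<Sum>b\<in>Basis. LINT x|lborel. \<phi> x * (b \<bullet> flow_grad k (\<lambda>y. \<Phi> y \<bullet> b) x))"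
      by (rule Bochner_Integration.integral_sum) (rule int[OF \<phi> \<Phi>b])
    also have "\<dots> = (\<Sum>b\<in>Basis. - (LINT x|lborel. (\<Phi> x \<bullet> b) * (b \<bullet> flow_grad k \<phi> x)))"
      by (intro sum.cong refl flow_grad_antisymmetric[OF k \<Phi>b \<phi>])
    also have "\<dots> = - (LINT x|lborel. (\<Sum>b\<in>Basis. (\<Phi> x \<bullet> b) * (b \<bullet> flow_grad k \<phi> x)))"
      by (subst Bochner_Integration.integral_sum) (auto intro: int[OF \<Phi>b \<phi>] simp: sum_negf)
    also have "(LINT x|lborel. (\<Sum>b\<in>Basis. (\<Phi> x \<bullet> b) * (b \<bullet> flow_grad k \<phi> x))) = (LINT x|lborel. flow_grad k \<phi> x \<bullet> \<Phi> x)"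
      by (intro Bochner_Integration.integral_cong refl)
         (subst euclidean_inner, simp add: inner_commute mult.commute)
    also have "\<dots> = (LINT x|lebesgue. flow_grad k \<phi> x \<bullet> \<Phi> x)"
      by (rule integral_completion[symmetric]) measurable
    finally show "(LINT x|lebesgue. \<phi> x * fdiv s \<Phi> x) = - (LINT x|lebesgue. flow_grad k \<phi> x \<bullet> \<Phi> x)" .
  qed
qed

text \<open>Both sides of the identity that defines the weak gradient are continuous in \<open>L\<^sup>p\<close>, because the
  fractional divergence of a test field lies in the dual exponent class.\<close>

lemma is_weak_fgrad_closed:
  fixes u :: "'a::euclidean_space \<Rightarrow> real"
  assumes p: "1 < p" and s: "0 < s" "s \<le> 1" and u: "u \<in> Lp p" and G: "\<Gamma> \<in> Lp p"
    and approx: "\<And>\<epsilon>. 0 < \<epsilon> \<Longrightarrow> \<exists>v\<in>Lp p. \<exists>\<Delta>\<in>Lp p. is_weak_fgrad s v \<Delta> \<and>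
      pint p (\<lambda>x. u x - v x) \<le> ennreal \<epsilon> \<and> pint p (\<lambda>x. \<Gamma> x - \<Delta> x) \<le> ennreal \<epsilon>"
  shows "is_weak_fgrad s u \<Gamma>"
  unfolding is_weak_fgrad_def
proof (intro conjI ballI)
  show "\<Gamma> \<in> L1_loc" using p by (intro Lp_subset_L1_loc[OF G]) auto
  fix \<Phi> :: "'a \<Rightarrow> 'a" assume \<Phi>: "\<Phi> \<in> Cc_infty UNIV"
  define q where "q = p / (p - 1)"
  have q: "1 < q" using p by (simp add: q_def field_simps)
  have fd: "fdiv s \<Phi> \<in> Lp q" by (rule fdiv_Lp[OF q s \<Phi>])
  have fd': "fdiv s \<Phi> \<in> borel_measurable lebesgue" "pint (p / (p - 1)) (fdiv s \<Phi>) < \<infinity>"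
    using fd by (auto simp: Lp_iff q_def)
  obtain K where K0: "0 \<le> K" and K1: "\<forall>u\<in>Lp p. integrable lebesgue (\<lambda>x. u x * fdiv s \<Phi> x) \<and>
      (LINT x|lebesgue. \<bar>u x * fdiv s \<Phi> x\<bar>) \<le> K * enn2real (pint p u) powr (1 / p)"
    using Hoelder_pint[OF p fd'] by (elim exE conjE)
  have Ph: "(\<lambda>x. norm (\<Phi> x)) \<in> borel_measurable lebesgue" "pint (p / (p - 1)) (\<lambda>x. norm (\<Phi> x)) < \<infinity>"
    using Cc_infty_Lp[OF _ \<Phi>, of q] q by (auto simp: Lp_iff pint_def q_def)
  obtain K' where K0': "0 \<le> K'" and K1': "\<forall>u\<in>Lp p. integrable lebesgue (\<lambda>x. u x * norm (\<Phi> x)) \<and>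
      (LINT x|lebesgue. \<bar>u x * norm (\<Phi> x)\<bar>) \<le> K' * enn2real (pint p u) powr (1 / p)"
    using Hoelder_pint[OF p Ph] by (elim exE conjE)
  note K = K0 bspec[OF K1, THEN conjunct2] and K' = K0' bspec[OF K1']
  define E where "E = \<bar>(LINT x|lebesgue. u x * fdiv s \<Phi> x) + (LINT x|lebesgue. \<Gamma> x \<bullet> \<Phi> x)\<bar>"
  have bound: "E \<le> (K + K') * e powr (1 / p)" if e: "0 < e" for e
  proof -
    obtain v \<Delta> where v: "v \<in> Lp p" "\<Delta> \<in> Lp p" "is_weak_fgrad s v \<Delta>"
        "pint p (\<lambda>x. u x - v x) \<le> ennreal e" "pint p (\<lambda>x. \<Gamma> x - \<Delta> x) \<le> ennreal e"
      using approx[OF e] by blast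
    have uv: "(\<lambda>x. u x - v x) \<in> Lp p" and GD: "(\<lambda>x. \<Gamma> x - \<Delta> x) \<in> Lp p"
      using p by (auto intro!: Lp_diff u v G)
    have nGD: "(\<lambda>x. norm (\<Gamma> x - \<Delta> x)) \<in> Lp p" "pint p (\<lambda>x. norm (\<Gamma> x - \<Delta> x)) = pint p (\<lambda>x. \<Gamma> x - \<Delta> x)"
      using GD by (auto simp: Lp_iff pint_def)
    have le: "enn2real X powr (1 / p) \<le> e powr (1 / p)" if "X \<le> ennreal e" for X
      using that e p enn2real_mono[OF that] by (intro powr_mono2) auto
    note i = mult_fdiv_integrable[OF p s u \<Phi>] mult_fdiv_integrable[OF p s v(1) \<Phi>]
      L1_loc_inner_integrable[OF Lp_subset_L1_loc[OF G] \<Phi>] L1_loc_inner_integrable[OF Lp_subset_L1_loc[OF v(2)] \<Phi>]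
    have 1: "\<bar>LINT x|lebesgue. (u x - v x) * fdiv s \<Phi> x\<bar> \<le> K * e powr (1 / p)"
    proof -
      have "\<bar>LINT x|lebesgue. (u x - v x) * fdiv s \<Phi> x\<bar> \<le> (LINT x|lebesgue. \<bar>(u x - v x) * fdiv s \<Phi> x\<bar>)"
        by (rule integral_abs_bound)
      also have "\<dots> \<le> K * enn2real (pint p (\<lambda>x. u x - v x)) powr (1 / p)" by (rule K(2)[OF uv])
      also have "\<dots> \<le> K * e powr (1 / p)" by (intro mult_left_mono le v K)
      finally show ?thesis .
    qed
    have 2: "\<bar>LINT x|lebesgue. (\<Gamma> x - \<Delta> x) \<bullet> \<Phi> x\<bar> \<le> K' * e powr (1 / p)"
    proof -
      have "\<bar>LINT x|lebesgue. (\<Gamma> x - \<Delta> x) \<bullet> \<Phi> x\<bar> \<le> (LINT x|lebesgue. \<bar>(\<Gamma> x - \<Delta> x) \<bullet> \<Phi> x\<bar>)"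
        by (rule integral_abs_bound)
      also have "\<dots> \<le> (LINT x|lebesgue. \<bar>norm (\<Gamma> x - \<Delta> x) * norm (\<Phi> x)\<bar>)"
      proof (rule integral_mono)
        show "integrable lebesgue (\<lambda>x. \<bar>(\<Gamma> x - \<Delta> x) \<bullet> \<Phi> x\<bar>)"
          using p by (intro integrable_abs L1_loc_inner_integrable[OF Lp_subset_L1_loc[OF GD] \<Phi>]) auto
        show "integrable lebesgue (\<lambda>x. \<bar>norm (\<Gamma> x - \<Delta> x) * norm (\<Phi> x)\<bar>)"
          using K'(2)[OF nGD(1)] by (intro integrable_abs) auto
      qed (simp add: Cauchy_Schwarz_ineq2)
      also have "\<dots> \<le> K' * enn2real (pint p (\<lambda>x. norm (\<Gamma> x - \<Delta> x))) powr (1 / p)" by (rule K'(2)[OF nGD(1), THEN conjunct2])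
      also have "\<dots> \<le> K' * e powr (1 / p)" unfolding nGD(2) by (intro mult_left_mono le v K')
      finally show ?thesis .
    qed
    have "(LINT x|lebesgue. v x * fdiv s \<Phi> x) = - (LINT x|lebesgue. \<Delta> x \<bullet> \<Phi> x)"
      using v(3) \<Phi> by (simp add: is_weak_fgrad_def)
    moreover have "(LINT x|lebesgue. (u x - v x) * fdiv s \<Phi> x) =
        (LINT x|lebesgue. u x * fdiv s \<Phi> x) - (LINT x|lebesgue. v x * fdiv s \<Phi> x)"
      unfolding left_diff_distrib by (rule Bochner_Integration.integral_diff[OF i(1,2)])
    moreover have "(LINT x|lebesgue. (\<Gamma> x - \<Delta> x) \<bullet> \<Phi> x) =
        (LINT x|lebesgue. \<Gamma> x \<bullet> \<Phi> x) - (LINT x|lebesgue. \<Delta> x \<bullet> \<Phi> x)"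
      unfolding inner_diff_left using p by (intro Bochner_Integration.integral_diff i) auto
    ultimately have "E = \<bar>(LINT x|lebesgue. (u x - v x) * fdiv s \<Phi> x) + (LINT x|lebesgue. (\<Gamma> x - \<Delta> x) \<bullet> \<Phi> x)\<bar>"
      by (simp add: E_def)
    then show ?thesis using 1 2 by (simp add: distrib_right)
  qed
  have "((\<lambda>e. (K + K') * e powr (1 / p)) \<longlongrightarrow> (K + K') * 0 powr (1 / p)) (at_right 0)"
    using p by (intro tendsto_intros) (auto simp: eventually_at_filter)
  then have "((\<lambda>e. (K + K') * e powr (1 / p)) \<longlongrightarrow> 0) (at_right 0)" by simp
  then have "E \<le> 0"
    by (rule tendsto_lowerbound) (auto simp: eventually_at_filter bound)
  then show "(LINT x|lebesgue. u x * fdiv s \<Phi> x) = - (LINT x|lebesgue. \<Gamma> x \<bullet> \<Phi> x)"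
    by (simp add: E_def)
qed

section \<open>Lowering the order in the closure of the test functions\<close>

lemma (in time_measure) heat_avg_diff_AE:
  fixes g h :: "'a::euclidean_space \<Rightarrow> 'b::{banach, second_countable_topology}"
  assumes p: "1 < p" and g: "g \<in> borel_measurable borel" "pint p g < \<infinity>"
    and h: "h \<in> borel_measurable borel" "pint p h < \<infinity>"
    and C: "(\<integral>\<^sup>+r. 1 \<partial>M) \<le> ennreal C" "0 < C"
  shows "AE x in lborel. heat_avg M (\<lambda>x. g x - h x) x = heat_avg M g x - heat_avg M h x"
  using heat_avg_bound(1)[OF p g C] heat_avg_bound(1)[OF p h C]
proof eventually_elim
  case (elim x)
  then show ?case
    unfolding heat_avg_def scaleR_diff_right by (rule Bochner_Integration.integral_diff)
qed

lemma (in time_measure) dheat_avg_diff_AE: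
  fixes u v :: "'a::euclidean_space \<Rightarrow> real"
  assumes p: "1 < p" and u: "u \<in> borel_measurable borel" "pint p u < \<infinity>"
    and v: "v \<in> borel_measurable borel" "pint p v < \<infinity>"
    and C: "(\<integral>\<^sup>+r. ennreal (r powr - (1 / 2)) \<partial>M) \<le> ennreal C" "0 < C"
  shows "AE x in lborel. dheat_avg M (\<lambda>x. u x - v x) x = dheat_avg M u x - dheat_avg M v x"
  using dheat_avg_bound(1)[OF p u C] dheat_avg_bound(1)[OF p v C]
proof eventually_elim
  case (elim x)
  then show ?case
    unfolding dheat_avg_def scaleR_left_diff_distrib by (rule Bochner_Integration.integral_diff)
qed

lemma pint_diff_finite:
  fixes f g :: "'a::euclidean_space \<Rightarrow> 'b::euclidean_space"
  assumes "f \<in> borel_measurable borel" "g \<in> borel_measurable borel" "pint p f < \<infinity>" "pint p g < \<infinity>" "0 \<le> p"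
  shows "pint p (\<lambda>x. f x - g x) < \<infinity>"
  using Lp_diff[of f p g] assms by (auto simp: Lp_iff intro: borel_imp_lebesgue)

text \<open>The formula of \<open>flow_grad_decomposition\<close> depends linearly on the pair of function and gradient, so it is
  continuous on pairs that do not come from test functions.\<close>

lemma lower_order_diff:
  fixes u :: "'a::euclidean_space \<Rightarrow> real"
  assumes p: "1 < p" and a: "0 < a" and b: "0 \<le> b" and ab: "a + b < 1 / 2"
    and D: "(\<integral>\<^sup>+r. 1 \<partial>early a) \<le> ennreal D" "0 < D"
    and C: "(\<integral>\<^sup>+r. ennreal (r powr - (1 / 2)) \<partial>late a b) \<le> ennreal C" "0 < C"
    and u: "u \<in> borel_measurable borel" "pint p u < \<infinity>"
    and g: "g \<in> borel_measurable borel" "pint p g < \<infinity>"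
    and \<phi>: "\<phi> \<in> Cc_infty UNIV"
  shows "pint p (\<lambda>x. (heat_avg (early a) g x + dheat_avg (late a b) u x) - flow_grad (a + b) \<phi> x) \<le>
    ennreal (2 powr p) * (ennreal (D powr p) * pint p (\<lambda>x. g x - flow_grad b \<phi> x) +
      ennreal ((heat_mom TYPE('a) * C) powr p) * pint p (\<lambda>x. u x - \<phi> x))"
proof -
  interpret L: time_measure "early a" by (rule time_measure_early[OF a])
  interpret H: time_measure "late a b" by (rule time_measure_late[OF a b ab])
  interpret test_function \<phi> by unfold_locales (rule \<phi>)
  note [measurable] = u(1) g(1)
  have b2: "b < 1 / 2" using a ab by simp
  have p0: "0 \<le> p" "0 < p" using p by auto
  have F: "pint p (flow_grad b \<phi>) < \<infinity>" by (rule flow_grad_pint_finite[OF p b b2 \<phi>])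
  have P: "pint p \<phi> < \<infinity>" by (rule phi_pint[OF p0(2)])
  have dg: "pint p (\<lambda>x. g x - flow_grad b \<phi> x) < \<infinity>" by (rule pint_diff_finite[OF g(1) borel_flow_grad g(2) F p0(1)])
  have du: "pint p (\<lambda>x. u x - \<phi> x) < \<infinity>" by (rule pint_diff_finite[OF u(1) borel_phi u(2) P p0(1)])
  let ?s = "heat_avg (early a) (\<lambda>x. g x - flow_grad b \<phi> x)" and ?d = "dheat_avg (late a b) (\<lambda>x. u x - \<phi> x)"
  have "AE x in lborel. (heat_avg (early a) g x + dheat_avg (late a b) u x) - flow_grad (a + b) \<phi> x = ?s x + ?d x"
    using L.heat_avg_diff_AE[OF p g borel_flow_grad F D] H.dheat_avg_diff_AE[OF p u borel_phi P C]
    by eventually_elim (simp add: flow_grad_decomposition[OF a b ab])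
  then have "pint p (\<lambda>x. (heat_avg (early a) g x + dheat_avg (late a b) u x) - flow_grad (a + b) \<phi> x) = pint p (\<lambda>x. ?s x + ?d x)"
    by (rule pint_cong_AE)
  also have "\<dots> \<le> ennreal (2 powr p) * (pint p ?s + pint p ?d)"
    by (intro pint_add p0) measurable
  also have "\<dots> \<le> ennreal (2 powr p) * (ennreal (D powr p) * pint p (\<lambda>x. g x - flow_grad b \<phi> x) +
      ennreal ((heat_mom TYPE('a) * C) powr p) * pint p (\<lambda>x. u x - \<phi> x))"
    by (intro mult_left_mono add_mono L.heat_avg_bound(2)[OF p _ dg D] H.dheat_avg_bound(2)[OF p _ du C]) auto
  finally show ?thesis .
qed

lemma Lam_diff_test:
  fixes u \<phi> :: "'a::euclidean_space \<Rightarrow> real"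
  assumes p: "1 < p" and s: "0 < s" "s \<le> 1" and u: "u \<in> Lam s p" and \<phi>: "\<phi> \<in> Cc_infty UNIV"
  shows "(\<lambda>x. u x - \<phi> x) \<in> Lam s p"
    and "AE x in lborel. wgrad s (\<lambda>x. u x - \<phi> x) x = wgrad s u x - flow_grad ((1 - s) / 2) \<phi> x"
proof -
  have k: "0 \<le> (1 - s) / 2" "(1 - s) / 2 < 1 / 2" using s by auto
  have p0: "0 < p" "0 \<le> p" using p by auto
  note L = LamE[OF u]
  have F: "flow_grad ((1 - s) / 2) \<phi> \<in> Lp p" by (rule flow_grad_Lp[OF p k \<phi>])
  have P: "\<phi> \<in> Lp p" by (rule Cc_infty_Lp[OF p0(1) \<phi>])
  have w: "is_weak_fgrad s (\<lambda>x. u x - \<phi> x) (\<lambda>x. wgrad s u x - flow_grad ((1 - s) / 2) \<phi> x)"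
    using is_weak_fgrad_lincomb[OF p s L(1) P L(2) F L(3) is_weak_fgrad_test[OF s \<phi>], of 1 "-1"] by simp
  show "(\<lambda>x. u x - \<phi> x) \<in> Lam s p"
    by (rule LamI[OF Lp_diff[OF L(1) P p0(2)] Lp_diff[OF L(2) F p0(2)] w])
  show "AE x in lborel. wgrad s (\<lambda>x. u x - \<phi> x) x = wgrad s u x - flow_grad ((1 - s) / 2) \<phi> x"
    by (rule wgrad_AE_eq[OF w])
qed

lemma Lam_norm_eq:
  fixes u \<phi> :: "'a::euclidean_space \<Rightarrow> real"
  assumes p: "1 < p" and s: "0 < s" "s \<le> 1" and u: "u \<in> Lam s p" and \<phi>: "\<phi> \<in> Cc_infty UNIV"
  shows "pint p (\<lambda>x. u x - \<phi> x) + pint p (\<lambda>x. wgrad s u x - flow_grad ((1 - s) / 2) \<phi> x) =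
    ennreal (Lam_norm s p (\<lambda>x. u x - \<phi> x) powr p)"
proof -
  have p0: "0 < p" using p by simp
  note D = Lam_diff_test[OF p s u \<phi>]
  note L = LamE[OF D(1)]
  have "Lam_norm s p (\<lambda>x. u x - \<phi> x) powr p =
      Lp_norm p (\<lambda>x. u x - \<phi> x) powr p + Lp_norm p (wgrad s (\<lambda>x. u x - \<phi> x)) powr p"
    using p0 by (simp add: Lam_norm_def powr_powr)
  then have "ennreal (Lam_norm s p (\<lambda>x. u x - \<phi> x) powr p) =
      pint p (\<lambda>x. u x - \<phi> x) + pint p (wgrad s (\<lambda>x. u x - \<phi> x))"
    by (simp add: ennreal_plus Lp_norm_powr[OF L(1) p0, symmetric] Lp_norm_powr[OF L(2) p0, symmetric])
  then show ?thesis using pint_cong_AE[OF D(2), of p] by simp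
qed

text \<open>The gradient of \<open>u - \<phi>\<close> is, up to a null set, the gradient of \<open>u\<close> minus the classical object for
  \<open>\<phi>\<close>; so approximation in the norm of \<open>Lam\<close> is approximation in both components.\<close>

lemma Lam0_iff:
  fixes u :: "'a::euclidean_space \<Rightarrow> real"
  assumes p: "1 < p" and s: "0 < s" "s \<le> 1"
  shows "u \<in> Lam0 s p \<Omega> \<longleftrightarrow> u \<in> Lam s p \<and> (\<forall>\<epsilon>>0. \<exists>\<phi>\<in>Cc_infty \<Omega>.
    pint p (\<lambda>x. u x - \<phi> x) + pint p (\<lambda>x. wgrad s u x - flow_grad ((1 - s) / 2) \<phi> x) < ennreal \<epsilon>)"
proof (cases "u \<in> Lam s p")
  case True
  have p0: "0 < p" using p by simp
  let ?N = "\<lambda>\<phi>. Lam_norm s p (\<lambda>x. u x - \<phi> x)"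
  have e: "pint p (\<lambda>x. u x - \<phi> x) + pint p (\<lambda>x. wgrad s u x - flow_grad ((1 - s) / 2) \<phi> x) < ennreal \<epsilon> \<longleftrightarrow>
      ?N \<phi> powr p < \<epsilon>" if "\<phi> \<in> Cc_infty \<Omega>" "0 < \<epsilon>" for \<phi> \<epsilon>
    using Lam_norm_eq[OF p s True Cc_infty_mono[OF that(1)]] that(2) by (simp add: ennreal_less_iff)
  have N0: "0 \<le> ?N \<phi>" for \<phi> by (simp add: Lam_norm_def)
  have "(\<forall>\<epsilon>>0. \<exists>\<phi>\<in>Cc_infty \<Omega>. ?N \<phi> < \<epsilon>) \<longleftrightarrow> (\<forall>\<epsilon>>0. \<exists>\<phi>\<in>Cc_infty \<Omega>. ?N \<phi> powr p < \<epsilon>)"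
  proof (intro iffI allI impI)
    fix \<epsilon> :: real assume \<epsilon>: "0 < \<epsilon>" and h: "\<forall>\<epsilon>>0. \<exists>\<phi>\<in>Cc_infty \<Omega>. ?N \<phi> < \<epsilon>"
    have "0 < \<epsilon> powr (1 / p)" using \<epsilon> by simp
    with h obtain \<phi> where \<phi>: "\<phi> \<in> Cc_infty \<Omega>" "?N \<phi> < \<epsilon> powr (1 / p)" by blast
    have "?N \<phi> powr p < (\<epsilon> powr (1 / p)) powr p" using N0 \<phi>(2) p0 by (intro powr_less_mono2) auto
    then have "?N \<phi> powr p < \<epsilon>" using \<epsilon> p0 by (simp add: powr_powr)
    then show "\<exists>\<phi>\<in>Cc_infty \<Omega>. ?N \<phi> powr p < \<epsilon>" using \<phi>(1) by blast
  next
    fix \<epsilon> :: real assume \<epsilon>: "0 < \<epsilon>" and h: "\<forall>\<epsilon>>0. \<exists>\<phi>\<in>Cc_infty \<Omega>. ?N \<phi> powr p < \<epsilon>"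
    have "0 < \<epsilon> powr p" using \<epsilon> by simp
    with h obtain \<phi> where \<phi>: "\<phi> \<in> Cc_infty \<Omega>" "?N \<phi> powr p < \<epsilon> powr p" by blast
    have "?N \<phi> < \<epsilon>"
    proof (rule ccontr)
      assume "\<not> ?N \<phi> < \<epsilon>"
      then have "\<epsilon> powr p \<le> ?N \<phi> powr p" using \<epsilon> p0 by (intro powr_mono2) auto
      with \<phi>(2) show False by simp
    qed
    then show "\<exists>\<phi>\<in>Cc_infty \<Omega>. ?N \<phi> < \<epsilon>" using \<phi>(1) by blast
  qed
  then show ?thesis using True e by (simp add: Lam0_def cong: bex_cong)
qed (simp add: Lam0_def)

text \<open>The closure of the test functions at order \<open>\<sigma>\<close> embeds into the one at any lower order \<open>s\<close>,
  and the lower-order gradient is given by the same formula as for test functions.\<close>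

lemma Lam0_lower_order:
  fixes u :: "'a::euclidean_space \<Rightarrow> real"
  assumes p: "1 < p" and s: "0 < s" "s < \<sigma>" "\<sigma> \<le> 1" and u: "u \<in> Lam0 \<sigma> p \<Omega>"
    and u': "u' \<in> borel_measurable borel" "AE x in lborel. u x = u' x"
    and g': "g' \<in> borel_measurable borel" "AE x in lborel. wgrad \<sigma> u x = g' x"
  shows "u \<in> Lam0 s p \<Omega>"
    and "AE x in lborel. wgrad s u x = heat_avg (early ((\<sigma> - s) / 2)) g' x + dheat_avg (late ((\<sigma> - s) / 2) ((1 - \<sigma>) / 2)) u' x"
proof -
  define a where "a = (\<sigma> - s) / 2"
  define b where "b = (1 - \<sigma>) / 2"
  have ab: "0 < a" "0 \<le> b" "a + b < 1 / 2" "a + b = (1 - s) / 2" using s by (auto simp: a_def b_def field_simps)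
  have \<sigma>: "0 < \<sigma>" "s \<le> 1" using s by auto
  have p0: "0 < p" "0 \<le> p" using p by auto
  have uL: "u \<in> Lam \<sigma> p" and ap: "\<And>\<epsilon>. 0 < \<epsilon> \<Longrightarrow> \<exists>\<phi>\<in>Cc_infty \<Omega>.
      pint p (\<lambda>x. u x - \<phi> x) + pint p (\<lambda>x. wgrad \<sigma> u x - flow_grad b \<phi> x) < ennreal \<epsilon>"
    using u unfolding Lam0_iff[OF p \<sigma>(1) s(3)] b_def by auto
  note L = LamE[OF uL]
  have u'p: "pint p u' < \<infinity>" and g'p: "pint p g' < \<infinity>"
    using L pint_cong_AE[OF u'(2), of p] pint_cong_AE[OF g'(2), of p] by (auto simp: Lp_iff)
  interpret Lo: time_measure "early a" by (rule time_measure_early[OF ab(1)])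
  interpret Hi: time_measure "late a b" by (rule time_measure_late[OF ab(1,2,3)])
  define D where "D = 1 / Gamma (a + 1)"
  have D: "(\<integral>\<^sup>+r. 1 \<partial>early a) \<le> ennreal D" "0 < D" using early_mass[OF ab(1)] ab(1) by (simp_all add: D_def)
  obtain C where C: "0 < C" "(\<integral>\<^sup>+r. ennreal (r powr - (1 / 2)) \<partial>late a b) \<le> ennreal C"
    using late_const[OF ab(1,2,3)] by metis
  define E where "E = 2 powr p * (D powr p + (heat_mom TYPE('a) * C) powr p)"
  have E: "0 < E" using D(2) by (auto simp: E_def intro!: mult_pos_pos add_pos_nonneg)
  define \<Gamma> where "\<Gamma> x = heat_avg (early a) g' x + dheat_avg (late a b) u' x" for x
  have \<Gamma>m: "\<Gamma> \<in> borel_measurable borel" unfolding \<Gamma>_def[abs_def] using u'(1) g'(1) by measurable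
  have diff: "pint p (\<lambda>x. \<Gamma> x - flow_grad (a + b) \<phi> x) \<le> ennreal (E * \<epsilon>)"
    if \<phi>: "\<phi> \<in> Cc_infty UNIV" and le: "pint p (\<lambda>x. u x - \<phi> x) \<le> ennreal \<epsilon>" "pint p (\<lambda>x. wgrad \<sigma> u x - flow_grad b \<phi> x) \<le> ennreal \<epsilon>"
      and \<epsilon>: "0 < \<epsilon>" for \<phi> \<epsilon>
  proof -
    have "AE x in lborel. u x - \<phi> x = u' x - \<phi> x" using u'(2) by eventually_elim simp
    from pint_cong_AE[OF this, of p] have 1: "pint p (\<lambda>x. u' x - \<phi> x) \<le> ennreal \<epsilon>" using le(1) by simp
    have "AE x in lborel. wgrad \<sigma> u x - flow_grad b \<phi> x = g' x - flow_grad b \<phi> x" using g'(2) by eventually_elim simp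
    from pint_cong_AE[OF this, of p] have 2: "pint p (\<lambda>x. g' x - flow_grad b \<phi> x) \<le> ennreal \<epsilon>" using le(2) by simp
    have "pint p (\<lambda>x. \<Gamma> x - flow_grad (a + b) \<phi> x) \<le>
      ennreal (2 powr p) * (ennreal (D powr p) * pint p (\<lambda>x. g' x - flow_grad b \<phi> x) +
        ennreal ((heat_mom TYPE('a) * C) powr p) * pint p (\<lambda>x. u' x - \<phi> x))"
      unfolding \<Gamma>_def by (rule lower_order_diff[OF p ab(1,2,3) D C(2,1) u'(1) u'p g'(1) g'p \<phi>])
    also have "\<dots> \<le> ennreal (2 powr p) * (ennreal (D powr p) * ennreal \<epsilon> + ennreal ((heat_mom TYPE('a) * C) powr p) * ennreal \<epsilon>)"
      by (intro mult_left_mono add_mono 1 2) auto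
    also have "\<dots> = ennreal (E * \<epsilon>)"
      using \<epsilon> by (simp add: E_def ennreal_mult[symmetric] ennreal_plus[symmetric] algebra_simps del: ennreal_plus)
    finally show ?thesis .
  qed
  have F: "flow_grad (a + b) \<phi> \<in> Lp p" if "\<phi> \<in> Cc_infty UNIV" for \<phi> :: "'a \<Rightarrow> real"
    using ab by (intro flow_grad_Lp[OF p _ _ that]) auto
  have \<Gamma>L: "\<Gamma> \<in> Lp p"
  proof -
    obtain \<phi> where \<phi>: "\<phi> \<in> Cc_infty \<Omega>"
      "pint p (\<lambda>x. u x - \<phi> x) + pint p (\<lambda>x. wgrad \<sigma> u x - flow_grad b \<phi> x) < ennreal 1" using ap[of 1] by auto
    have \<phi>U: "\<phi> \<in> Cc_infty UNIV" using Cc_infty_mono[OF \<phi>(1)] by simp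
    have "pint p (\<lambda>x. u x - \<phi> x) \<le> ennreal 1" "pint p (\<lambda>x. wgrad \<sigma> u x - flow_grad b \<phi> x) \<le> ennreal 1"
      using \<phi>(2) by (meson add_increasing2 add_increasing le_less_trans less_imp_le order_refl zero_le)+
    from diff[OF \<phi>U this] have "pint p (\<lambda>x. \<Gamma> x - flow_grad (a + b) \<phi> x) < \<infinity>"
      using le_less_trans[of _ "ennreal (E * 1)" \<infinity>] by simp
    then have "(\<lambda>x. \<Gamma> x - flow_grad (a + b) \<phi> x) \<in> Lp p"
      using borel_imp_lebesgue[OF borel_measurable_diff[OF \<Gamma>m flow_grad_borel[OF \<phi>U]]] by (simp add: Lp_iff)
    from Lp_lincomb[OF this F[OF \<phi>U] p0(2), of 1 1] show ?thesis by simp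
  qed
  have w: "is_weak_fgrad s u \<Gamma>"
  proof (rule is_weak_fgrad_closed[OF p s(1) \<sigma>(2) L(1) \<Gamma>L])
    fix \<epsilon> :: real assume \<epsilon>: "0 < \<epsilon>"
    define \<delta> where "\<delta> = min \<epsilon> (\<epsilon> / E)"
    have \<delta>: "0 < \<delta>" "\<delta> \<le> \<epsilon>" "E * \<delta> \<le> \<epsilon>" using \<epsilon> E by (auto simp: \<delta>_def min_def field_simps)
    obtain \<phi> where \<phi>: "\<phi> \<in> Cc_infty \<Omega>"
      "pint p (\<lambda>x. u x - \<phi> x) + pint p (\<lambda>x. wgrad \<sigma> u x - flow_grad b \<phi> x) < ennreal \<delta>" using ap[OF \<delta>(1)] by auto
    have \<phi>U: "\<phi> \<in> Cc_infty UNIV" using Cc_infty_mono[OF \<phi>(1)] by simp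
    have le: "pint p (\<lambda>x. u x - \<phi> x) \<le> ennreal \<delta>" "pint p (\<lambda>x. wgrad \<sigma> u x - flow_grad b \<phi> x) \<le> ennreal \<delta>"
      using \<phi>(2) by (meson add_increasing2 add_increasing le_less_trans less_imp_le order_refl zero_le)+
    show "\<exists>v\<in>Lp p. \<exists>\<Delta>\<in>Lp p. is_weak_fgrad s v \<Delta> \<and> pint p (\<lambda>x. u x - v x) \<le> ennreal \<epsilon> \<and> pint p (\<lambda>x. \<Gamma> x - \<Delta> x) \<le> ennreal \<epsilon>"
    proof (intro bexI conjI)
      show "is_weak_fgrad s \<phi> (flow_grad (a + b) \<phi>)" unfolding ab(4) by (rule is_weak_fgrad_test[OF s(1) \<sigma>(2) \<phi>U])
      show "pint p (\<lambda>x. u x - \<phi> x) \<le> ennreal \<epsilon>" using le(1) \<delta>(2) ennreal_leI order_trans by blast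
      show "pint p (\<lambda>x. \<Gamma> x - flow_grad (a + b) \<phi> x) \<le> ennreal \<epsilon>"
        using diff[OF \<phi>U le \<delta>(1)] \<delta>(3) ennreal_leI order_trans by blast
    qed (use F[OF \<phi>U] Cc_infty_Lp[OF p0(1) \<phi>U] in auto)
  qed
  have we: "AE x in lborel. wgrad s u x = \<Gamma> x" by (rule wgrad_AE_eq[OF w])
  then show "AE x in lborel. wgrad s u x = heat_avg (early ((\<sigma> - s) / 2)) g' x + dheat_avg (late ((\<sigma> - s) / 2) ((1 - \<sigma>) / 2)) u' x"
    by (simp add: \<Gamma>_def a_def b_def)
  have "\<exists>\<phi>\<in>Cc_infty \<Omega>. pint p (\<lambda>x. u x - \<phi> x) + pint p (\<lambda>x. wgrad s u x - flow_grad ((1 - s) / 2) \<phi> x) < ennreal \<epsilon>"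
    if \<epsilon>: "0 < \<epsilon>" for \<epsilon>
  proof -
    define \<delta> where "\<delta> = \<epsilon> / (2 * (1 + E))"
    have "c / (2 * d) * d = c / 2" if "0 < d" for c d :: real using that by simp
    from this[of "1 + E" \<epsilon>] have "\<delta> * (1 + E) = \<epsilon> / 2" using E by (simp only: \<delta>_def)
    then have "\<delta> + E * \<delta> = \<epsilon> / 2" by (simp add: distrib_left mult.commute)
    then have \<delta>: "0 < \<delta>" "\<delta> + E * \<delta> < \<epsilon>" using \<epsilon> E by (simp_all add: \<delta>_def)
    obtain \<phi> where \<phi>: "\<phi> \<in> Cc_infty \<Omega>"
      "pint p (\<lambda>x. u x - \<phi> x) + pint p (\<lambda>x. wgrad \<sigma> u x - flow_grad b \<phi> x) < ennreal \<delta>" using ap[OF \<delta>(1)] by auto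
    have \<phi>U: "\<phi> \<in> Cc_infty UNIV" using Cc_infty_mono[OF \<phi>(1)] by simp
    have le: "pint p (\<lambda>x. u x - \<phi> x) \<le> ennreal \<delta>" "pint p (\<lambda>x. wgrad \<sigma> u x - flow_grad b \<phi> x) \<le> ennreal \<delta>"
      using \<phi>(2) by (meson add_increasing2 add_increasing le_less_trans less_imp_le order_refl zero_le)+
    have "AE x in lborel. wgrad s u x - flow_grad (a + b) \<phi> x = \<Gamma> x - flow_grad (a + b) \<phi> x" using we by eventually_elim simp
    from pint_cong_AE[OF this, of p] have "pint p (\<lambda>x. wgrad s u x - flow_grad (a + b) \<phi> x) \<le> ennreal (E * \<delta>)"
      using diff[OF \<phi>U le \<delta>(1)] by simp
    with le(1) have "pint p (\<lambda>x. u x - \<phi> x) + pint p (\<lambda>x. wgrad s u x - flow_grad (a + b) \<phi> x) \<le> ennreal \<delta> + ennreal (E * \<delta>)"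
      by (rule add_mono)
    also have "\<dots> = ennreal (\<delta> + E * \<delta>)" using \<delta> E by (simp add: ennreal_plus)
    also have "\<dots> < ennreal \<epsilon>" using \<delta> \<epsilon> by (intro ennreal_lessI)
    finally show ?thesis using \<phi>(1) unfolding ab(4) by blast
  qed
  then show "u \<in> Lam0 s p \<Omega>"
    unfolding Lam0_iff[OF p s(1) \<sigma>(2)] using LamI[OF L(1) \<Gamma>L w] by blast
qed

section \<open>Continuity of the gradient in the order from below\<close>

lemma eventually_early_mass_le: "\<forall>\<^sub>F a in at_right (0::real). 1 / Gamma (a + 1) \<le> 2"
  using order_tendstoD(2)[OF inverse_Gamma1_tendsto, of 2] by (auto elim: eventually_mono)

text \<open>The averages have mass at most 2, so their convergence extends from gradients of test functions to
  limits of such gradients.\<close>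

lemma heat_avg_early_minus_id_tendsto:
  fixes g :: "'a::euclidean_space \<Rightarrow> 'a"
  assumes p: "1 < p" and b: "0 \<le> b" "b < 1 / 2" and g: "g \<in> borel_measurable borel" "pint p g < \<infinity>"
    and approx: "\<And>\<epsilon>. 0 < \<epsilon> \<Longrightarrow> \<exists>\<phi>\<in>Cc_infty UNIV. pint p (\<lambda>x. g x - flow_grad b \<phi> x) \<le> ennreal \<epsilon>"
    and \<epsilon>: "0 < \<epsilon>"
  shows "\<forall>\<^sub>F a in at_right 0. pint p (\<lambda>x. heat_avg (early a) g x - g x) \<le> ennreal \<epsilon>"
proof -
  have p0: "0 \<le> p" using p by simp
  define k where "k = (2::real) powr p"
  have k: "0 < k" by (simp add: k_def)
  \<comment> \<open>The approximation error \<open>\<eta>\<close> meets two triangle inequalities with factor \<open>k\<close> and the bound \<open>k + 1\<close> for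
    the average minus the identity; it has to use up half of \<open>\<epsilon>\<close>.\<close>
  define \<eta> where "\<eta> = \<epsilon> / (2 * (k * k * (k + 1)))"
  have \<eta>: "0 < \<eta>" using \<epsilon> k by (auto simp: \<eta>_def intro!: divide_pos_pos mult_pos_pos add_pos_pos)
  obtain \<phi> where \<phi>: "\<phi> \<in> Cc_infty UNIV" "pint p (\<lambda>x. g x - flow_grad b \<phi> x) \<le> ennreal \<eta>"
    using approx[OF \<eta>] by blast
  interpret test_function \<phi> by unfold_locales (rule \<phi>(1))
  have F: "pint p (flow_grad b \<phi>) < \<infinity>" by (rule flow_grad_pint_finite[OF p b \<phi>(1)])
  have d: "pint p (\<lambda>x. g x - flow_grad b \<phi> x) < \<infinity>" by (rule pint_diff_finite[OF g(1) borel_flow_grad g(2) F p0])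
  have "0 < ennreal (\<epsilon> / (2 * k))" using \<epsilon> k by simp
  from order_tendstoD(2)[OF heat_avg_early_tendsto[OF p b \<phi>(1)] this]
  have ev: "\<forall>\<^sub>F a in at_right 0. pint p (\<lambda>x. heat_avg (early a) (flow_grad b \<phi>) x - flow_grad b \<phi> x) < ennreal (\<epsilon> / (2 * k))" .
  have pos: "\<forall>\<^sub>F a in at_right (0::real). 0 < a" by (simp add: eventually_at_filter)
  show ?thesis
    using ev pos eventually_early_mass_le
  proof eventually_elim
    case (elim a)
    interpret L: time_measure "early a" by (rule time_measure_early[OF elim(2)])
    note [measurable] = g(1)
    have D: "(\<integral>\<^sup>+r. 1 \<partial>early a) \<le> ennreal 2" by (simp only: early_mass[OF elim(2)] ennreal_leI[OF elim(3)])
    let ?r = "\<lambda>x. g x - flow_grad b \<phi> x"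
    have "AE x in lborel. heat_avg (early a) g x - g x =
        (heat_avg (early a) ?r x - ?r x) + (heat_avg (early a) (flow_grad b \<phi>) x - flow_grad b \<phi> x)"
      using L.heat_avg_diff_AE[OF p g borel_flow_grad F D zero_less_numeral] by eventually_elim simp
    then have "pint p (\<lambda>x. heat_avg (early a) g x - g x) =
        pint p (\<lambda>x. (heat_avg (early a) ?r x - ?r x) + (heat_avg (early a) (flow_grad b \<phi>) x - flow_grad b \<phi> x))"
      by (rule pint_cong_AE)
    also have "\<dots> \<le> ennreal k * (pint p (\<lambda>x. heat_avg (early a) ?r x - ?r x) + pint p (\<lambda>x. heat_avg (early a) (flow_grad b \<phi>) x - flow_grad b \<phi> x))"
      unfolding k_def by (intro pint_add p0) measurable
    also have "pint p (\<lambda>x. heat_avg (early a) ?r x - ?r x) \<le> ennreal k * (ennreal k * ennreal \<eta> + ennreal \<eta>)"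
    proof -
      have "pint p (\<lambda>x. heat_avg (early a) ?r x + (- 1) *\<^sub>R ?r x) \<le> ennreal k * (pint p (heat_avg (early a) ?r) + pint p (\<lambda>x. (- 1) *\<^sub>R ?r x))"
        unfolding k_def by (intro pint_add p0) measurable
      also have "pint p (\<lambda>x. (- 1) *\<^sub>R ?r x) = pint p ?r" by (simp add: pint_def norm_minus_commute)
      also have "ennreal k * (pint p (heat_avg (early a) ?r) + pint p ?r) \<le> ennreal k * (ennreal k * ennreal \<eta> + ennreal \<eta>)"
      proof (intro mult_left_mono add_mono)
        have "pint p (heat_avg (early a) ?r) \<le> ennreal (2 powr p) * pint p ?r"
          by (rule L.heat_avg_bound(2)[OF p _ d D zero_less_numeral]) auto
        also have "\<dots> \<le> ennreal k * ennreal \<eta>" unfolding k_def by (intro mult_left_mono \<phi>) auto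
        finally show "pint p (heat_avg (early a) ?r) \<le> ennreal k * ennreal \<eta>" .
      qed (use \<phi> in auto)
      finally show ?thesis by (simp only: scaleR_minus1_left diff_conv_add_uminus)
    qed
    also have "pint p (\<lambda>x. heat_avg (early a) (flow_grad b \<phi>) x - flow_grad b \<phi> x) \<le> ennreal (\<epsilon> / (2 * k))" using elim by simp
    finally have "pint p (\<lambda>x. heat_avg (early a) g x - g x) \<le>
        ennreal k * (ennreal k * (ennreal k * ennreal \<eta> + ennreal \<eta>) + ennreal (\<epsilon> / (2 * k)))"
      by (simp add: mult_left_mono add_mono)
    also have "\<dots> = ennreal (k * (k * (k * \<eta> + \<eta>) + \<epsilon> / (2 * k)))"
      using k \<eta> \<epsilon> by (simp add: ennreal_mult[symmetric] ennreal_plus[symmetric] del: ennreal_plus)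
    also have "k * (k * (k * \<eta> + \<eta>) + \<epsilon> / (2 * k)) = (k * k * (k + 1)) * \<eta> + \<epsilon> / 2"
      using k by (simp add: field_simps)
    also have "(k * k * (k + 1)) * \<eta> = \<epsilon> / 2"
    proof -
      have "d * (\<epsilon> / (2 * d)) = \<epsilon> / 2" if "0 < d" for d :: real using that by simp
      from this[of "k * k * (k + 1)"] show ?thesis unfolding \<eta>_def using k by (simp add: mult_pos_pos add_pos_pos)
    qed
    finally show "pint p (\<lambda>x. heat_avg (early a) g x - g x) \<le> ennreal \<epsilon>" by simp
  qed
qed

text \<open>The long-time part is damped by the factor \<open>1 / Gamma a\<close>.\<close>

lemma dheat_avg_late_tendsto:
  fixes u :: "'a::euclidean_space \<Rightarrow> real"
  assumes p: "1 < p" and b: "0 \<le> b" "b < 1 / 2" and u: "u \<in> borel_measurable borel" "pint p u < \<infinity>" and \<epsilon>: "0 < \<epsilon>"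
  shows "\<forall>\<^sub>F a in at_right 0. pint p (dheat_avg (late a b) u) \<le> ennreal \<epsilon>"
proof -
  \<comment> \<open>An exponent that does not depend on \<open>a\<close>; it is admissible for all \<open>a < e\<close>.\<close>
  define e where "e = (1 / 2 - b) / 2"
  have e: "0 < e" "b + e < 1 / 2" "e < 1 / 2" using b by (auto simp: e_def field_simps)
  define d where "d = enn2real (decay_const b e) + 1"
  have d: "0 < d" "decay_const b e \<le> ennreal d"
  proof -
    show "0 < d" by (simp add: d_def add_nonneg_pos)
    have "decay_const b e = ennreal (enn2real (decay_const b e))" using decay_const_finite[OF b(1) e(1,2)] by simp
    also have "\<dots> \<le> ennreal d" by (rule ennreal_leI) (simp add: d_def)
    finally show "decay_const b e \<le> ennreal d" .
  qed
  define U where "U = enn2real (pint p u)"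
  have U: "pint p u = ennreal U" "0 \<le> U" using u(2) by (simp_all add: U_def)
  let ?C = "\<lambda>a. d * ((1 / Gamma a) * (2 / e))"
  let ?B = "\<lambda>a. (heat_mom TYPE('a) * ?C a) powr p * U"
  have pos: "\<forall>\<^sub>F a in at_right (0::real). 0 < a" by (simp add: eventually_at_filter)
  have C0: "\<forall>\<^sub>F a in at_right 0. 0 \<le> heat_mom TYPE('a) * ?C a"
    using pos by eventually_elim (use d e heat_mom_pos[where 'a='a] in \<open>auto intro!: mult_nonneg_nonneg divide_nonneg_nonneg less_imp_le[OF Gamma_real_pos]\<close>)
  have "(?B \<longlongrightarrow> (heat_mom TYPE('a) * (d * (0 * (2 / e)))) powr p * U) (at_right 0)"
    using C0 p by (intro tendsto_intros inverse_Gamma_tendsto) auto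
  then have "(?B \<longlongrightarrow> 0) (at_right 0)" using p by simp
  from order_tendstoD(2)[OF this \<epsilon>] have ev: "\<forall>\<^sub>F a in at_right 0. ?B a < \<epsilon>" .
  have small: "\<forall>\<^sub>F a in at_right (0::real). a < e / 2"
    using e(1) by (intro order_tendstoD(2)[OF tendsto_ident_at]) auto
  show ?thesis
    using ev pos small
  proof eventually_elim
    case (elim a)
    have ab: "a + b < 1 / 2" "a < e" using elim e by auto
    interpret H: time_measure "late a b" by (rule time_measure_late[OF elim(2) b(1) ab(1)])
    have G: "0 < Gamma a" using elim by auto
    have C: "0 < ?C a" using d e G by simp
    have "(\<integral>\<^sup>+r. ennreal (r powr - (1 / 2)) \<partial>late a b) \<le> decay_const b e * ennreal (1 / (Gamma a * (e - a)))"
      by (rule late_bound[OF elim(2) ab(2) b(1) e(3)])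
    also have "\<dots> \<le> ennreal d * ennreal ((1 / Gamma a) * (2 / e))"
    proof (intro mult_mono d ennreal_leI)
      have "1 / (e - a) \<le> 2 / e" using elim e by (simp add: field_simps)
      then have "(1 / Gamma a) * (1 / (e - a)) \<le> (1 / Gamma a) * (2 / e)" using G by (intro mult_left_mono) auto
      then show "1 / (Gamma a * (e - a)) \<le> (1 / Gamma a) * (2 / e)" by simp
    qed auto
    also have "\<dots> = ennreal (?C a)" using d e G by (simp add: ennreal_mult[symmetric])
    finally have le: "(\<integral>\<^sup>+r. ennreal (r powr - (1 / 2)) \<partial>late a b) \<le> ennreal (?C a)" .
    have "pint p (dheat_avg (late a b) u) \<le> ennreal ((heat_mom TYPE('a) * ?C a) powr p) * pint p u"
      by (rule H.dheat_avg_bound(2)[OF p u le C])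
    also have "\<dots> = ennreal (?B a)" using U by (simp add: ennreal_mult[symmetric])
    also have "\<dots> \<le> ennreal \<epsilon>" using elim by (intro ennreal_leI) simp
    finally show ?case .
  qed
qed

text \<open>In the formula of \<open>Lam0_lower_order\<close> the early part is an approximate identity and the late part
  vanishes in the limit.\<close>

lemma wgrad_tendsto_from_below:
  fixes u :: "'a::euclidean_space \<Rightarrow> real"
  assumes p: "1 < p" and \<sigma>: "0 < \<sigma>" "\<sigma> \<le> 1" and u: "u \<in> Lam0 \<sigma> p \<Omega>" and \<epsilon>: "0 < \<epsilon>"
  shows "\<exists>\<delta>>0. \<forall>s. 0 < s \<and> s < \<sigma> \<and> \<sigma> - s < \<delta> \<longrightarrow> pint p (\<lambda>x. wgrad s u x - wgrad \<sigma> u x) \<le> ennreal \<epsilon>"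
proof -
  define b where "b = (1 - \<sigma>) / 2"
  have b: "0 \<le> b" "b < 1 / 2" using \<sigma> by (auto simp: b_def)
  have p0: "0 \<le> p" using p by simp
  have uL: "u \<in> Lam \<sigma> p" and ap: "\<And>\<epsilon>. 0 < \<epsilon> \<Longrightarrow> \<exists>\<phi>\<in>Cc_infty \<Omega>.
      pint p (\<lambda>x. u x - \<phi> x) + pint p (\<lambda>x. wgrad \<sigma> u x - flow_grad b \<phi> x) < ennreal \<epsilon>"
    using u unfolding Lam0_iff[OF p \<sigma>] b_def by auto
  note L = LamE[OF uL]
  obtain u' where u': "u' \<in> borel_measurable borel" "AE x in lborel. u x = u' x"
    using lebesgue_borel_rep[OF Lp_measurable[OF L(1)]] by metis
  obtain g' where g': "g' \<in> borel_measurable borel" "AE x in lborel. wgrad \<sigma> u x = g' x"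
    using lebesgue_borel_rep[OF Lp_measurable[OF L(2)]] by metis
  have u'p: "pint p u' < \<infinity>" and g'p: "pint p g' < \<infinity>"
    using L pint_cong_AE[OF u'(2), of p] pint_cong_AE[OF g'(2), of p] by (auto simp: Lp_iff)
  have ap': "\<exists>\<phi>\<in>Cc_infty UNIV. pint p (\<lambda>x. g' x - flow_grad b \<phi> x) \<le> ennreal \<eta>" if \<eta>: "0 < \<eta>" for \<eta>
  proof -
    obtain \<phi> where \<phi>: "\<phi> \<in> Cc_infty \<Omega>"
      "pint p (\<lambda>x. u x - \<phi> x) + pint p (\<lambda>x. wgrad \<sigma> u x - flow_grad b \<phi> x) < ennreal \<eta>" using ap[OF \<eta>] by auto
    have "pint p (\<lambda>x. wgrad \<sigma> u x - flow_grad b \<phi> x) \<le> ennreal \<eta>"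
      using \<phi>(2) by (meson add_increasing le_less_trans less_imp_le order_refl zero_le)
    moreover have "AE x in lborel. wgrad \<sigma> u x - flow_grad b \<phi> x = g' x - flow_grad b \<phi> x" using g'(2) by eventually_elim simp
    ultimately have "pint p (\<lambda>x. g' x - flow_grad b \<phi> x) \<le> ennreal \<eta>" using pint_cong_AE by metis
    then show ?thesis using Cc_infty_mono[OF \<phi>(1)] by blast
  qed
  define k where "k = (2::real) powr p"
  have k: "0 < k" by (simp add: k_def)
  have \<epsilon>k: "0 < \<epsilon> / (2 * k)" using \<epsilon> k by simp
  have "\<forall>\<^sub>F a in at_right 0. pint p (\<lambda>x. heat_avg (early a) g' x - g' x) \<le> ennreal (\<epsilon> / (2 * k)) \<and>
      pint p (dheat_avg (late a b) u') \<le> ennreal (\<epsilon> / (2 * k))"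
    by (intro eventually_conj heat_avg_early_minus_id_tendsto[OF p b g'(1) g'p ap' \<epsilon>k] dheat_avg_late_tendsto[OF p b u'(1) u'p \<epsilon>k])
  then obtain c where c: "0 < c" "\<And>a. 0 < a \<Longrightarrow> a < c \<Longrightarrow> pint p (\<lambda>x. heat_avg (early a) g' x - g' x) \<le> ennreal (\<epsilon> / (2 * k)) \<and>
      pint p (dheat_avg (late a b) u') \<le> ennreal (\<epsilon> / (2 * k))"
    unfolding eventually_at_right_field by auto
  show ?thesis
  proof (intro exI[of _ "2 * c"] conjI allI impI)
    fix s assume s: "0 < s \<and> s < \<sigma> \<and> \<sigma> - s < 2 * c"
    define a where "a = (\<sigma> - s) / 2"
    have a: "0 < a" "a < c" "a + b < 1 / 2" using s by (auto simp: a_def b_def field_simps)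
    interpret Lo: time_measure "early a" by (rule time_measure_early[OF a(1)])
    interpret Hi: time_measure "late a b" by (rule time_measure_late[OF a(1) b(1) a(3)])
    note [measurable] = u'(1) g'(1)
    have "AE x in lborel. wgrad s u x = heat_avg (early a) g' x + dheat_avg (late a b) u' x"
      unfolding a_def b_def using s by (intro Lam0_lower_order(2)[OF p _ _ \<sigma>(2) u u' g']) auto
    then have "AE x in lborel. wgrad s u x - wgrad \<sigma> u x = (heat_avg (early a) g' x - g' x) + dheat_avg (late a b) u' x"
      using g'(2) by eventually_elim simp
    then have "pint p (\<lambda>x. wgrad s u x - wgrad \<sigma> u x) = pint p (\<lambda>x. (heat_avg (early a) g' x - g' x) + dheat_avg (late a b) u' x)"
      by (rule pint_cong_AE)
    also have "\<dots> \<le> ennreal k * (pint p (\<lambda>x. heat_avg (early a) g' x - g' x) + pint p (dheat_avg (late a b) u'))"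
      unfolding k_def by (intro pint_add p0) measurable
    also have "\<dots> \<le> ennreal k * (ennreal (\<epsilon> / (2 * k)) + ennreal (\<epsilon> / (2 * k)))"
      using c(2)[OF a(1,2)] by (intro mult_left_mono add_mono) auto
    also have "\<dots> = ennreal \<epsilon>"
      using k \<epsilon> by (simp add: ennreal_mult[symmetric] ennreal_plus[symmetric] del: ennreal_plus)
    finally show "pint p (\<lambda>x. wgrad s u x - wgrad \<sigma> u x) \<le> ennreal \<epsilon>" .
  qed (use c in auto)
qed

section \<open>Mosco convergence of the obstacle sets\<close>

lemma Lam0_convex:
  fixes u v :: "'a::euclidean_space \<Rightarrow> real"
  assumes p: "1 < p" and s: "0 < s" "s \<le> 1" and u: "u \<in> Lam0 s p \<Omega>" and v: "v \<in> Lam0 s p \<Omega>"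
    and t: "0 \<le> t" "t \<le> 1"
  shows "(\<lambda>x. (1 - t) * u x + t * v x) \<in> Lam0 s p \<Omega>"
proof -
  let ?k = "(1 - s) / 2"
  have k: "0 \<le> ?k" "?k < 1 / 2" using s by auto
  have p0: "0 \<le> p" "0 < p" using p by auto
  have uL: "u \<in> Lam s p" "\<And>\<epsilon>. 0 < \<epsilon> \<Longrightarrow> \<exists>\<phi>\<in>Cc_infty \<Omega>.
      pint p (\<lambda>x. u x - \<phi> x) + pint p (\<lambda>x. wgrad s u x - flow_grad ?k \<phi> x) < ennreal \<epsilon>"
    using u unfolding Lam0_iff[OF p s] by auto
  have vL: "v \<in> Lam s p" "\<And>\<epsilon>. 0 < \<epsilon> \<Longrightarrow> \<exists>\<phi>\<in>Cc_infty \<Omega>.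
      pint p (\<lambda>x. v x - \<phi> x) + pint p (\<lambda>x. wgrad s v x - flow_grad ?k \<phi> x) < ennreal \<epsilon>"
    using v unfolding Lam0_iff[OF p s] by auto
  note U = LamE[OF uL(1)] and V = LamE[OF vL(1)]
  let ?w = "\<lambda>x. (1 - t) * u x + t * v x" and ?G = "\<lambda>x. (1 - t) *\<^sub>R wgrad s u x + t *\<^sub>R wgrad s v x"
  have w: "is_weak_fgrad s ?w ?G" by (rule is_weak_fgrad_lincomb[OF p s U(1) V(1) U(2) V(2) U(3) V(3)])
  have wL: "?w \<in> Lam s p"
    using LamI[OF _ Lp_lincomb[OF U(2) V(2) p0(1)] w] Lp_lincomb[OF U(1) V(1) p0(1), of "1 - t" t] by simp
  have bound: "pint p (\<lambda>x. (1 - t) *\<^sub>R f x + t *\<^sub>R g x) \<le> ennreal (2 powr p) * (pint p f + pint p g)"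
    if "f \<in> Lp p" "g \<in> Lp p" for f g :: "'a \<Rightarrow> 'c::euclidean_space"
  proof -
    have "pint p (\<lambda>x. (1 - t) *\<^sub>R f x + t *\<^sub>R g x) \<le> ennreal (2 powr p) * (ennreal (\<bar>1 - t\<bar> powr p) * pint p f + ennreal (\<bar>t\<bar> powr p) * pint p g)"
      using that by (intro pint_lincomb p0) (auto simp: Lp_iff)
    also have "\<dots> \<le> ennreal (2 powr p) * (1 * pint p f + 1 * pint p g)"
    proof (intro mult_left_mono add_mono mult_right_mono)
      show "ennreal (\<bar>1 - t\<bar> powr p) \<le> 1" "ennreal (\<bar>t\<bar> powr p) \<le> 1"
        using t p0 powr_mono2[of p "\<bar>1 - t\<bar>" 1] powr_mono2[of p "\<bar>t\<bar>" 1] by auto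
    qed auto
    finally show ?thesis by simp
  qed
  have "\<exists>\<phi>\<in>Cc_infty \<Omega>. pint p (\<lambda>x. ?w x - \<phi> x) + pint p (\<lambda>x. wgrad s ?w x - flow_grad ?k \<phi> x) < ennreal \<epsilon>"
    if \<epsilon>: "0 < \<epsilon>" for \<epsilon>
  proof -
    define \<delta> where "\<delta> = \<epsilon> / (2 * 2 powr p)"
    have \<delta>: "0 < \<delta>" using \<epsilon> by (simp add: \<delta>_def)
    obtain \<phi> where \<phi>: "\<phi> \<in> Cc_infty \<Omega>"
      "pint p (\<lambda>x. u x - \<phi> x) + pint p (\<lambda>x. wgrad s u x - flow_grad ?k \<phi> x) < ennreal \<delta>" using uL(2)[OF \<delta>] by auto
    obtain \<psi> where \<psi>: "\<psi> \<in> Cc_infty \<Omega>"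
      "pint p (\<lambda>x. v x - \<psi> x) + pint p (\<lambda>x. wgrad s v x - flow_grad ?k \<psi> x) < ennreal \<delta>" using vL(2)[OF \<delta>] by auto
    have \<phi>U: "\<phi> \<in> Cc_infty UNIV" and \<psi>U: "\<psi> \<in> Cc_infty UNIV"
      using Cc_infty_mono[OF \<phi>(1)] Cc_infty_mono[OF \<psi>(1)] by auto
    let ?\<chi> = "\<lambda>x. (1 - t) * \<phi> x + t * \<psi> x"
    have l1: "(\<lambda>x. u x - \<phi> x) \<in> Lp p" "(\<lambda>x. v x - \<psi> x) \<in> Lp p"
      by (intro Lp_diff U V Cc_infty_Lp[OF p0(2) \<phi>U] Cc_infty_Lp[OF p0(2) \<psi>U] p0)+
    have l2: "(\<lambda>x. wgrad s u x - flow_grad ?k \<phi> x) \<in> Lp p" "(\<lambda>x. wgrad s v x - flow_grad ?k \<psi> x) \<in> Lp p"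
      by (intro Lp_diff U V flow_grad_Lp[OF p k] \<phi>U \<psi>U p0)+
    have "(\<lambda>x. ?w x - ?\<chi> x) = (\<lambda>x. (1 - t) *\<^sub>R (u x - \<phi> x) + t *\<^sub>R (v x - \<psi> x))"
      by (simp add: fun_eq_iff algebra_simps)
    then have 1: "pint p (\<lambda>x. ?w x - ?\<chi> x) \<le> ennreal (2 powr p) * (pint p (\<lambda>x. u x - \<phi> x) + pint p (\<lambda>x. v x - \<psi> x))"
      using bound[OF l1] by simp
    have "AE x in lborel. wgrad s ?w x - flow_grad ?k ?\<chi> x = (1 - t) *\<^sub>R (wgrad s u x - flow_grad ?k \<phi> x) + t *\<^sub>R (wgrad s v x - flow_grad ?k \<psi> x)"
      using wgrad_AE_eq[OF w] by eventually_elim (simp only: flow_grad_lincomb[OF k \<phi>U \<psi>U] scaleR_diff_right add_diff_add)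
    from pint_cong_AE[OF this, of p]
    have 2: "pint p (\<lambda>x. wgrad s ?w x - flow_grad ?k ?\<chi> x) \<le>
        ennreal (2 powr p) * (pint p (\<lambda>x. wgrad s u x - flow_grad ?k \<phi> x) + pint p (\<lambda>x. wgrad s v x - flow_grad ?k \<psi> x))"
      using bound[OF l2] by simp
    let ?A = "pint p (\<lambda>x. u x - \<phi> x) + pint p (\<lambda>x. wgrad s u x - flow_grad ?k \<phi> x)"
    let ?B = "pint p (\<lambda>x. v x - \<psi> x) + pint p (\<lambda>x. wgrad s v x - flow_grad ?k \<psi> x)"
    have "?A + ?B < ennreal \<delta> + ennreal \<delta>" using \<phi>(2) \<psi>(2) by (rule add_strict_mono)
    then have AB: "ennreal (2 powr p) * (?A + ?B) < ennreal (2 powr p) * (ennreal \<delta> + ennreal \<delta>)"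
      by (intro ennreal_mult_strict_left_mono) auto
    have "pint p (\<lambda>x. ?w x - ?\<chi> x) + pint p (\<lambda>x. wgrad s ?w x - flow_grad ?k ?\<chi> x) \<le> ennreal (2 powr p) * (?A + ?B)"
      using add_mono[OF 1 2] by (simp add: algebra_simps)
    also note AB
    also have "ennreal (2 powr p) * (ennreal \<delta> + ennreal \<delta>) = ennreal \<epsilon>"
      using \<delta> by (simp add: ennreal_mult[symmetric] ennreal_plus[symmetric] \<delta>_def del: ennreal_plus)
    finally show ?thesis by (intro bexI[of _ ?\<chi>] Cc_infty_lincomb[OF \<phi>(1) \<psi>(1)])
  qed
  then show ?thesis unfolding Lam0_iff[OF p s] using wL by blast
qed

lemma obstacle_set_convex:
  fixes \<psi> :: "'a::euclidean_space \<Rightarrow> real"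
  assumes p: "1 < p" and s: "0 < s" "s \<le> 1"
  shows "convex_fun_set (obstacle_set s p \<Omega> \<psi>)"
  unfolding convex_fun_set_def
proof (intro ballI allI impI)
  fix u v :: "'a \<Rightarrow> real" and t :: real
  assume u: "u \<in> obstacle_set s p \<Omega> \<psi>" and v: "v \<in> obstacle_set s p \<Omega> \<psi>" and t: "0 \<le> t \<and> t \<le> 1"
  have "AE x in lebesgue. u x \<ge> \<psi> x" "AE x in lebesgue. v x \<ge> \<psi> x" using u v by (auto simp: obstacle_set_def)
  then have "AE x in lebesgue. (1 - t) * u x + t * v x \<ge> \<psi> x"
  proof eventually_elim
    case (elim x)
    have "(1 - t) * \<psi> x + t * \<psi> x \<le> (1 - t) * u x + t * v x"
      using elim t by (intro add_mono mult_left_mono) auto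
    then show ?case by (simp add: algebra_simps)
  qed
  then show "(\<lambda>x. (1 - t) * u x + t * v x) \<in> obstacle_set s p \<Omega> \<psi>"
    using Lam0_convex[OF p s, of u \<Omega> v t] u v t by (auto simp: obstacle_set_def)
qed

lemma Lam0_Lp: "u \<in> Lam0 s p \<Omega> \<Longrightarrow> u \<in> Lp p" "u \<in> Lam0 s p \<Omega> \<Longrightarrow> wgrad s u \<in> Lp p"
  using LamE[of u s p] by (auto simp: Lam0_def)

text \<open>These functionals detect the sign of the first component; Hoelder's inequality makes them bounded.\<close>

lemma LL_dual_integral:
  fixes E :: "'a::euclidean_space set"
  assumes p: "1 < p" and E: "E \<in> lmeasurable"
  shows "(\<lambda>X. LINT x|lebesgue. fst X x * indicator E x) \<in> LL_dual p \<Omega>"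
    and "\<And>u::'a \<Rightarrow> real. u \<in> Lp p \<Longrightarrow> integrable lebesgue (\<lambda>x. u x * indicator E x)"
proof -
  have Em: "E \<in> sets lebesgue" using E by (simp add: fmeasurableD)
  have m: "indicator E \<in> borel_measurable lebesgue" using Em by (rule borel_measurable_indicator)
  have "pint (p / (p - 1)) (indicator E :: 'a \<Rightarrow> real) < \<infinity>"
  proof -
    have "pint (p / (p - 1)) (indicator E :: 'a \<Rightarrow> real) = (\<integral>\<^sup>+x. indicator E x \<partial>lebesgue)"
      unfolding pint_lebesgue[symmetric] using p by (intro nn_integral_cong) (auto simp: indicator_def)
    also have "\<dots> = emeasure lebesgue E" using Em by (rule nn_integral_indicator)
    also have "\<dots> < \<infinity>" using E by (simp only: fmeasurable_def mem_Collect_eq)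
    finally show ?thesis .
  qed
  from Hoelder_pint[OF p m this] obtain K where K0: "0 \<le> K" and K1: "\<forall>u\<in>Lp p. integrable lebesgue (\<lambda>x. u x * indicator E x) \<and>
     (LINT x|lebesgue. \<bar>u x * indicator E x\<bar>) \<le> K * enn2real (pint p u) powr (1 / p)"
    by (elim exE conjE)
  note i = bspec[OF K1, THEN conjunct1] and b = bspec[OF K1, THEN conjunct2]
  show "\<And>u::'a \<Rightarrow> real. u \<in> Lp p \<Longrightarrow> integrable lebesgue (\<lambda>x. u x * indicator E x)" by (rule i)
  have LLp: "fst X \<in> Lp p" "snd X \<in> Lp p" if "X \<in> LL p \<Omega>" for X
    using that by (auto simp: LL_def Lp0_def)
  show "(\<lambda>X. LINT x|lebesgue. fst X x * indicator E x) \<in> LL_dual p \<Omega>"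
    unfolding LL_dual_def
  proof (intro CollectI conjI ballI allI)
    fix X Y :: "'a LL_elem" and c d :: real assume X: "X \<in> LL p \<Omega>" and Y: "Y \<in> LL p \<Omega>"
    have "(LINT x|lebesgue. fst (LL_lin c X d Y) x * indicator E x) =
        (LINT x|lebesgue. c * (fst X x * indicator E x) + d * (fst Y x * indicator E x))"
      by (simp add: LL_lin_def algebra_simps)
    also have "\<dots> = c * (LINT x|lebesgue. fst X x * indicator E x) + d * (LINT x|lebesgue. fst Y x * indicator E x)"
      using i[OF LLp(1)[OF X]] i[OF LLp(1)[OF Y]] by simp
    finally show "(LINT x|lebesgue. fst (LL_lin c X d Y) x * indicator E x) =
        c * (LINT x|lebesgue. fst X x * indicator E x) + d * (LINT x|lebesgue. fst Y x * indicator E x)" .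
  next
    show "\<exists>C. \<forall>X\<in>LL p \<Omega>. \<bar>LINT x|lebesgue. fst X x * indicator E x\<bar> \<le> C * LL_norm p X"
    proof (intro exI[of _ K] ballI)
      fix X :: "'a LL_elem" assume X: "X \<in> LL p \<Omega>"
      have "\<bar>LINT x|lebesgue. fst X x * indicator E x\<bar> \<le> (LINT x|lebesgue. \<bar>fst X x * indicator E x\<bar>)"
        by (rule integral_abs_bound)
      also have "\<dots> \<le> K * enn2real (pint p (fst X)) powr (1 / p)" by (rule b[OF LLp(1)[OF X]])
      also have "\<dots> \<le> K * LL_norm p X"
      proof (intro mult_left_mono K0)
        have "pint p (fst X) = ennreal (Lp_norm p (fst X) powr p)"
          using Lp_norm_powr[OF LLp(1)[OF X]] p by simp
        then show "enn2real (pint p (fst X)) powr (1 / p) \<le> LL_norm p X"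
          unfolding LL_norm_def using p by (simp add: powr_mono2)
      qed
      finally show "\<bar>LINT x|lebesgue. fst X x * indicator E x\<bar> \<le> K * LL_norm p X" .
    qed
  qed
qed

text \<open>The inequality is tested on the sets where it fails in the limit, cut off by balls in order to have
  finite measure.\<close>

lemma LL_weak_le:
  fixes u v :: "'a::euclidean_space \<Rightarrow> real"
  assumes p: "1 < p" and u: "u \<in> Lp p" and v: "v \<in> Lp p" and un: "\<And>n. un n \<in> Lp p" and vn: "\<And>n. vn n \<in> Lp p"
    and le: "\<And>n. AE x in lebesgue. vn n x \<le> un n x"
    and wu: "LL_weak p \<Omega> (\<lambda>n. Pi_s (s n) (un n)) (Pi_s \<sigma> u)"
    and wv: "LL_weak p \<Omega> (\<lambda>n. Pi_s (s n) (vn n)) (Pi_s \<sigma> v)"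
  shows "AE x in lebesgue. v x \<le> u x"
proof -
  have [measurable]: "u \<in> borel_measurable lebesgue" "v \<in> borel_measurable lebesgue" using u v by (auto simp: Lp_iff)
  have E: "AE x in lebesgue. (v x - u x) * indicator ({x. u x < v x} \<inter> cball 0 (real m)) x = 0" for m :: nat
  proof -
    let ?E = "{x. u x < v x} \<inter> cball 0 (real m)"
    have "{x \<in> space lebesgue. u x < v x} \<in> sets lebesgue" by measurable
    then have E: "?E \<in> lmeasurable"
      by (intro fmeasurable_Int_fmeasurable[OF lmeasurable_cball, of _ 0 "real m", simplified Int_commute]) simp
    note F = LL_dual_integral(1)[OF p E, of \<Omega>] and i = LL_dual_integral(2)[OF p E]
    have "(\<lambda>n. LINT x|lebesgue. un n x * indicator ?E x) \<longlonglongrightarrow> (LINT x|lebesgue. u x * indicator ?E x)"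
      using wu[unfolded LL_weak_def, rule_format, OF F] by (simp add: Pi_s_def)
    moreover have "(\<lambda>n. LINT x|lebesgue. vn n x * indicator ?E x) \<longlonglongrightarrow> (LINT x|lebesgue. v x * indicator ?E x)"
      using wv[unfolded LL_weak_def, rule_format, OF F] by (simp add: Pi_s_def)
    moreover have "(LINT x|lebesgue. vn n x * indicator ?E x) \<le> (LINT x|lebesgue. un n x * indicator ?E x)" for n
      using le[of n] by (intro integral_mono_AE i un vn) (auto elim!: eventually_mono simp: indicator_def)
    ultimately have "(LINT x|lebesgue. v x * indicator ?E x) \<le> (LINT x|lebesgue. u x * indicator ?E x)"
      by (intro LIMSEQ_le) auto
    then have neg: "(LINT x|lebesgue. (v x - u x) * indicator ?E x) \<le> 0"
      unfolding left_diff_distrib by (subst Bochner_Integration.integral_diff[OF i[OF v] i[OF u]]) simp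
    have nn: "AE x in lebesgue. 0 \<le> (v x - u x) * indicator ?E x" by (intro AE_I2) (auto simp: indicator_def)
    have ii: "integrable lebesgue (\<lambda>x. (v x - u x) * indicator ?E x)"
      unfolding left_diff_distrib by (intro Bochner_Integration.integrable_diff i u v)
    have "(LINT x|lebesgue. (v x - u x) * indicator ?E x) = 0"
      using neg integral_nonneg_AE[OF nn] by linarith
    then show ?thesis using integral_nonneg_eq_0_iff_AE[OF ii nn] by simp
  qed
  have "AE x in lebesgue. \<forall>m::nat. (v x - u x) * indicator ({x. u x < v x} \<inter> cball 0 (real m)) x = 0"
    unfolding AE_all_countable using E by blast
  then show ?thesis
  proof eventually_elim
    case (elim x)
    obtain m :: nat where "norm x \<le> real m" using real_arch_simple by blast
    then show ?case using elim[rule_format, of m] by (auto simp: indicator_def split: if_splits)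
  qed
qed

theorem proposition5p1:
  fixes \<Omega> :: "'a::euclidean_space set"
    and p \<sigma> :: real
    and s :: "nat \<Rightarrow> real"
    and \<psi>n :: "nat \<Rightarrow> 'a \<Rightarrow> real"
    and \<psi> :: "'a \<Rightarrow> real"
  assumes "open \<Omega>"
    and "1 < p"
    and "\<And>n. 0 < s n \<and> s n < 1"
    and "incseq s"
    and "0 < \<sigma>" and "\<sigma> \<le> 1"
    and "s \<longlonglongrightarrow> \<sigma>"
    and "\<And>n. \<psi>n n \<in> Lam0 (s n) p \<Omega>"
    and "\<psi> \<in> Lam0 \<sigma> p \<Omega>"
    and "LL_weak p \<Omega> (\<lambda>n. Pi_s (s n) (\<psi>n n)) (Pi_s \<sigma> \<psi>)"
    and "\<And>n. AE x in lebesgue. \<psi>n n x \<le> \<psi> x"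
  shows "mosco_conv p \<Omega> s \<sigma> (\<lambda>n. obstacle_set (s n) p \<Omega> (\<psi>n n)) (obstacle_set \<sigma> p \<Omega> \<psi>)"
proof -
  note p = assms(2) and \<sigma> = assms(5,6)
  have sn: "0 < s n" "s n \<le> 1" for n using assms(3)[of n] by auto
  have s\<sigma>: "s n \<le> \<sigma>" for n by (rule incseq_le[OF assms(4,7)])
  have M1: "\<exists>un. (\<forall>n. un n \<in> obstacle_set (s n) p \<Omega> (\<psi>n n)) \<and> LL_strong p (\<lambda>n. Pi_s (s n) (un n)) (Pi_s \<sigma> u)"
    if u: "u \<in> obstacle_set \<sigma> p \<Omega> \<psi>" for u
  proof (intro exI[of _ "\<lambda>n. u"] conjI allI)
    \<comment> \<open>The recovery sequence is constant. The orders may reach \<open>\<sigma>\<close>, where there is nothing to prove.\<close>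
    have u0: "u \<in> Lam0 \<sigma> p \<Omega>" and ub: "AE x in lebesgue. u x \<ge> \<psi> x" using u by (auto simp: obstacle_set_def)
    obtain u' where u': "u' \<in> borel_measurable borel" "AE x in lborel. u x = u' x"
      using lebesgue_borel_rep[OF Lp_measurable[OF Lam0_Lp(1)[OF u0]]] by metis
    obtain g' where g': "g' \<in> borel_measurable borel" "AE x in lborel. wgrad \<sigma> u x = g' x"
      using lebesgue_borel_rep[OF Lp_measurable[OF Lam0_Lp(2)[OF u0]]] by metis
    have un: "u \<in> Lam0 (s n) p \<Omega>" for n
    proof (cases "s n = \<sigma>")
      case False
      then have "s n < \<sigma>" using s\<sigma>[of n] by simp
      then show ?thesis using Lam0_lower_order(1)[OF p sn(1) _ \<sigma>(2) u0 u' g'] by blast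
    qed (use u0 in simp)
    show "u \<in> obstacle_set (s n) p \<Omega> (\<psi>n n)" for n
      using un[of n] ub assms(11)[of n] by (auto simp: obstacle_set_def elim: eventually_elim2)
    define d where "d n = (\<lambda>x. 1 *\<^sub>R wgrad (s n) u x + (- 1) *\<^sub>R wgrad \<sigma> u x)" for n
    have dL: "d n \<in> Lp p" for n
      unfolding d_def using p by (intro Lp_lincomb Lam0_Lp(2)[OF un] Lam0_Lp(2)[OF u0]) auto
    have lim: "(\<lambda>n. Lp_norm p (d n) powr p) \<longlonglongrightarrow> 0"
    proof (rule LIMSEQ_I)
      fix r :: real assume r: "0 < r"
      then have r2: "0 < r / 2" by simp
      from wgrad_tendsto_from_below[OF p \<sigma> u0 this]
      obtain \<delta> where \<delta>: "0 < \<delta>" "\<And>t. 0 < t \<Longrightarrow> t < \<sigma> \<Longrightarrow> \<sigma> - t < \<delta> \<Longrightarrow>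
        pint p (\<lambda>x. wgrad t u x - wgrad \<sigma> u x) \<le> ennreal (r / 2)" by blast
      obtain N where N: "\<And>n. n \<ge> N \<Longrightarrow> norm (s n - \<sigma>) < \<delta>" using LIMSEQ_D[OF assms(7) \<delta>(1)] by blast
      have "norm (Lp_norm p (d n) powr p - 0) < r" if "n \<ge> N" for n
      proof -
        have "pint p (d n) \<le> ennreal (r / 2)"
        proof (cases "s n = \<sigma>")
          case True
          then show ?thesis using p by (simp add: d_def pint_def)
        next
          case False
          then have "s n < \<sigma>" using s\<sigma>[of n] by simp
          then show ?thesis using \<delta>(2)[OF sn(1)] N[OF that] by (simp add: d_def)
        qed
        then have "ennreal (Lp_norm p (d n) powr p) \<le> ennreal (r / 2)" using Lp_norm_powr[OF dL] p by simp
        then have "Lp_norm p (d n) powr p \<le> r / 2" using r by simp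
        then show ?thesis using r by simp
      qed
      then show "\<exists>N. \<forall>n\<ge>N. norm (Lp_norm p (d n) powr p - 0) < r" by blast
    qed
    have "LL_norm p (LL_lin 1 (Pi_s (s n) u) (- 1) (Pi_s \<sigma> u)) = (Lp_norm p (d n) powr p) powr (1 / p)" for n
    proof -
      have "Lp_norm p (\<lambda>x. 1 * u x + - 1 * u x) = 0" using p by (simp add: Lp_norm_def)
      then show ?thesis by (simp add: LL_norm_def LL_lin_def Pi_s_def d_def)
    qed
    moreover have "(\<lambda>n. (Lp_norm p (d n) powr p) powr (1 / p)) \<longlonglongrightarrow> 0 powr (1 / p)"
      using lim p by (intro tendsto_powr2) auto
    ultimately show "LL_strong p (\<lambda>n. Pi_s (s n) u) (Pi_s \<sigma> u)" by (simp add: LL_strong_def)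
  qed
  have M2: "u \<in> obstacle_set \<sigma> p \<Omega> \<psi>"
    if u: "u \<in> Lam0 \<sigma> p \<Omega>" and un: "\<forall>n. un n \<in> obstacle_set (s n) p \<Omega> (\<psi>n n)"
      and w: "LL_weak p \<Omega> (\<lambda>n. Pi_s (s n) (un n)) (Pi_s \<sigma> u)" for u un
  proof -
    have un0: "un n \<in> Lam0 (s n) p \<Omega>" "AE x in lebesgue. \<psi>n n x \<le> un n x" for n
      using un by (auto simp: obstacle_set_def)
    note unL = Lam0_Lp(1)[OF un0(1)] un0(2)
    have "AE x in lebesgue. \<psi> x \<le> u x"
      by (rule LL_weak_le[OF p Lam0_Lp(1)[OF u] Lam0_Lp(1)[OF assms(9)] unL(1) Lam0_Lp(1)[OF assms(8)] unL(2) w assms(10)])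
    then show ?thesis using u by (simp add: obstacle_set_def)
  qed
  show ?thesis
    unfolding mosco_conv_def
  proof (intro conjI allI ballI impI assms(7))
    show "obstacle_set (s n) p \<Omega> (\<psi>n n) \<subseteq> Lam0 (s n) p \<Omega>" for n by (auto simp: obstacle_set_def)
    show "convex_fun_set (obstacle_set (s n) p \<Omega> (\<psi>n n))" for n by (rule obstacle_set_convex[OF p sn])
    show "obstacle_set \<sigma> p \<Omega> \<psi> \<subseteq> Lam0 \<sigma> p \<Omega>" by (auto simp: obstacle_set_def)
    show "convex_fun_set (obstacle_set \<sigma> p \<Omega> \<psi>)" by (rule obstacle_set_convex[OF p \<sigma>])
  qed (use M1 M2 in blast)+
qed

end
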